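(* Let $w\in\mathfrak{S}_n$ be vexillary of shape $\lambda$, let $x$ be a positive integer, and let $\varphi:=\varphi(w)+(x,x,x,\dots)$. Then for every nonnegative integer $L$, $$FK(w,L)=\sum_{j=|\lambda|}^{L}\#\mathtt{SSYT}(\lambda,\varphi,j)\cdot j!\,S(L,j),$$ where $FK(w,L)$ is evaluated at this value of $x$.
   Context: The Lehmer code of $w$ is $c_i(w)=\#\{j>i:w(i)>w(j)\}$; $w$ is vexillary if it avoids $2143$; its shape $\lambda=\lambda(w)$ is the decreasing rearrangement of $c(w)$, with $\ell$ nonzero parts. The $0$-Hecke monoid has generators $T_1,\dots,T_{n-1}$ with $T_i^2=T_i$ and the braid relations; a $0$-Hecke word of length $L$ for $w$ is $(\sigma_{i_1},\dots,\sigma_{i_L})$ with $T_{i_1}\cdots T_{i_L}=T_w$. $FK(w,L):=\sum(x+i_1)(x+i_2)\cdots(x+i_L)$, summed over all $0$-Hecke words $(\sigma_{i_1},\dots,\sigma_{i_L})$ for $w$ of length $L$. The flag $\varphi(w)=(\varphi_1,\dots,\varphi_\ell)$: the Rothe diagram is $D(w)=\{(i,j)\in[n]\times[n]: w(i)>j,\ w^{-1}(j)>i\}$ (row $i$, column $j$); $\mu(w)$ is the smallest Ferrers shape, justified at the northwest corner of the $n\times n$ square, containing $D(w)$. Place $\lambda(w)$ at the northwest corner as well; the diagonal of row $i$ is the diagonal containing the rightmost box of $\lambda(w)$ in row $i$, and $\varphi_i$ is the row number of the southeasternmost box of $\mu(w)$ on that diagonal. Adding $(x,x,\dots)$ adds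 $x$ to each $\varphi_i$. A column-strict set-valued tableau of shape $\lambda$ assigns to each cell a finite nonempty set $T(y)$ of positive integers with $\max T(y)\le\min T(y')$ for $y$ left of $y'$ in a row and $\max T(y)<\min T(y')$ for $y$ above $y'$ in a column; it is flagged by $\varphi$ if $\max T(y)\le\varphi_i$ for every cell $y$ in row $i$. $\mathtt{SSYT}(\lambda,\varphi,j)$ is the set of such tableaux flagged by $\varphi$ with total number of entries $\sum_y\#T(y)=j$. $S(L,j)$ is the Stirling number of the second kind. *)

theory Defs
  imports
    "HOL-Combinatorics.Combinatorics"
    "HOL-Computational_Algebra.Polynomial"
begin

text \<open>A permutation in the symmetric group on n letters is a function w with
  \<^term>\<open>w permutes {1..n}\<close>. Rows, columns and positions are numbered from 1.\<close>

subsection \<open>Lehmer code, shape, vexillary permutations\<close>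

definition code :: "nat \<Rightarrow> (nat \<Rightarrow> nat) \<Rightarrow> nat \<Rightarrow> nat" where
  "code n w i = card {j \<in> {1..n}. i < j \<and> w j < w i}"

definition vexillary :: "nat \<Rightarrow> (nat \<Rightarrow> nat) \<Rightarrow> bool" where
  "vexillary n w \<longleftrightarrow>
     \<not> (\<exists>a\<in>{1..n}. \<exists>b\<in>{1..n}. \<exists>c\<in>{1..n}. \<exists>d\<in>{1..n}.
          a < b \<and> b < c \<and> c < d \<and> w b < w a \<and> w a < w d \<and> w d < w c)"

definition shape :: "nat \<Rightarrow> (nat \<Rightarrow> nat) \<Rightarrow> nat list" where
  "shape n w = rev (sort (filter (\<lambda>c. 0 < c) (map (code n w) [1..<Suc n])))"

text \<open>A partition is the list of its nonzero parts. List positions start at 0, so row i of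
  its diagram has length \<^term>\<open>lam ! (i - 1)\<close>; flags are lists indexed in the same way.\<close>

definition cells :: "nat list \<Rightarrow> (nat \<times> nat) set" where
  "cells lam = {(i, j). i \<in> {1..length lam} \<and> j \<in> {1..lam ! (i - 1)}}"

subsection \<open>The flag of a permutation\<close>

definition rothe :: "nat \<Rightarrow> (nat \<Rightarrow> nat) \<Rightarrow> (nat \<times> nat) set" where
  "rothe n w = {(i, j). i \<in> {1..n} \<and> j \<in> {1..n} \<and> j < w i \<and> i < inv w j}"

definition ferrers :: "nat \<Rightarrow> (nat \<times> nat) set \<Rightarrow> bool" where
  "ferrers n F \<longleftrightarrow> F \<subseteq> {1..n} \<times> {1..n} \<and>
     (\<forall>(i, j)\<in>F. \<forall>i'\<in>{1..i}. \<forall>j'\<in>{1..j}. (i', j') \<in> F)"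

definition mu :: "nat \<Rightarrow> (nat \<Rightarrow> nat) \<Rightarrow> (nat \<times> nat) set" where
  "mu n w = \<Inter> {F. ferrers n F \<and> rothe n w \<subseteq> F}"

text \<open>A box (r, c) is on the diagonal of the rightmost box of row i of the shape iff
  \<open>c - r = lam ! (i - 1) - i\<close>, lam being the shape. This is written without
  subtraction, which truncates on the natural numbers.\<close>

definition flag_entry :: "nat \<Rightarrow> (nat \<Rightarrow> nat) \<Rightarrow> nat \<Rightarrow> nat" where
  "flag_entry n w i = Max {r. \<exists>c. (r, c) \<in> mu n w \<and> c + i = r + shape n w ! (i - 1)}"

definition flag :: "nat \<Rightarrow> (nat \<Rightarrow> nat) \<Rightarrow> nat list" where
  "flag n w = map (flag_entry n w) [1..<Suc (length (shape n w))]"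

subsection \<open>The 0-Hecke monoid\<close>

text \<open>Words in the generators \<open>T\<^sub>1, \<dots>, T\<^bsub>n-1\<^esub>\<close> are lists over \<^term>\<open>{1..<n}\<close>. Two words
  have the same product in the presented monoid iff they are related by the congruence
  \<open>hecke_eq n\<close> generated by the defining relations.\<close>

inductive hecke_step :: "nat \<Rightarrow> nat list \<Rightarrow> nat list \<Rightarrow> bool" for n :: nat where
  idem: "\<lbrakk>u \<in> lists {1..<n}; v \<in> lists {1..<n}; i \<in> {1..<n}\<rbrakk>
     \<Longrightarrow> hecke_step n (u @ [i, i] @ v) (u @ [i] @ v)"
| comm: "\<lbrakk>u \<in> lists {1..<n}; v \<in> lists {1..<n}; i \<in> {1..<n}; j \<in> {1..<n}; Suc i < j\<rbrakk>
     \<Longrightarrow> hecke_step n (u @ [i, j] @ v) (u @ [j, i] @ v)"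
| braid: "\<lbrakk>u \<in> lists {1..<n}; v \<in> lists {1..<n}; i \<in> {1..<n}; Suc i \<in> {1..<n}\<rbrakk>
     \<Longrightarrow> hecke_step n (u @ [i, Suc i, i] @ v) (u @ [Suc i, i, Suc i] @ v)"

definition hecke_eq :: "nat \<Rightarrow> nat list \<Rightarrow> nat list \<Rightarrow> bool" where
  "hecke_eq n = equivclp (hecke_step n)"

text \<open>The permutation \<open>\<sigma>\<^bsub>i\<^sub>1\<^esub> \<cdots> \<sigma>\<^bsub>i\<^sub>L\<^esub>\<close>, where \<open>\<sigma>\<^sub>i\<close> exchanges i and i + 1 and
  products are compositions of functions.\<close>

definition word_perm :: "nat list \<Rightarrow> nat \<Rightarrow> nat" where
  "word_perm a = foldr (\<lambda>i f. Transposition.transpose i (Suc i) \<circ> f) a id"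

definition reduced_word :: "nat \<Rightarrow> (nat \<Rightarrow> nat) \<Rightarrow> nat list \<Rightarrow> bool" where
  "reduced_word n w a \<longleftrightarrow> a \<in> lists {1..<n} \<and> word_perm a = w \<and>
     (\<forall>b \<in> lists {1..<n}. word_perm b = w \<longrightarrow> length a \<le> length b)"

text \<open>\<open>T\<^sub>w\<close> is the product of the generators along any reduced word of w.\<close>

definition hecke_words :: "nat \<Rightarrow> (nat \<Rightarrow> nat) \<Rightarrow> nat \<Rightarrow> nat list set" where
  "hecke_words n w L =
     {a \<in> lists {1..<n}. length a = L \<and> (\<exists>r. reduced_word n w r \<and> hecke_eq n a r)}"

text \<open>\<open>FK(w,L)\<close> as a polynomial in x; the linear factor \<^term>\<open>[:i, 1:]\<close> is \<open>x + i\<close>.\<close>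

definition FK :: "nat \<Rightarrow> (nat \<Rightarrow> nat) \<Rightarrow> nat \<Rightarrow> nat poly" where
  "FK n w L = (\<Sum>a\<in>hecke_words n w L. prod_list (map (\<lambda>i. [:i, 1:]) a))"

subsection \<open>Flagged set-valued tableaux\<close>

text \<open>Tableaux are total functions; requiring the value \<^term>\<open>{}\<close> outside the diagram makes
  each tableau be counted once.\<close>

definition set_valued_tableau :: "nat list \<Rightarrow> (nat \<times> nat \<Rightarrow> nat set) \<Rightarrow> bool" where
  "set_valued_tableau lam T \<longleftrightarrow>
     (\<forall>y\<in>cells lam. finite (T y) \<and> T y \<noteq> {} \<and> T y \<subseteq> {1..}) \<and>
     (\<forall>y. y \<notin> cells lam \<longrightarrow> T y = {}) \<and>
     (\<forall>i j j'. (i, j) \<in> cells lam \<and> (i, j') \<in> cells lam \<and> j < j'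
        \<longrightarrow> Max (T (i, j)) \<le> Min (T (i, j'))) \<and>
     (\<forall>i i' j. (i, j) \<in> cells lam \<and> (i', j) \<in> cells lam \<and> i < i'
        \<longrightarrow> Max (T (i, j)) < Min (T (i', j)))"

definition flagged :: "nat list \<Rightarrow> nat list \<Rightarrow> (nat \<times> nat \<Rightarrow> nat set) \<Rightarrow> bool" where
  "flagged lam phi T \<longleftrightarrow> (\<forall>(i, j)\<in>cells lam. Max (T (i, j)) \<le> phi ! (i - 1))"

definition SSYT :: "nat list \<Rightarrow> nat list \<Rightarrow> nat \<Rightarrow> (nat \<times> nat \<Rightarrow> nat set) set" where
  "SSYT lam phi k = {T. set_valued_tableau lam T \<and> flagged lam phi T \<and> (\<Sum>y\<in>cells lam. card (T y)) = k}"

end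

theory Submission
  imports Defs
begin

text \<open>
  Write \<open>y = e\<^sup>t - 1\<close>. Since \<open>j! S(L,j)\<close> is the coefficient of \<open>t\<^sup>L/L!\<close> in \<open>y\<^sup>j\<close>, the claim is that
  the exponential generating function \<open>F\<^sub>w\<close> of the numbers \<open>FK(w,L)\<close> equals the generating
  function of flagged set-valued tableaux at \<open>y\<close>. Replacing w by \<open>1\<^sub>x \<times> w\<close> turns the weight
  \<open>x + i\<close> into the index of the letter. Then \<open>F' = F \<circ> D\<close> for the operator
  \<open>D w = \<Sum> k (w + \<sigma>\<^sub>k w)\<close>, the sum being over the left descents k of w.

  Let r be the last row with a nonzero code, s maximal with \<open>w(s) < w(r)\<close>, and \<open>v = w t\<^bsub>rs\<^esub>\<close>.
  Lascoux's transition formula for Grothendieck polynomials, with all variables equal to y, reads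
  \<open>F\<^sub>v + F\<^sub>w = (1 + y) \<Sum> F\<^sub>u\<close>, where u ranges over v and certain products of v
  with transpositions \<open>t\<^bsub>ir\<^esub>\<close>, \<open>i < r\<close>. Both sides satisfy the same linear differential equation,
  because the commutators of D with the two operators sending v to these sums are diagonal and
  differ by 1, which accounts for the derivative of the factor \<open>1 + y\<close>;
  this proves the formula. If w is vexillary, at most one transposition occurs, the code of v
  arises from that of w by decreasing the entry in row r, and the code of \<open>u = v t\<^bsub>ir\<^esub>\<close> by
  exchanging the entries in rows i and r. The resulting recursion \<open>F\<^sub>w = y F\<^sub>v + (1 + y) F\<^sub>u\<close> is the
  classification of flagged tableaux by the set S in a corner of the shape whose flag is r:
  \<open>S = {r}\<close> gives v, and \<open>r \<notin> S\<close> or \<open>{r} \<subset> S\<close> gives u.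
\<close>

subsection \<open>The transition formula for weighted Hecke words\<close>

abbreviation swap :: "nat \<Rightarrow> nat \<Rightarrow> nat \<Rightarrow> nat" where
  "swap \<equiv> Transposition.transpose"

lemmas swap_def = Transposition.transpose_def

abbreviation adj :: "nat \<Rightarrow> nat \<Rightarrow> nat" where
  "adj k \<equiv> swap k (Suc k)"

text \<open>Below, g is the inverse of a permutation v, so that it maps values to positions and the left
  descents of v are the descents of g.\<close>

definition dstep :: "((nat \<Rightarrow> nat) \<Rightarrow> int) \<Rightarrow> (nat \<Rightarrow> nat) \<Rightarrow> nat \<Rightarrow> int" where
  "dstep f g k = (if g (Suc k) < g k then f g + f (g \<circ> adj k) else 0)"

definition cyc :: "nat \<Rightarrow> nat set \<Rightarrow> nat \<Rightarrow> nat" where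
  "cyc r S x = (if x = r then Min (insert r S)
     else if x \<in> S then Min {y \<in> insert r S. x < y} else x)"

definition records :: "nat \<Rightarrow> (nat \<Rightarrow> nat) \<Rightarrow> nat set" where
  "records r v = {i. i < r \<and> 0 < v i \<and> v i < v r \<and>
     (\<forall>j. i < j \<and> j < r \<and> v j < v r \<longrightarrow> v j < v i)}"

text \<open>For \<open>S = {i\<^sub>1 < \<dots> < i\<^sub>p}\<close>, the inverse of \<^term>\<open>cyc r S \<circ> g\<close> is
  \<open>v t\<^bsub>i\<^sub>1r\<^esub> \<cdots> t\<^bsub>i\<^sub>pr\<^esub>\<close>; the set of records consists of the \<open>i < r\<close> for which
  \<open>v t\<^bsub>ir\<^esub>\<close> covers v in Bruhat order.\<close>

definition upper :: "nat \<Rightarrow> ((nat \<Rightarrow> nat) \<Rightarrow> int) \<Rightarrow> (nat \<Rightarrow> nat) \<Rightarrow> int" where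
  "upper r f g = (\<Sum>S\<in>Pow (records r (inv g)). f (cyc r S \<circ> g))"

lemma cyc_self: "cyc r S r = Min (insert r S)"
  by (simp add: cyc_def)

lemma cyc_outside: "x \<noteq> r \<Longrightarrow> x \<notin> S \<Longrightarrow> cyc r S x = x"
  by (simp add: cyc_def)

lemma cyc_inside_gt:
  assumes "finite S" "S \<subseteq> {..<r}" "x \<in> S"
  shows "x < cyc r S x" "cyc r S x \<le> r"
proof -
  have 1: "cyc r S x = Min {y \<in> insert r S. x < y}"
    using assms by (auto simp: cyc_def)
  have r: "r \<in> {y \<in> insert r S. x < y}" and fin: "finite {y \<in> insert r S. x < y}"
    using assms by auto
  have "Min {y \<in> insert r S. x < y} \<in> {y \<in> insert r S. x < y}"
    using r fin by (intro Min_in) auto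
  then show "x < cyc r S x" using 1 by auto
  show "cyc r S x \<le> r" using 1 Min_le[OF fin r] by simp
qed

lemma cyc_self_le: "finite S \<Longrightarrow> cyc r S r \<le> r"
  by (simp add: cyc_self)

lemma cyc_self_gt:
  assumes "finite S" "q < r" "\<And>y. y \<in> S \<Longrightarrow> q < y"
  shows "q < cyc r S r"
  using assms by (simp add: cyc_self)

lemma cyc_inside_next:
  assumes "finite S" "S \<subseteq> {..<r}" "x \<in> S" "y \<in> insert r S" "x < y"
    "\<And>z. z \<in> S \<Longrightarrow> z \<le> x \<or> y \<le> z"
  shows "cyc r S x = y"
proof -
  have "cyc r S x = Min {y \<in> insert r S. x < y}"
    using assms by (auto simp: cyc_def)
  also have "\<dots> = y"
    using assms by (intro Min_eqI) fastforce+
  finally show ?thesis .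
qed

lemma cyc_inside_gt2:
  assumes "finite S" "S \<subseteq> {..<r}" "x \<in> S" "p < r"
    "\<And>z. z \<in> S \<Longrightarrow> z \<le> x \<or> p < z"
  shows "p < cyc r S x"
proof -
  have 1: "cyc r S x = Min {y \<in> insert r S. x < y}"
    using assms by (auto simp: cyc_def)
  have r: "r \<in> {y \<in> insert r S. x < y}" and fin: "finite {y \<in> insert r S. x < y}"
    using assms by auto
  have "Min {y \<in> insert r S. x < y} \<in> {y \<in> insert r S. x < y}"
    using r fin by (intro Min_in) auto
  then have "Min {y \<in> insert r S. x < y} = r \<or> (Min {y \<in> insert r S. x < y} \<in> S \<and> x < Min {y \<in> insert r S. x < y})"
    by blast
  then show ?thesis using 1 assms(4,5) by fastforce
qed

lemma cyc_merge:
  assumes "finite S" "S \<subseteq> {..<r}" "q \<in> S" "p \<in> S" "q < p"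
    "\<And>z. z \<in> S \<Longrightarrow> z \<le> q \<or> p \<le> z"
  shows "cyc r S \<circ> swap q p = cyc r (S - {p})"
proof
  fix x
  have pr: "p < r" "q < r" using assms by auto
  consider "x = p" | "x = q" | "x = r" | "x \<in> S" "x \<noteq> p" "x \<noteq> q" "x \<noteq> r" | "x \<notin> S" "x \<noteq> r" by blast
  then show "(cyc r S \<circ> swap q p) x = cyc r (S - {p}) x"
  proof cases
    case 1
    have "cyc r S q = p" using assms by (intro cyc_inside_next) auto
    then show ?thesis using 1 pr by (simp add: cyc_outside)
  next
    case 2
    have e: "{y \<in> insert r S. p < y} = {y \<in> insert r (S - {p}). q < y}"
      using assms pr by (auto) (metis less_le_not_le linorder_neqE_nat order.trans)
    show ?thesis using 2 pr assms e by (simp add: cyc_def)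
  next
    case 3
    have "Min (insert r S) = Min (insert r (S - {p}))"
    proof (rule Min_eqI)
      show "finite (insert r S)" using assms by simp
      show "Min (insert r (S - {p})) \<in> insert r S"
        using Min_in[of "insert r (S - {p})"] assms(1) by auto
      fix y assume y: "y \<in> insert r S"
      have le: "Min (insert r (S - {p})) \<le> z" if "z \<in> insert r (S - {p})" for z
        using that assms(1) by (intro Min_le) auto
      show "Min (insert r (S - {p})) \<le> y"
      proof (cases "y = p")
        case True
        have "Min (insert r (S - {p})) \<le> q" using le[of q] assms by auto
        then show ?thesis using True assms(5) by linarith
      next
        case False
        then show ?thesis using y le by auto
      qed
    qed
    then show ?thesis using 3 pr by (simp add: cyc_self)
  next
    case 4
    have "Min {y \<in> insert r S. x < y} = Min {y \<in> insert r (S - {p}). x < y}" (is "Min ?A = Min ?B")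
    proof (rule Min_eqI)
      have rB: "r \<in> ?B" using 4 assms by auto
      have fB: "finite ?B" using assms by simp
      show "finite ?A" using assms by simp
      show "Min ?B \<in> ?A" using Min_in[OF fB] rB by blast
      fix y assume y: "y \<in> ?A"
      show "Min ?B \<le> y"
      proof (cases "y = p")
        case True
        have "x < q" using 4 y True assms(6)[of x] by auto
        then have "Min ?B \<le> q" using assms fB by (intro Min_le) auto
        then show ?thesis using True assms(5) by linarith
      next
        case False
        then show ?thesis using y fB by (intro Min_le) auto
      qed
    qed
    then show ?thesis using 4 pr by (simp add: cyc_def)
  next
    case 5
    then have "x \<noteq> p" "x \<noteq> q" using assms by auto
    then show ?thesis using 5 pr by (simp add: cyc_def)
  qed
qed

lemma cyc_drop_Min:
  assumes "finite S" "S \<subseteq> {..<r}" "q < r" "\<And>z. z \<in> S \<Longrightarrow> q < z"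
  shows "cyc r (insert q S) \<circ> swap q r = cyc r S"
proof
  fix x
  have qS: "q \<notin> S" using assms by auto
  consider "x = q" | "x = r" | "x \<in> S" "x \<noteq> q" "x \<noteq> r" | "x \<notin> S" "x \<noteq> r" "x \<noteq> q" by blast
  then show "(cyc r (insert q S) \<circ> swap q r) x = cyc r S x"
  proof cases
    case 1
    have "Min (insert r (insert q S)) = q"
      using assms by (intro Min_eqI) (auto dest: assms(4) simp: less_imp_le)
    then show ?thesis using 1 assms qS by (simp add: cyc_def)
  next
    case 2
    have "{y \<in> insert r (insert q S). q < y} = insert r S" using assms by auto
    then show ?thesis using 2 assms qS by (simp add: cyc_def)
  next
    case 3
    then have "{y \<in> insert r (insert q S). x < y} = {y \<in> insert r S. x < y}"
      using assms(4)[of x] by auto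
    then show ?thesis using 3 by (simp add: cyc_def)
  next
    case 4
    then show ?thesis by (simp add: cyc_def)
  qed
qed

lemma sum_Pow_insert:
  fixes F :: "'a set \<Rightarrow> int"
  assumes "finite A" "x \<notin> A"
  shows "(\<Sum>S\<in>Pow (insert x A). F S) = (\<Sum>S\<in>Pow A. F S + F (insert x S))"
proof -
  have "(\<Sum>S\<in>Pow (insert x A). F S) = (\<Sum>S\<in>Pow A. F S) + (\<Sum>S\<in>insert x ` Pow A. F S)"
    unfolding Pow_insert using assms by (intro sum.union_disjoint) auto
  also have "(\<Sum>S\<in>insert x ` Pow A. F S) = (\<Sum>S\<in>Pow A. F (insert x S))"
    using assms by (subst sum.reindex) (auto simp: inj_on_def)
  finally show ?thesis by (simp add: sum.distrib)
qed

lemma comp_adj: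
  assumes "inj g"
  shows "g \<circ> adj k = swap (g k) (g (Suc k)) \<circ> g"
  using assms by (auto simp: fun_eq_iff swap_def dest: injD)

lemma inv_comp_adj:
  assumes "bij g"
  shows "inv (g \<circ> adj k) = adj k \<circ> inv g"
  using assms by (simp add: o_inv_distrib)

lemma finite_records: "finite (records r v)"
  by (rule finite_subset[of _ "{..<r}"]) (auto simp: records_def)

lemma records_less: "S \<subseteq> records r v \<Longrightarrow> S \<subseteq> {..<r}"
  by (auto simp: records_def)

lemma sum_dstep_same:
  assumes "finite A"
    and "\<And>S. S \<subseteq> A \<Longrightarrow> cyc r S (g (Suc k)) < cyc r S (g k)"
  shows "(\<Sum>S\<in>Pow A. dstep f (cyc r S \<circ> g) k) =
    (\<Sum>S\<in>Pow A. f (cyc r S \<circ> g)) + (\<Sum>S\<in>Pow A. f (cyc r S \<circ> (g \<circ> adj k)))"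
  using assms(2) by (simp add: dstep_def o_assoc sum.distrib)

lemma adj_less_iff:
  "adj k x < adj k y \<longleftrightarrow> (if x = k \<and> y = Suc k then False else if x = Suc k \<and> y = k then True else x < y)"
  by (auto simp: swap_def)

lemma adj_pos: "0 < k \<Longrightarrow> 0 < adj k x \<longleftrightarrow> 0 < x"
  by (auto simp: swap_def)

text \<open>Summed over k with weight k, this lemma and lower_dstep compute the commutators of the two
  transition operators with the operator D.\<close>

lemma upper_dstep:
  fixes r :: nat
  assumes g: "bij g" and k: "0 < k"
  defines "a \<equiv> inv g r"
  shows "(\<Sum>S\<in>Pow (records r (inv g)). dstep f (cyc r S \<circ> g) k) =
    dstep (upper r f) g k + (if Suc k = a \<and> g k < r then upper r f g else 0)
      - (if k = a \<and> g (Suc k) < r then upper r f g else 0)"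
proof -
  define v where "v = inv g"
  define p where "p = g k"
  define q where "q = g (Suc k)"
  define I where "I = records r v"
  define I' where "I' = records r (adj k \<circ> v)"
  have inj: "inj g" using g by (simp add: bij_is_inj)
  have vg: "v (g m) = m" for m using inj by (simp add: v_def)
  have gv: "g (v i) = i" for i using g by (simp add: v_def bij_is_surj surj_f_inv_f)
  have vp: "v i = k \<longleftrightarrow> i = p" for i using vg gv p_def by metis
  have vq: "v i = Suc k \<longleftrightarrow> i = q" for i using vg gv q_def by metis
  have vpp: "v p = k" and vqq: "v q = Suc k" using vp vq by blast+
  have vinj: "v i = v j \<longleftrightarrow> i = j" for i j using gv by metis
  have ra: "v r = a" by (simp add: a_def v_def)
  have pq: "p \<noteq> q" using vp[of q] vq[of q] by simp
  have pr: "p = r \<longleftrightarrow> k = a" using vp[of r] ra by metis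
  have qr: "q = r \<longleftrightarrow> Suc k = a" using vq[of r] ra by metis
  have I'I: "inv (g \<circ> adj k) = adj k \<circ> v" using g by (simp add: inv_comp_adj v_def)
  have finI: "finite I" "finite I'" by (simp_all add: I_def I'_def finite_records)
  have sub: "S \<subseteq> {..<r}" "finite S" if "S \<subseteq> I" for S
    using that finI(1) records_less[of S r v] finite_subset by (auto simp: I_def)
  have up: "upper r f g = (\<Sum>S\<in>Pow I. f (cyc r S \<circ> g))"
    by (simp add: upper_def I_def v_def)
  have up': "upper r f (g \<circ> adj k) = (\<Sum>S\<in>Pow I'. f (cyc r S \<circ> (g \<circ> adj k)))"
    using I'I by (simp add: upper_def I'_def)
  have gs: "g \<circ> adj k = swap q p \<circ> g"
    using comp_adj[OF inj, of k] by (simp add: p_def q_def transpose_commute)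
  have gs2: "h \<circ> (g \<circ> adj k) = (h \<circ> swap q p) \<circ> g" for h :: "nat \<Rightarrow> nat"
    unfolding gs by (rule o_assoc)
  have gs3: "h \<circ> g \<circ> adj k = (h \<circ> swap q p) \<circ> g" for h :: "nat \<Rightarrow> nat"
    using gs2 unfolding o_assoc .
  have Idef: "i \<in> I \<longleftrightarrow> i < r \<and> 0 < v i \<and> v i < a \<and> (\<forall>j. i < j \<and> j < r \<and> v j < a \<longrightarrow> v j < v i)" for i
    by (simp add: I_def records_def ra)
  have I'def: "i \<in> I' \<longleftrightarrow> i < r \<and> 0 < v i \<and> adj k (v i) < adj k a \<and>
      (\<forall>j. i < j \<and> j < r \<and> adj k (v j) < adj k a \<longrightarrow> adj k (v j) < adj k (v i))" for i
    using k by (simp add: I'_def records_def ra adj_pos)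
  have adjv: "adj k (v i) = (if i = p then Suc k else if i = q then k else v i)" for i
    using vp vq by (auto simp: swap_def)
  have adja: "adj k a = (if p = r then Suc k else if q = r then k else a)"
    using adjv[of r] by (simp add: ra)
  have desc: "cyc r S (g (Suc k)) < cyc r S (g k) \<longleftrightarrow> cyc r S q < cyc r S p" for S
    by (simp add: p_def q_def)
  have D: "dstep (upper r f) g k = (if q < p then upper r f g + upper r f (g \<circ> adj k) else 0)"
    by (simp add: dstep_def p_def q_def)
  have LHS0: "(\<Sum>S\<in>Pow I. dstep f (cyc r S \<circ> g) k) = 0"
    if "\<And>S. S \<subseteq> I \<Longrightarrow> \<not> cyc r S q < cyc r S p"
    using that by (intro sum.neutral) (auto simp: dstep_def desc)
  have same: "(\<Sum>S\<in>Pow I. dstep f (cyc r S \<circ> g) k) = upper r f g + upper r f (g \<circ> adj k)"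
    if "I' = I" "\<And>S. S \<subseteq> I \<Longrightarrow> cyc r S q < cyc r S p"
    using sum_dstep_same[OF finI(1), of r g k f] that desc up up' by simp
  have goal: "(\<Sum>S\<in>Pow I. dstep f (cyc r S \<circ> g) k) =
    dstep (upper r f) g k + (if q = r \<and> p < r then upper r f g else 0)
      - (if p = r \<and> q < r then upper r f g else 0)"
  proof (cases "p < q")
    case asc: True
    show ?thesis
    proof (cases "q = r")
      case True
      have aS: "a = Suc k" using True qr by simp
      have below: "v j < k" if "v j < a" "j \<noteq> p" for j
        using that vp[of j] aS by linarith
      have pI: "p \<in> I" using asc True vpp k below by (auto simp: Idef aS)
      have pmin: "p < z" if "z \<in> I" "z \<noteq> p" for z
      proof (rule ccontr)
        assume "\<not> p < z"
        then have "z < p" using that by simp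
        then have "v p < v z" using that pI by (simp add: Idef)
        then show False using that below[of z] vpp by (simp add: Idef)
      qed
      define J where "J = I - {p}"
      have J: "I = insert p J" "p \<notin> J" "finite J" using pI finI by (auto simp: J_def)
      have "(\<Sum>S\<in>Pow I. dstep f (cyc r S \<circ> g) k) =
        (\<Sum>S\<in>Pow J. dstep f (cyc r S \<circ> g) k + dstep f (cyc r (insert p S) \<circ> g) k)"
        unfolding J(1) by (rule sum_Pow_insert[OF J(3,2)])
      also have "\<dots> = (\<Sum>S\<in>Pow J. f (cyc r S \<circ> g) + f (cyc r (insert p S) \<circ> g))"
      proof (rule sum.cong[OF refl])
        fix S assume "S \<in> Pow J"
        then have S: "S \<subseteq> I" "p \<notin> S" "S \<subseteq> {..<r}" "finite S" "\<And>z. z \<in> S \<Longrightarrow> p < z"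
          and S': "insert p S \<subseteq> {..<r}" "finite (insert p S)"
          using sub[of S] sub[of "insert p S"] J pmin by auto
        have "cyc r S p = p" using S asc True by (simp add: cyc_outside)
        moreover have "p < cyc r S q" using S asc True cyc_self_gt[of S p r] by simp
        ultimately have 1: "dstep f (cyc r S \<circ> g) k = 0" by (simp add: dstep_def desc)
        have "cyc r (insert p S) r = p" unfolding cyc_self
          using S asc True by (intro Min_eqI) (auto dest: S(5) simp: less_imp_le)
        moreover have "p < cyc r (insert p S) p" using S' by (intro cyc_inside_gt) auto
        ultimately have "cyc r (insert p S) q < cyc r (insert p S) p" using True by simp
        moreover have "cyc r (insert p S) \<circ> g \<circ> adj k = cyc r S \<circ> g"
        proof -
          have "cyc r (insert p S) \<circ> swap p r = cyc r S"
            using S asc True by (intro cyc_drop_Min) auto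
          then show ?thesis unfolding gs3 True by (simp add: transpose_commute)
        qed
        ultimately show "dstep f (cyc r S \<circ> g) k + dstep f (cyc r (insert p S) \<circ> g) k =
          f (cyc r S \<circ> g) + f (cyc r (insert p S) \<circ> g)"
          using 1 by (simp add: dstep_def desc)
      qed
      also have "\<dots> = upper r f g"
        unfolding up J(1) by (rule sum_Pow_insert[OF J(3,2), symmetric])
      finally show ?thesis using asc True D by simp
    next
      case qnr: False
      have "\<not> cyc r S q < cyc r S p" if S: "S \<subseteq> I" for S
      proof (cases "p < r")
        case False
        then have "q \<notin> S" "p \<notin> S" using asc S sub[OF S] by auto
        then have "cyc r S q = q" using qnr by (simp add: cyc_outside)
        moreover have "cyc r S p \<le> p"
          using cyc_outside[of p r S] cyc_self_le[OF sub(2)[OF S], of r] \<open>p \<notin> S\<close> by (cases "p = r") auto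
        ultimately show ?thesis using asc by simp
      next
        case True
        have qS: "q \<le> cyc r S q" using cyc_outside[of q r S] cyc_inside_gt(1)[of S r q] sub[OF S] qnr by (cases "q \<in> S") auto
        show ?thesis
        proof (cases "p \<in> S")
          case False
          then show ?thesis using qS True asc by (simp add: cyc_outside)
        next
          case pS: True
          then have "p \<in> I" using S by auto
          then have "\<not> q < r" using asc vpp vqq qnr qr by (fastforce simp: Idef)
          moreover have "cyc r S p \<le> r" using sub[OF S] pS by (intro cyc_inside_gt)
          ultimately show ?thesis using qS by simp
        qed
      qed
      then show ?thesis using LHS0 asc qnr D by simp
    qed
  next
    case False
    then have desc': "q < p" using pq by simp
    show ?thesis
    proof (cases "p = r")
      case True
      have ak: "a = k" using True pr by simp
      have I'mem: "i \<in> I' \<longleftrightarrow> i = q \<or> (i \<in> I \<and> q < i)" for i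
      proof (cases "i = q")
        case True
        then show ?thesis
          using desc' \<open>p = r\<close> k vqq pq vp by (auto simp: I'def adjv adja less_Suc_eq)
      next
        case False
        have *: "adj k (v j) < adj k a \<longleftrightarrow> v j < a \<or> j = q" if "j < r" for j
          using that vp[of j] True ak by (auto simp: adjv adja less_Suc_eq)
        have **: "adj k (v j) = (if j = q then k else v j)" if "j < r" for j
          using that True by (simp add: adjv)
        have nk: "\<not> k < v i" if "v i < a" using that ak by simp
        show ?thesis
        proof
          assume i: "i \<in> I'"
          then have 1: "i < r" "0 < v i" "v i < a" using False by (auto simp: I'def *)
          have "\<not> i < q"
          proof
            assume "i < q"
            then have "adj k (v q) < adj k (v i)"
              using i desc' True *[of q] unfolding I'def by blast
            then show False using **[of q] **[of i] 1 False nk desc' True by simp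
          qed
          moreover have "v j < v i" if "i < j" "j < r" "v j < a" for j
          proof -
            have "adj k (v j) < adj k (v i)" using i that *[of j] unfolding I'def by blast
            then show ?thesis using **[of j] **[of i] that 1 False \<open>\<not> i < q\<close> by simp
          qed
          ultimately show "i = q \<or> (i \<in> I \<and> q < i)" using 1 False by (auto simp: Idef)
        next
          assume "i = q \<or> (i \<in> I \<and> q < i)"
          moreover have "adj k a = Suc k" using True by (simp add: adja)
          moreover have "v j < Suc k \<longleftrightarrow> v j < a" if "j < r" for j
            using that vp[of j] True ak by (auto simp: less_Suc_eq)
          ultimately show "i \<in> I'" using False by (auto simp: I'def Idef **)
        qed
      qed
      define J where "J = {i \<in> I. q < i}"
      have qJ: "q \<notin> J" "finite J" "J \<subseteq> I" "I' = insert q J" "q \<notin> I"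
        using finI I'mem vqq ak by (auto simp: J_def Idef)
      have step: "dstep f (cyc r S \<circ> g) k = (if S \<subseteq> J then f (cyc r S \<circ> g) + f (cyc r S \<circ> (g \<circ> adj k)) else 0)"
        if S: "S \<subseteq> I" for S
      proof -
        have "cyc r S q = q" using qJ S desc' True by (intro cyc_outside) auto
        moreover have "cyc r S p = Min (insert r S)" using True by (simp add: cyc_self)
        moreover have "q < Min (insert r S) \<longleftrightarrow> S \<subseteq> J"
          using sub[OF S] S desc' True by (auto simp: J_def)
        ultimately show ?thesis by (simp add: dstep_def desc o_assoc)
      qed
      have "(\<Sum>S\<in>Pow I. dstep f (cyc r S \<circ> g) k) =
        (\<Sum>S\<in>Pow J. f (cyc r S \<circ> g) + f (cyc r S \<circ> (g \<circ> adj k)))"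
        using qJ finI by (intro sum.mono_neutral_cong_right) (auto simp: step)
      also have "\<dots> = (\<Sum>S\<in>Pow J. f (cyc r (insert q S) \<circ> (g \<circ> adj k)) + f (cyc r S \<circ> (g \<circ> adj k)))"
      proof (rule sum.cong[OF refl])
        fix S assume "S \<in> Pow J"
        then have S: "S \<subseteq> {..<r}" "finite S" "\<And>z. z \<in> S \<Longrightarrow> q < z"
          using sub[of S] qJ by (auto simp: J_def)
        have "cyc r (insert q S) \<circ> swap q r = cyc r S"
          using S desc' True by (intro cyc_drop_Min) auto
        then show "f (cyc r S \<circ> g) + f (cyc r S \<circ> (g \<circ> adj k)) =
            f (cyc r (insert q S) \<circ> (g \<circ> adj k)) + f (cyc r S \<circ> (g \<circ> adj k))"
          unfolding gs2 True by simp
      qed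
      also have "\<dots> = upper r f (g \<circ> adj k)"
        unfolding up' qJ(4) using sum_Pow_insert[OF qJ(2,1), of "\<lambda>S. f (cyc r S \<circ> (g \<circ> adj k))"]
        by (simp add: add.commute)
      finally show ?thesis using D desc' True by simp
    next
      case pnr: False
      show ?thesis
      proof (cases "q \<in> I \<and> p \<in> I")
        case True
        have I'mem: "i \<in> I' \<longleftrightarrow> i \<in> I \<and> i \<noteq> q" for i
        proof -
          have f: "q \<noteq> r" "q < r" "p < r" "Suc k < a" using True vpp vqq by (auto simp: Idef)
          have m: "adj k (v j) < adj k a \<longleftrightarrow> v j < a" for j
            using f pnr vpp vqq by (auto simp: adjv adja)
          show ?thesis
          proof (cases "i = q")
            case True
            then show ?thesis using f pnr desc' m[of p] vpp by (auto simp: I'def m adjv intro!: exI[of _ p])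
          next
            case False
            have "adj k (v j) < adj k (v i) \<longleftrightarrow> v j < v i" if "i < j" for j
              using False that vp vq vpp vqq desc' adj_less_iff[of k "v j" "v i"] by auto
            then show ?thesis using False by (auto simp: I'def Idef m)
          qed
        qed
        define J where "J = I - {p, q}"
        have J: "finite J" "p \<notin> J" "q \<notin> insert p J" "I = insert q (insert p J)" "I' = insert p J"
          using True pq finI I'mem by (auto simp: J_def)
        have between: "z \<le> q \<or> p \<le> z" if "z \<in> I" for z
        proof (rule ccontr)
          assume "\<not> ?thesis"
          then have "v z < v q" "v p < v z" using that True by (auto simp: Idef)
          then show False using vpp vqq by simp
        qed
        have psr: "p < r" "q < r" using True by (auto simp: Idef)
        have split: "(\<Sum>S\<in>Pow I. F S) = (\<Sum>S\<in>Pow J. F S + F (insert p S) + (F (insert q S) + F (insert q (insert p S))))" for F :: "nat set \<Rightarrow> int"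
        proof -
          have "(\<Sum>S\<in>Pow I. F S) = (\<Sum>S\<in>Pow (insert p J). F S + F (insert q S))"
            unfolding J(4) using J by (intro sum_Pow_insert) auto
          also have "\<dots> = (\<Sum>S\<in>Pow J. F S + F (insert q S) + (F (insert p S) + F (insert q (insert p S))))"
            using J by (intro sum_Pow_insert) auto
          finally show ?thesis by (simp add: ac_simps)
        qed
        have "(\<Sum>S\<in>Pow I. dstep f (cyc r S \<circ> g) k) =
          (\<Sum>S\<in>Pow J. f (cyc r S \<circ> g) + f (cyc r (insert p S) \<circ> g) + (f (cyc r (insert q S) \<circ> g) +
            f (cyc r (insert q (insert p S)) \<circ> g)) + (f (cyc r S \<circ> (g \<circ> adj k)) + f (cyc r (insert p S) \<circ> (g \<circ> adj k))))"
          unfolding split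
        proof (rule sum.cong[OF refl])
          fix S assume "S \<in> Pow J"
          then have S: "S \<subseteq> J" "p \<notin> S" "q \<notin> S" using J by auto
          have "insert q (insert p S) \<subseteq> I" using S J by auto
          then have S4: "S \<subseteq> {..<r}" "insert q (insert p S) \<subseteq> {..<r}" "finite S"
            and b: "\<And>z. z \<in> S \<Longrightarrow> z \<le> q \<or> p \<le> z"
            using sub[of "insert q (insert p S)"] between by auto
          have s1: "cyc r S q < cyc r S p" using S psr desc' by (simp add: cyc_outside)
          have s2: "cyc r (insert p S) q < cyc r (insert p S) p"
            using S psr desc' S4 cyc_inside_gt(1)[of "insert p S" r p] by (simp add: cyc_outside)
          have "p < cyc r (insert q S) q"
            using S4 psr S b by (intro cyc_inside_gt2) (auto simp: le_less)
          then have s3: "\<not> cyc r (insert q S) q < cyc r (insert q S) p"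
            using S psr desc' by (simp add: cyc_outside)
          have "cyc r (insert q (insert p S)) q = p"
            using S4 psr S b desc' by (intro cyc_inside_next) auto
          moreover have "p < cyc r (insert q (insert p S)) p"
            using S4 by (intro cyc_inside_gt) auto
          ultimately have s4: "cyc r (insert q (insert p S)) q < cyc r (insert q (insert p S)) p" by simp
          have "cyc r (insert q (insert p S)) \<circ> swap q p = cyc r (insert q (insert p S) - {p})"
            using S4 desc' b by (intro cyc_merge) auto
          moreover have "insert q (insert p S) - {p} = insert q S" using S desc' by auto
          ultimately have e: "cyc r (insert q (insert p S)) \<circ> g \<circ> adj k = cyc r (insert q S) \<circ> g"
            unfolding gs3 by simp
          show "dstep f (cyc r S \<circ> g) k + dstep f (cyc r (insert p S) \<circ> g) k +
              (dstep f (cyc r (insert q S) \<circ> g) k + dstep f (cyc r (insert q (insert p S)) \<circ> g) k) =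
            f (cyc r S \<circ> g) + f (cyc r (insert p S) \<circ> g) + (f (cyc r (insert q S) \<circ> g) +
            f (cyc r (insert q (insert p S)) \<circ> g)) + (f (cyc r S \<circ> (g \<circ> adj k)) + f (cyc r (insert p S) \<circ> (g \<circ> adj k)))"
            using s1 s2 s3 s4 e by (simp add: dstep_def desc o_assoc)
        qed
        also have "\<dots> = upper r f g + upper r f (g \<circ> adj k)"
          unfolding up up' J(5) split sum_Pow_insert[OF J(1,2)] by (simp add: sum.distrib)
        finally show ?thesis using D desc' pnr psr by simp
      next
        case notboth: False
        have key: "r < p \<or> q \<notin> I"
        proof (rule ccontr)
          assume "\<not> ?thesis"
          then have "p < r" "q \<in> I" "p \<notin> I" using notboth pnr by auto
          then obtain j where "p < j" "j < r" "v j < a" "\<not> v j < v p"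
            using k vpp vqq by (auto simp: Idef)
          moreover from this have "v j < Suc k" using \<open>q \<in> I\<close> desc' vqq by (auto simp: Idef)
          moreover have "v j \<noteq> k" using vp[of j] \<open>p < j\<close> by simp
          ultimately show False using vpp by simp
        qed
        have m: "adj k (v j) < adj k a \<longleftrightarrow> v j < a" if "j < r" for j
          using that desc' vp[of j] vq[of j] pnr pr qr adj_less_iff[of k "v j" a] by auto
        have "i \<in> I' \<longleftrightarrow> i \<in> I" for i
        proof -
          consider "i \<noteq> q \<or> \<not> p < r" | "i = q" "p < r" by blast
          then show ?thesis
          proof cases
            case 1
            have "adj k (v j) < adj k (v i) \<longleftrightarrow> v j < v i" if "i < j" "j < r" for j
              using 1 that vp[of j] vq[of j] vp[of i] vq[of i] desc' adj_less_iff[of k "v j" "v i"] by auto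
            then show ?thesis by (auto simp: I'def Idef m)
          next
            case 2
            then have nI: "q \<notin> I" using key by simp
            have "q \<notin> I'"
            proof
              assume "q \<in> I'"
              then have *: "q < r" "v q < a" "\<And>j. q < j \<Longrightarrow> j < r \<Longrightarrow> v j < a \<Longrightarrow> adj k (v j) < adj k (v q)"
                by (auto simp: I'def m)
              show False using *(3)[of p] *(1,2) 2 desc' vpp vqq pq by (simp add: adjv)
            qed
            then show ?thesis using nI 2 by simp
          qed
        qed
        then have "I' = I" by blast
        moreover have "cyc r S q < cyc r S p" if S: "S \<subseteq> I" for S
        proof -
          have "p \<le> cyc r S p" using cyc_outside[of p r S] cyc_inside_gt(1)[of S r p] sub[OF S] pnr by (cases "p \<in> S") auto
          moreover have "cyc r S q < p"
          proof (cases "q \<in> S")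
            case True
            then have "r < p" using key S by auto
            then show ?thesis using True sub[OF S] cyc_inside_gt(2)[of S r q] by simp
          next
            case False
            show ?thesis
              using False desc' cyc_self_le[OF sub(2)[OF S], of r] cyc_outside[of q r S] by (cases "q = r") auto
          qed
          ultimately show ?thesis by simp
        qed
        ultimately show ?thesis using same D desc' pnr by simp
      qed
    qed
  qed
  show ?thesis using goal pr qr by (simp add: I_def v_def p_def q_def)
qed

definition nxt :: "nat \<Rightarrow> (nat \<Rightarrow> nat) \<Rightarrow> nat" where
  "nxt r g = (LEAST b. inv g r < b \<and> r < g b)"

definition lower :: "nat \<Rightarrow> ((nat \<Rightarrow> nat) \<Rightarrow> int) \<Rightarrow> (nat \<Rightarrow> nat) \<Rightarrow> int" where
  "lower r f g = f g + f (g \<circ> swap (inv g r) (nxt r g))"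

definition increasing_beyond :: "nat \<Rightarrow> (nat \<Rightarrow> nat) \<Rightarrow> bool" where
  "increasing_beyond r g \<longleftrightarrow> (\<forall>m m'. r < g m \<and> r < g m' \<and> m < m' \<longrightarrow> g m < g m')"

lemma nxt_eqI:
  assumes "inv g r < b" "r < g b" "\<And>m. inv g r < m \<Longrightarrow> m < b \<Longrightarrow> \<not> r < g m"
  shows "nxt r g = b"
  unfolding nxt_def using assms by (intro Least_equality) (auto simp: not_less[symmetric])

lemma lower_dstep:
  fixes r :: nat
  assumes g: "bij g" and inc: "increasing_beyond r g" and ex: "\<exists>b. inv g r < b \<and> r < g b"
  defines "a \<equiv> inv g r"
  shows "dstep f g k + dstep f (g \<circ> swap a (nxt r g)) k =
    dstep (lower r f) g k + (if k = a \<and> r < g (Suc k) then lower r f g else 0)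
      - (if Suc k = a \<and> r < g k then lower r f g else 0)"
proof -
  define b where "b = nxt r g"
  define t where "t = swap a b"
  have b: "a < b" "r < g b"
    using LeastI_ex[OF ex] by (simp_all add: b_def nxt_def a_def)
  have bmin: "\<not> r < g m" if "a < m" "m < b" for m
    using that not_less_Least[of m "\<lambda>b. inv g r < b \<and> r < g b"] by (auto simp: b_def nxt_def a_def)
  have ga: "g a = r" using g by (simp add: a_def bij_is_surj surj_f_inv_f)
  have geq: "g x = g y \<longleftrightarrow> x = y" for x y using g by (simp add: bij_is_inj inj_eq)
  have gr: "g x = r \<longleftrightarrow> x = a" for x using geq ga by metis
  have bl: "g m < r" if "a < m" "m < b" for m
    using bmin[OF that] gr[of m] that by simp
  have low: "lower r f g = f g + f (g \<circ> t)" by (simp add: lower_def t_def a_def b_def)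
  have a': "inv (g \<circ> adj k) r = adj k a" using g by (simp add: inv_comp_adj a_def)
  have low': "lower r f (g \<circ> adj k) = f (g \<circ> adj k) + f (g \<circ> adj k \<circ> swap (adj k a) b')"
    if "adj k a < b'" "r < g (adj k b')" "\<And>m. adj k a < m \<Longrightarrow> m < b' \<Longrightarrow> \<not> r < g (adj k m)" for b'
    using nxt_eqI[of "g \<circ> adj k" r b'] that by (simp add: lower_def a')
  have goal: "dstep f g k + dstep f (g \<circ> t) k =
    dstep (lower r f) g k + (if k = a \<and> r < g (Suc k) then lower r f g else 0)
      - (if Suc k = a \<and> r < g k then lower r f g else 0)"
  proof -
    consider "k = a" "b = Suc a" | "k = a" "b \<noteq> Suc a" | "Suc k = a" "r < g k" | "Suc k = a" "\<not> r < g k"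
      | "k \<noteq> a" "Suc k \<noteq> a" "k \<noteq> b" "Suc k \<noteq> b" | "k \<noteq> a" "Suc k = b" | "k = b" "r < g (Suc k)" | "k = b" "\<not> r < g (Suc k)"
      by blast
    then show ?thesis
    proof cases
      case 1
      then have "t = adj k" by (simp add: t_def)
      moreover have "g \<circ> adj k \<circ> adj k = g" by (simp add: comp_assoc)
      ultimately show ?thesis using 1 b ga low by (simp add: dstep_def)
    next
      case 2
      then have r: "g (Suc k) < r" using bl[of "Suc k"] b by simp
      have sb: "adj k b = b" using 2 b by (auto simp: swap_def)
      have "lower r f (g \<circ> adj k) = f (g \<circ> adj k) + f (g \<circ> adj k \<circ> swap (adj k a) b)"
        using 2 b bmin r by (intro low') (auto simp: swap_def)
      moreover have "g \<circ> adj k \<circ> swap (adj k a) b = g \<circ> t \<circ> adj k"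
        using 2 b by (auto simp: fun_eq_iff t_def swap_def)
      moreover have "(g \<circ> t) k = g b" "(g \<circ> t) (Suc k) = g (Suc k)"
        using 2 b by (auto simp: t_def swap_def)
      ultimately show ?thesis using 2 b ga r low by (simp add: dstep_def)
    next
      case 3
      then have kb: "k < b" and bk: "b \<noteq> k" using b by auto
      have sb: "adj k b = b" using 3 b by (auto simp: swap_def)
      have "lower r f (g \<circ> adj k) = f (g \<circ> adj k) + f (g \<circ> adj k \<circ> swap (adj k a) (Suc k))"
        using 3 b bmin by (intro low') (auto simp: swap_def)
      moreover have "g \<circ> adj k \<circ> swap (adj k a) (Suc k) = g"
        using 3 by (auto simp: fun_eq_iff swap_def)
      moreover have "(g \<circ> t) k = g k" "(g \<circ> t) (Suc k) = g b"
        using 3 b by (auto simp: t_def swap_def)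
      moreover have "g k < g b" using inc 3 b kb unfolding increasing_beyond_def by blast
      ultimately show ?thesis using 3 b ga low by (simp add: dstep_def)
    next
      case 4
      then have "g k < r" using gr[of k] by simp
      moreover have "(g \<circ> t) k = g k" "(g \<circ> t) (Suc k) = g b"
        using 4 b by (auto simp: t_def swap_def)
      ultimately show ?thesis using 4 b ga by (simp add: dstep_def)
    next
      case 5
      have s: "adj k a = a" "adj k b = b" using 5 by (auto simp: swap_def)
      have "lower r f (g \<circ> adj k) = f (g \<circ> adj k) + f (g \<circ> adj k \<circ> swap (adj k a) b)"
        using 5 b s bmin by (intro low') (auto simp: swap_def)
      moreover have "g \<circ> adj k \<circ> swap (adj k a) b = g \<circ> t \<circ> adj k"
        using 5 b by (auto simp: fun_eq_iff t_def swap_def)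
      moreover have "(g \<circ> t) k = g k" "(g \<circ> t) (Suc k) = g (Suc k)"
        using 5 b by (auto simp: t_def swap_def)
      ultimately show ?thesis using 5 low by (simp add: dstep_def)
    next
      case 6
      then have "g k < r" using bl[of k] b by simp
      moreover have "(g \<circ> t) k = g k" "(g \<circ> t) (Suc k) = r"
        using 6 b ga by (auto simp: t_def swap_def)
      ultimately show ?thesis using 6 b ga by (auto simp: dstep_def)
    next
      case 7
      have "g k < g (Suc k)" using inc 7 b unfolding increasing_beyond_def by blast
      moreover have "(g \<circ> t) k = r" "(g \<circ> t) (Suc k) = g (Suc k)"
        using 7 b ga by (auto simp: t_def swap_def)
      ultimately show ?thesis using 7 b by (auto simp: dstep_def)
    next
      case 8
      then have r: "g (Suc k) < r" using gr[of "Suc k"] b by simp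
      have sa: "adj k a = a" using 8 b by (auto simp: swap_def)
      have "lower r f (g \<circ> adj k) = f (g \<circ> adj k) + f (g \<circ> adj k \<circ> swap (adj k a) (Suc k))"
        using 8 b r sa bmin by (intro low') (auto simp: swap_def less_Suc_eq)
      moreover have "g \<circ> adj k \<circ> swap (adj k a) (Suc k) = g \<circ> t \<circ> adj k"
        using 8 b by (auto simp: fun_eq_iff t_def swap_def)
      moreover have "(g \<circ> t) k = r" "(g \<circ> t) (Suc k) = g (Suc k)"
        using 8 b ga by (auto simp: t_def swap_def)
      ultimately show ?thesis using 8 b r low by (simp add: dstep_def)
    qed
  qed
  then show ?thesis by (simp add: t_def b_def)
qed

fun hecke_sum :: "nat \<Rightarrow> nat \<Rightarrow> (nat \<Rightarrow> nat) \<Rightarrow> int" where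
  "hecke_sum M 0 g = (if g = id then 1 else 0)"
| "hecke_sum M (Suc L) g = (\<Sum>k=1..<M. int k * dstep (hecke_sum M L) g k)"

definition monk_ok :: "nat \<Rightarrow> nat \<Rightarrow> (nat \<Rightarrow> nat) \<Rightarrow> bool" where
  "monk_ok M r g \<longleftrightarrow> g permutes {1..<M} \<and> r \<in> {1..<M} \<and> increasing_beyond r g \<and>
     (\<exists>b<M. inv g r < b \<and> r < g b)"

lemma monk_ok_adj:
  assumes ok: "monk_ok M r g" and k: "k \<in> {1..<M}" and d: "g (Suc k) < g k"
  shows "monk_ok M r (g \<circ> adj k)"
proof -
  have p: "g permutes {1..<M}" and r: "r \<in> {1..<M}" and inc: "increasing_beyond r g"
    using ok by (auto simp: monk_ok_def)
  obtain b where b: "b < M" "inv g r < b" "r < g b" using ok by (auto simp: monk_ok_def)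
  have gi: "g i \<in> {1..<M} \<longleftrightarrow> i \<in> {1..<M}" for i using p by (rule permutes_in_image)
  have kM: "Suc k < M"
  proof (rule ccontr)
    assume "\<not> ?thesis"
    then have "g (Suc k) = Suc k" "g k < M" using k gi[of k] p by (auto simp: permutes_def)
    then show False using d \<open>\<not> Suc k < M\<close> by simp
  qed
  have bij: "bij g" using p by (rule permutes_bij)
  have ga: "g (inv g r) = r" using bij by (simp add: bij_is_surj surj_f_inv_f)
  have 1: "g \<circ> adj k permutes {1..<M}"
    using k kM by (intro permutes_compose[OF permutes_swap_id p]) auto
  have nb: "\<not> (r < g k \<and> r < g (Suc k))"
    using inc d unfolding increasing_beyond_def by (metis lessI order.asym)
  have 2: "increasing_beyond r (g \<circ> adj k)"
    unfolding increasing_beyond_def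
  proof (intro allI impI)
    fix m m' assume *: "r < (g \<circ> adj k) m \<and> r < (g \<circ> adj k) m' \<and> m < m'"
    have "adj k m < adj k m'"
      using * nb by (auto simp: adj_less_iff[of k m m'])
    then show "(g \<circ> adj k) m < (g \<circ> adj k) m'"
      using * inc unfolding increasing_beyond_def by auto
  qed
  have 3: "\<exists>b<M. inv (g \<circ> adj k) r < b \<and> r < (g \<circ> adj k) b"
  proof (cases "inv g r = k \<and> b = Suc k")
    case True
    then show ?thesis using d b ga by auto
  next
    case F: False
    have "inv (g \<circ> adj k) r = adj k (inv g r)" using bij by (simp add: inv_comp_adj)
    moreover have "adj k (inv g r) < adj k b" using b F by (auto simp: adj_less_iff)
    moreover have "adj k b < M" using b kM by (auto simp: swap_def)
    ultimately show ?thesis using b by (intro exI[of _ "adj k b"]) auto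
  qed
  show ?thesis using 1 2 3 r by (simp add: monk_ok_def)
qed

text \<open>The coefficients of \<open>t\<^sup>L/L!\<close> in Lascoux's transition formula, with \<open>1 + y = e\<^sup>t\<close>.\<close>

lemma hecke_sum_monk:
  assumes "monk_ok M r g"
  shows "lower r (hecke_sum M L) g = (\<Sum>m\<le>L. int (L choose m) * upper r (hecke_sum M m) g)"
  using assms
proof (induction L arbitrary: g)
  case (0 g)
  have p: "g permutes {1..<M}" and r: "r \<in> {1..<M}"
    using 0 by (auto simp: monk_ok_def)
  have bij: "bij g" using p by (rule permutes_bij)
  obtain b where b: "b = nxt r g" "inv g r < b" "r < g b"
    using LeastI_ex[of "\<lambda>b. inv g r < b \<and> r < g b"] 0 by (auto simp: monk_ok_def nxt_def)
  have ga: "g (inv g r) = r" using bij by (simp add: bij_is_surj surj_f_inv_f)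
  have "g \<circ> swap (inv g r) b \<noteq> id"
  proof
    assume "g \<circ> swap (inv g r) b = id"
    from fun_cong[OF this, of b] fun_cong[OF this, of "inv g r"] show False
      using ga b by simp
  qed
  then have 1: "lower r (hecke_sum M 0) g = hecke_sum M 0 g"
    by (simp add: lower_def b(1))
  let ?I = "records r (inv g)"
  have "upper r (hecke_sum M 0) g = (\<Sum>S\<in>{{}}. hecke_sum M 0 (cyc r S \<circ> g))"
    unfolding upper_def
  proof (rule sum.mono_neutral_right)
    show "finite (Pow ?I)" by (simp add: finite_records)
    show "\<forall>S\<in>Pow ?I - {{}}. hecke_sum M 0 (cyc r S \<circ> g) = 0"
    proof
      fix S assume S: "S \<in> Pow ?I - {{}}"
      have "cyc r S \<circ> g \<noteq> id"
      proof
        assume e: "cyc r S \<circ> g = id"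
        obtain i where i: "i \<in> S" using S by auto
        have fin: "finite S" "S \<subseteq> {..<r}"
          using S finite_subset[OF _ finite_records] records_less[of S r "inv g"] by auto
        define x where "x = Max S"
        have x: "x \<in> S" unfolding x_def using fin(1) i by (intro Max_in) auto
        have "cyc r S x = r"
        proof (rule cyc_inside_next)
          fix z assume "z \<in> S" then show "z \<le> x \<or> r \<le> z" using fin by (simp add: x_def)
        qed (use fin x in auto)
        moreover have "g (inv g x) = x" using bij by (simp add: bij_is_surj surj_f_inv_f)
        ultimately have "inv g x = r" using fun_cong[OF e, of "inv g x"] by simp
        moreover have minr: "Min S < r" using fin i by (metis Min_in empty_iff lessThan_iff subsetD)
        moreover have "inv g r = Min S"
        proof -
          have "cyc r S r = Min S"
            using i fin minr by (subst cyc_self, subst Min_insert) auto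
          then show ?thesis using fun_cong[OF e, of "inv g r"] ga by simp
        qed
        moreover have "inv g x < inv g r" using x S by (auto simp: records_def)
        ultimately show False by simp
      qed
      then show "hecke_sum M 0 (cyc r S \<circ> g) = 0" by simp
    qed
  qed auto
  also have "cyc r {} \<circ> g = g" by (auto simp: cyc_def fun_eq_iff)
  ultimately show ?case using 1 by (simp del: hecke_sum.simps)
next
  case (Suc L g)
  have p: "g permutes {1..<M}" and r: "r \<in> {1..<M}" and inc: "increasing_beyond r g"
    and ex: "\<exists>b. inv g r < b \<and> r < g b"
    using Suc.prems by (auto simp: monk_ok_def)
  have bij: "bij g" using p by (rule permutes_bij)
  define a where "a = inv g r"
  define t where "t = swap a (nxt r g)"
  have ga: "g a = r" using bij by (simp add: a_def bij_is_surj surj_f_inv_f)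
  have geq: "g x = g y \<longleftrightarrow> x = y" for x y using bij by (simp add: bij_is_inj inj_eq)
  have aM: "a \<in> {1..<M}" using ga r permutes_in_image[OF p, of a] by simp
  define c :: int where "c = (if r < g (Suc a) then int a else 0) - (if r < g (a - 1) then int (a - 1) else 0)"
  have ca: "c - 1 = (if g (a - 1) < r then int (a - 1) else 0) - (if g (Suc a) < r then int a else 0)"
  proof -
    have "g (Suc a) < r \<longleftrightarrow> \<not> r < g (Suc a)" "g (a - 1) < r \<longleftrightarrow> \<not> r < g (a - 1)"
      using aM geq[of "Suc a" a] geq[of "a - 1" a] ga by auto
    then show ?thesis using aM unfolding c_def by (simp add: of_nat_diff)
  qed
  have delta: "(\<Sum>k=1..<M. int k * (if k = a \<and> P k then x else 0)) = (if P a then int a * x else 0)"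
    for P and x :: int
  proof -
    have "(\<Sum>k=1..<M. int k * (if k = a \<and> P k then x else 0)) =
        (\<Sum>k=1..<M. if k = a then (if P a then int a * x else 0) else 0)"
      by (intro sum.cong) auto
    then show ?thesis using aM by (simp add: sum.delta)
  qed
  have delta': "(\<Sum>k=1..<M. int k * (if Suc k = a \<and> P k then x else 0)) = (if P (a - 1) then int (a - 1) * x else 0)"
    for P and x :: int
  proof -
    have "(\<Sum>k=1..<M. int k * (if Suc k = a \<and> P k then x else 0)) =
        (\<Sum>k=1..<M. if k = a - 1 then (if P (a - 1) then int (a - 1) * x else 0) else 0)"
      using aM by (intro sum.cong) auto
    also have "\<dots> = (if P (a - 1) then int (a - 1) * x else 0)"
      using aM by (subst sum.delta) auto
    finally show ?thesis .
  qed
  have low: "lower r (hecke_sum M (Suc L)) g = (\<Sum>k=1..<M. int k * dstep (lower r (hecke_sum M L)) g k)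
      + c * lower r (hecke_sum M L) g"
  proof -
    have "lower r (hecke_sum M (Suc L)) g =
        (\<Sum>k=1..<M. int k * (dstep (hecke_sum M L) g k + dstep (hecke_sum M L) (g \<circ> t) k))"
      by (simp add: lower_def a_def t_def sum.distrib distrib_left)
    also have "\<dots> = (\<Sum>k=1..<M. int k * dstep (lower r (hecke_sum M L)) g k)
      + (\<Sum>k=1..<M. int k * (if k = a \<and> r < g (Suc k) then lower r (hecke_sum M L) g else 0))
      - (\<Sum>k=1..<M. int k * (if Suc k = a \<and> r < g k then lower r (hecke_sum M L) g else 0))"
      unfolding t_def a_def lower_dstep[OF bij inc ex]
      by (simp only: distrib_left right_diff_distrib sum.distrib sum_subtractf)
    finally show ?thesis unfolding delta delta' c_def
      by (cases "r < g (Suc a)"; cases "r < g (a - 1)") (simp_all add: algebra_simps del: hecke_sum.simps One_nat_def)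
  qed
  have up: "upper r (hecke_sum M (Suc m)) g + upper r (hecke_sum M m) g =
      (\<Sum>k=1..<M. int k * dstep (upper r (hecke_sum M m)) g k) + c * upper r (hecke_sum M m) g" for m
  proof -
    have "upper r (hecke_sum M (Suc m)) g =
        (\<Sum>k=1..<M. int k * (\<Sum>S\<in>Pow (records r (inv g)). dstep (hecke_sum M m) (cyc r S \<circ> g) k))"
      unfolding upper_def hecke_sum.simps sum_distrib_left by (rule sum.swap)
    also have "\<dots> = (\<Sum>k=1..<M. int k * (dstep (upper r (hecke_sum M m)) g k
        + (if Suc k = a \<and> g k < r then upper r (hecke_sum M m) g else 0)
        - (if k = a \<and> g (Suc k) < r then upper r (hecke_sum M m) g else 0)))"
      unfolding a_def by (intro sum.cong refl arg_cong2[where f="(*)"] upper_dstep[OF bij]) auto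
    also have "\<dots> = (\<Sum>k=1..<M. int k * dstep (upper r (hecke_sum M m)) g k)
      + (\<Sum>k=1..<M. int k * (if Suc k = a \<and> g k < r then upper r (hecke_sum M m) g else 0))
      - (\<Sum>k=1..<M. int k * (if k = a \<and> g (Suc k) < r then upper r (hecke_sum M m) g else 0))"
      by (simp only: distrib_left right_diff_distrib sum.distrib sum_subtractf)
    finally have "upper r (hecke_sum M (Suc m)) g = (\<Sum>k=1..<M. int k * dstep (upper r (hecke_sum M m)) g k)
      + (c - 1) * upper r (hecke_sum M m) g"
      unfolding delta delta' ca
      by (cases "g (Suc a) < r"; cases "g (a - 1) < r") (simp_all add: algebra_simps del: hecke_sum.simps One_nat_def)
    then show ?thesis by (simp add: algebra_simps del: hecke_sum.simps)
  qed
  have IH: "dstep (lower r (hecke_sum M L)) g k = (\<Sum>m\<le>L. int (L choose m) * dstep (upper r (hecke_sum M m)) g k)"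
    if "k \<in> {1..<M}" for k
  proof (cases "g (Suc k) < g k")
    case True
    show ?thesis
      unfolding dstep_def Suc.IH[OF Suc.prems] Suc.IH[OF monk_ok_adj[OF Suc.prems that True]]
      using True by (simp add: sum.distrib distrib_left)
  qed (simp add: dstep_def)
  have "(\<Sum>m\<le>Suc L. int (Suc L choose m) * upper r (hecke_sum M m) g) =
      (\<Sum>m\<le>L. int (L choose m) * upper r (hecke_sum M m) g) + (\<Sum>m\<le>L. int (L choose m) * upper r (hecke_sum M (Suc m)) g)"
  proof -
    have "(\<Sum>m\<le>Suc L. int (Suc L choose m) * upper r (hecke_sum M m) g) =
      upper r (hecke_sum M 0) g + (\<Sum>m\<le>L. int (Suc L choose Suc m) * upper r (hecke_sum M (Suc m)) g)"
      by (subst sum.atMost_Suc_shift) (simp del: hecke_sum.simps)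
    also have "\<dots> = upper r (hecke_sum M 0) g + (\<Sum>m\<le>L. int (L choose Suc m) * upper r (hecke_sum M (Suc m)) g)
       + (\<Sum>m\<le>L. int (L choose m) * upper r (hecke_sum M (Suc m)) g)"
      by (simp add: distrib_right sum.distrib del: hecke_sum.simps)
    also have "upper r (hecke_sum M 0) g + (\<Sum>m\<le>L. int (L choose Suc m) * upper r (hecke_sum M (Suc m)) g) =
       (\<Sum>m\<le>Suc L. int (L choose m) * upper r (hecke_sum M m) g)"
      by (subst sum.atMost_Suc_shift) (simp del: hecke_sum.simps)
    also have "\<dots> = (\<Sum>m\<le>L. int (L choose m) * upper r (hecke_sum M m) g)" by simp
    finally show ?thesis .
  qed
  also have "\<dots> = (\<Sum>m\<le>L. int (L choose m) * (upper r (hecke_sum M (Suc m)) g + upper r (hecke_sum M m) g))"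
    by (simp add: sum.distrib distrib_left del: hecke_sum.simps)
  also have "\<dots> = (\<Sum>m\<le>L. \<Sum>k=1..<M. int (L choose m) * (int k * dstep (upper r (hecke_sum M m)) g k))
      + c * (\<Sum>m\<le>L. int (L choose m) * upper r (hecke_sum M m) g)"
    unfolding up by (simp add: sum.distrib distrib_left sum_distrib_left mult.left_commute)
  also have "(\<Sum>m\<le>L. \<Sum>k=1..<M. int (L choose m) * (int k * dstep (upper r (hecke_sum M m)) g k)) =
     (\<Sum>k=1..<M. int k * dstep (lower r (hecke_sum M L)) g k)"
    by (subst sum.swap) (simp add: IH sum_distrib_left mult.left_commute)
  also have "(\<Sum>m\<le>L. int (L choose m) * upper r (hecke_sum M m) g) = lower r (hecke_sum M L) g"
    using Suc.IH[OF Suc.prems] by simp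
  finally show ?case unfolding low by (rule sym)
qed

subsection \<open>Hecke words and Demazure products\<close>

definition hop :: "nat \<Rightarrow> (nat \<Rightarrow> nat) \<Rightarrow> nat \<Rightarrow> nat" where
  "hop i g = g(i := max (g i) (g (Suc i)), Suc i := min (g i) (g (Suc i)))"

definition demazure :: "nat list \<Rightarrow> nat \<Rightarrow> nat" where
  "demazure a = foldr hop a id"

fun inv_perm :: "nat list \<Rightarrow> nat \<Rightarrow> nat" where
  "inv_perm [] = id"
| "inv_perm (i # a) = inv_perm a \<circ> adj i"

fun ascending :: "nat list \<Rightarrow> bool" where
  "ascending [] \<longleftrightarrow> True"
| "ascending (i # a) \<longleftrightarrow> ascending a \<and> inv_perm a i < inv_perm a (Suc i)"

lemma hop_descent: "g (Suc i) \<le> g i \<Longrightarrow> hop i g = g"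
  by (auto simp: hop_def fun_eq_iff)

lemma hop_ascent: "g i \<le> g (Suc i) \<Longrightarrow> hop i g = g \<circ> adj i"
  by (auto simp: hop_def fun_eq_iff swap_def)

lemma hop_idem: "hop i (hop i g) = hop i g"
  by (auto simp: hop_def fun_eq_iff)

lemma hop_comm: "Suc i < j \<Longrightarrow> hop i (hop j g) = hop j (hop i g)"
  by (auto simp: hop_def fun_eq_iff)

lemma hop_braid: "hop i (hop (Suc i) (hop i g)) = hop (Suc i) (hop i (hop (Suc i) g))"
  by (auto simp: hop_def fun_eq_iff max_def min_def)

lemma hop_bij: "bij g \<Longrightarrow> bij (hop i g)"
  by (cases "g i \<le> g (Suc i)") (auto simp: hop_ascent hop_descent bij_comp)

lemma demazure_simps [simp]: "demazure [] = id" "demazure (i # a) = hop i (demazure a)"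
  by (simp_all add: demazure_def)

lemma demazure_append: "demazure (a @ b) = foldr hop a (demazure b)"
  by (simp add: demazure_def)

lemma demazure_bij: "bij (demazure a)"
  by (induction a) (simp_all add: hop_bij bij_id[unfolded id_def])

lemma inv_perm_bij: "bij (inv_perm a)"
proof (induction a)
  case Nil
  show ?case unfolding inv_perm.simps by (rule bij_id)
next
  case (Cons i a)
  then show ?case unfolding inv_perm.simps by (intro bij_comp) auto
qed

lemma word_perm_simps: "word_perm [] = id" "word_perm (i # a) = adj i \<circ> word_perm a"
  by (simp_all add: word_perm_def)

lemma word_perm_bij: "bij (word_perm a)"
proof (induction a)
  case Nil
  show ?case unfolding word_perm_simps by (rule bij_id)
next
  case (Cons i a)
  then show ?case unfolding word_perm_simps by (intro bij_comp) auto
qed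

lemma inv_perm_eq: "inv_perm a = inv (word_perm a)"
proof (induction a)
  case Nil
  show ?case unfolding word_perm_simps inv_perm.simps by (rule inv_id[symmetric])
next
  case (Cons i a)
  have "inv (adj i \<circ> word_perm a) = inv (word_perm a) \<circ> inv (adj i)"
    by (rule o_inv_distrib) (simp_all add: word_perm_bij)
  also have "inv (adj i) = adj i" by simp
  finally show ?case unfolding word_perm_simps inv_perm.simps Cons by (rule sym)
qed

lemma word_perm_eq: "word_perm a = inv (inv_perm a)"
  by (simp add: inv_perm_eq inv_inv_eq word_perm_bij)

lemma hecke_step_demazure:
  assumes "hecke_step n a b"
  shows "demazure a = demazure b"
  using assms
proof cases
  case (comm u v i j)
  then show ?thesis using hop_comm[of i j "demazure v"] by (simp add: demazure_append)
next
  case (braid u v i)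
  then show ?thesis using hop_braid[of i "demazure v"] by (simp add: demazure_append)
qed (simp add: demazure_append hop_idem)

lemma hecke_eq_demazure:
  assumes "hecke_eq n a b"
  shows "demazure a = demazure b"
proof -
  have "equivclp (hecke_step n) a b" using assms by (simp add: hecke_eq_def)
  then show ?thesis
    by (induction rule: equivclp_induct) (auto dest: hecke_step_demazure)
qed

lemma hecke_eq_refl: "hecke_eq n a a"
  by (simp add: hecke_eq_def)

lemma hecke_eq_trans [trans]: "hecke_eq n a b \<Longrightarrow> hecke_eq n b c \<Longrightarrow> hecke_eq n a c"
  unfolding hecke_eq_def by (rule equivclp_trans)

lemma hecke_step_Cons:
  assumes "hecke_step n a b" "i \<in> {1..<n}"
  shows "hecke_step n (i # a) (i # b)"
  using assms(1)
proof cases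
  case (idem u v j)
  then show ?thesis using assms(2) hecke_step.idem[of "i # u" n v j] by simp
next
  case (comm u v j k)
  then show ?thesis using assms(2) hecke_step.comm[of "i # u" n v j k] by simp
next
  case (braid u v j)
  then show ?thesis using assms(2) hecke_step.braid[of "i # u" n v j] by simp
qed

lemma hecke_eq_Cons:
  assumes "hecke_eq n a b" "i \<in> {1..<n}"
  shows "hecke_eq n (i # a) (i # b)"
proof -
  have "equivclp (hecke_step n) a b" using assms by (simp add: hecke_eq_def)
  then show ?thesis
  proof (induction rule: equivclp_induct)
    case base
    then show ?case by (rule hecke_eq_refl)
  next
    case (step y z)
    then have "hecke_step n (i # y) (i # z) \<or> hecke_step n (i # z) (i # y)"
      using hecke_step_Cons[OF _ assms(2)] by blast
    then have "hecke_eq n (i # y) (i # z)" by (auto simp: hecke_eq_def intro: equivclp_sym)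
    then show ?case using step.IH hecke_eq_trans by blast
  qed
qed

lemma hecke_eq_commute:
  assumes "a \<in> lists {1..<n}" "i \<in> {1..<n}" "j \<in> {1..<n}" "Suc i < j \<or> Suc j < i"
  shows "hecke_eq n (i # j # a) (j # i # a)"
  using assms hecke_step.comm[of "[]" n a i j] hecke_step.comm[of "[]" n a j i]
  by (auto simp: hecke_eq_def intro: equivclp_sym)

lemma hecke_eq_braid:
  assumes "a \<in> lists {1..<n}" "i \<in> {1..<n}" "j \<in> {1..<n}" "j = Suc i \<or> i = Suc j"
  shows "hecke_eq n (i # j # i # a) (j # i # j # a)"
  using assms hecke_step.braid[of "[]" n a i] hecke_step.braid[of "[]" n a j]
  by (auto simp: hecke_eq_def intro: equivclp_sym)

lemma hecke_eq_idem:
  assumes "a \<in> lists {1..<n}" "i \<in> {1..<n}"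
  shows "hecke_eq n (i # i # a) (i # a)"
  using assms hecke_step.idem[of "[]" n a i] by (auto simp: hecke_eq_def)

lemma ascending_demazure: "ascending a \<Longrightarrow> demazure a = inv_perm a"
  by (induction a) (auto simp: hop_ascent)

lemma comp_adj_adj: "f \<circ> adj i \<circ> adj i = f"
  by (simp add: fun_eq_iff)

lemma comp_adj_eq_iff: "f \<circ> adj i = h \<longleftrightarrow> f = h \<circ> adj i"
  using comp_adj_adj[of f i] comp_adj_adj[of h i] by auto

lemma adj_braid: "adj i \<circ> adj (Suc i) \<circ> adj i = adj (Suc i) \<circ> adj i \<circ> adj (Suc i)"
proof
  fix x
  consider "x = i" | "x = Suc i" | "x = Suc (Suc i)" | "x \<noteq> i" "x \<noteq> Suc i" "x \<noteq> Suc (Suc i)" by blast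
  then show "(adj i \<circ> adj (Suc i) \<circ> adj i) x = (adj (Suc i) \<circ> adj i \<circ> adj (Suc i)) x"
    by cases (simp_all add: swap_def)
qed

text \<open>Matsumoto's argument.\<close>

lemma descent_to_front:
  assumes "a \<in> lists {1..<n}" "ascending a" "i \<in> {1..<n}"
    "inv_perm a (Suc i) < inv_perm a i"
  shows "\<exists>b \<in> lists {1..<n}. ascending (i # b) \<and> inv_perm (i # b) = inv_perm a \<and>
    length a = Suc (length b) \<and> hecke_eq n a (i # b)"
  using assms
proof (induction "length a" arbitrary: a i rule: less_induct)
  case less
  show ?case
  proof (cases a)
    case Nil
    then show ?thesis using less.prems by simp
  next
    case (Cons j c)
    define h where "h = inv_perm c"
    have c: "c \<in> lists {1..<n}" "ascending c" "j \<in> {1..<n}" "h j < h (Suc j)" "inv_perm a = h \<circ> adj j"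
      using less.prems Cons by (auto simp: h_def)
    have IH: "\<exists>b \<in> lists {1..<n}. ascending (i' # b) \<and> inv_perm (i' # b) = inv_perm a' \<and>
      length a' = Suc (length b) \<and> hecke_eq n a' (i' # b)"
      if "length a' \<le> length c" "a' \<in> lists {1..<n}" "ascending a'" "i' \<in> {1..<n}"
        "inv_perm a' (Suc i') < inv_perm a' i'" for a' i'
      using less.hyps[of a' i'] that Cons by simp
    consider "i = j" | "Suc i < j \<or> Suc j < i" | "i = Suc j \<or> j = Suc i" by linarith
    then show ?thesis
    proof cases
      case 1
      then show ?thesis using less.prems Cons c by (intro bexI[of _ c]) (auto intro: hecke_eq_refl)
    next
      case 2
      then have "h (Suc i) < h i" using less.prems(4) c(5) by (auto simp: swap_def split: if_splits)
      then obtain b where b: "b \<in> lists {1..<n}" "ascending (i # b)" "inv_perm (i # b) = h"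
        "length c = Suc (length b)" "hecke_eq n c (i # b)"
        using IH[of c i] c less.prems by (auto simp: h_def)
      have hb: "inv_perm b = h \<circ> adj i"
        using b(3) by (auto simp: comp_assoc)
      have "hecke_eq n (j # c) (j # i # b)" using b c by (intro hecke_eq_Cons)
      also have "hecke_eq n (j # i # b) (i # j # b)" using b c less.prems 2 by (intro hecke_eq_commute) auto
      finally have "hecke_eq n a (i # j # b)" using Cons by simp
      moreover have "ascending (i # j # b)"
        using b c 2 hb by (auto simp: swap_def)
      moreover have "inv_perm (i # j # b) = inv_perm a"
        using c(5) b(3) 2 hb by (auto simp: fun_eq_iff swap_def)
      moreover have "j # b \<in> lists {1..<n}" "length a = Suc (length (j # b))"
        using b(1,4) c(3) Cons by simp_all
      ultimately show ?thesis by blast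
    next
      case 3
      have h3: "h (Suc i) < h i"
        using 3 less.prems(4) c(4,5) by (auto simp: swap_def split: if_splits)
      then obtain b where b: "b \<in> lists {1..<n}" "ascending (i # b)" "inv_perm (i # b) = h"
        "length c = Suc (length b)" "hecke_eq n c (i # b)"
        using IH[of c i] c less.prems by (auto simp: h_def)
      have hb: "inv_perm b = h \<circ> adj i"
        using b(3) by (auto simp: comp_assoc)
      have "inv_perm b (Suc j) < inv_perm b j"
        using 3 less.prems(4) c(4,5) h3 hb by (auto simp: swap_def split: if_splits)
      then obtain d where d: "d \<in> lists {1..<n}" "ascending (j # d)" "inv_perm (j # d) = inv_perm b"
        "length b = Suc (length d)" "hecke_eq n b (j # d)"
        using IH[of b j] b c less.prems by auto
      have hd: "inv_perm d = h \<circ> adj i \<circ> adj j"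
        using d(3) unfolding inv_perm.simps hb comp_adj_eq_iff .
      have "hecke_eq n (j # c) (j # i # b)" using b c by (intro hecke_eq_Cons)
      also have "hecke_eq n (j # i # b) (j # i # j # d)" using b c d less.prems by (intro hecke_eq_Cons)
      also have "hecke_eq n (j # i # j # d) (i # j # i # d)" using c d less.prems 3 by (intro hecke_eq_braid) auto
      finally have "hecke_eq n a (i # j # i # d)" using Cons by simp
      moreover have "ascending (i # j # i # d)"
        using 3
      proof
        assume e: "i = Suc j"
        have "h (Suc (Suc j)) < h j" using less.prems(4) c(5) e by (simp add: swap_def)
        moreover have "ascending d" using d(2) by simp
        ultimately show ?thesis using c(4) by (simp add: hd e swap_def)
      next
        assume e: "j = Suc i"
        have "h (Suc (Suc i)) < h i" using less.prems(4) c(5) e by (simp add: swap_def)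
        moreover have "ascending d" using d(2) by simp
        ultimately show ?thesis using c(4) by (simp add: hd e swap_def)
      qed
      moreover have "inv_perm (i # j # i # d) = inv_perm a"
      proof -
        have "adj i \<circ> adj j \<circ> adj i = adj j \<circ> adj i \<circ> adj j"
          using 3 adj_braid by auto
        then have "adj i \<circ> adj j \<circ> adj i \<circ> adj j \<circ> adj i = adj j" by (simp only: comp_adj_adj)
        then have "h \<circ> (adj i \<circ> adj j \<circ> adj i \<circ> adj j \<circ> adj i) = h \<circ> adj j" by simp
        then show ?thesis unfolding c(5) inv_perm.simps hd by (simp only: o_assoc)
      qed
      moreover have "j # i # d \<in> lists {1..<n}" "length a = Suc (length (j # i # d))"
        using b(4) c(3) d(1,4) Cons less.prems(3) by simp_all
      ultimately show ?thesis by blast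
    qed
  qed
qed

lemma hecke_eq_ascending:
  assumes "a \<in> lists {1..<n}"
  shows "\<exists>b \<in> lists {1..<n}. ascending b \<and> inv_perm b = demazure a \<and> hecke_eq n a b"
  using assms
proof (induction a)
  case Nil
  then show ?case by (intro bexI[of _ "[]"]) (auto intro: hecke_eq_refl)
next
  case (Cons i a)
  then have i: "i \<in> {1..<n}" by auto
  obtain b where b: "b \<in> lists {1..<n}" "ascending b" "inv_perm b = demazure a" "hecke_eq n a b"
    using Cons by auto
  have e: "hecke_eq n (i # a) (i # b)" using b i by (intro hecke_eq_Cons)
  have ne: "inv_perm b i \<noteq> inv_perm b (Suc i)"
    using inv_perm_bij[of b] by (auto simp: bij_def dest: injD)
  show ?case
  proof (cases "inv_perm b i < inv_perm b (Suc i)")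
    case True
    then show ?thesis using b i e by (intro bexI[of _ "i # b"]) (auto simp: hop_ascent)
  next
    case False
    then have "inv_perm b (Suc i) < inv_perm b i" using ne by simp
    then obtain c where c: "c \<in> lists {1..<n}" "ascending (i # c)" "inv_perm (i # c) = inv_perm b" "hecke_eq n b (i # c)"
      using descent_to_front[OF b(1,2) i] by auto
    note e
    also have "hecke_eq n (i # b) (i # i # c)" using c i by (intro hecke_eq_Cons)
    also have "hecke_eq n (i # i # c) (i # c)" using c i by (intro hecke_eq_idem)
    finally have "hecke_eq n (i # a) (i # c)" .
    then show ?thesis using b c i False by (intro bexI[of _ "i # c"]) (auto simp: hop_descent)
  qed
qed

lemma shorten_to_ascending:
  assumes "a \<in> lists {1..<n}"
  shows "\<exists>b \<in> lists {1..<n}. ascending b \<and> inv_perm b = inv_perm a \<and> length b \<le> length a \<and>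
    (length b = length a \<longrightarrow> ascending a)"
  using assms
proof (induction a)
  case Nil
  then show ?case by (intro bexI[of _ "[]"]) auto
next
  case (Cons i a)
  then have i: "i \<in> {1..<n}" by auto
  obtain b where b: "b \<in> lists {1..<n}" "ascending b" "inv_perm b = inv_perm a" "length b \<le> length a"
    "length b = length a \<longrightarrow> ascending a"
    using Cons by auto
  have ne: "inv_perm b i \<noteq> inv_perm b (Suc i)"
    using inv_perm_bij[of b] by (auto simp: bij_def dest: injD)
  show ?case
  proof (cases "inv_perm b i < inv_perm b (Suc i)")
    case True
    then show ?thesis using b i by (intro bexI[of _ "i # b"]) auto
  next
    case False
    then have "inv_perm b (Suc i) < inv_perm b i" using ne by simp
    then obtain c where c: "c \<in> lists {1..<n}" "ascending (i # c)" "inv_perm (i # c) = inv_perm b"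
       "length b = Suc (length c)"
      using descent_to_front[OF b(1,2) i] by auto
    have "inv_perm c = inv_perm (i # a)"
      using c(3) unfolding inv_perm.simps b(3) comp_adj_eq_iff .
    then show ?thesis using c b by (intro bexI[of _ c]) auto
  qed
qed

lemma ascending_length_unique:
  assumes "a \<in> lists {1..<n}" "b \<in> lists {1..<n}" "ascending a" "ascending b"
    "inv_perm a = inv_perm b"
  shows "length a = length b"
  using assms
proof (induction a arbitrary: b rule: list.induct)
  case Nil
  show ?case
  proof (cases b)
    case (Cons i c)
    have "inv_perm b (Suc i) < inv_perm b i" using Nil.prems(4) unfolding Cons by simp
    then show ?thesis unfolding Nil.prems(5)[symmetric] inv_perm.simps by simp
  qed simp
next
  case (Cons i a)
  have "inv_perm b (Suc i) < inv_perm b i"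
    using Cons.prems(3) unfolding Cons.prems(5)[symmetric] by simp
  then obtain c where c: "c \<in> lists {1..<n}" "ascending (i # c)" "inv_perm (i # c) = inv_perm b"
       "length b = Suc (length c)"
    using descent_to_front[OF Cons.prems(2,4), of i] Cons.prems(1) by auto
  have "inv_perm a = inv_perm c"
    using c(3) unfolding Cons.prems(5)[symmetric] inv_perm.simps comp_adj_eq_iff comp_adj_adj by (rule sym)
  then show ?case using Cons.IH[of c] c Cons.prems by auto
qed

lemma reduced_word_iff:
  "reduced_word n w a \<longleftrightarrow> a \<in> lists {1..<n} \<and> word_perm a = w \<and> ascending a"
proof
  assume r: "reduced_word n w a"
  then have a: "a \<in> lists {1..<n}" "word_perm a = w" by (auto simp: reduced_word_def)
  obtain b where b: "b \<in> lists {1..<n}" "ascending b" "inv_perm b = inv_perm a" "length b \<le> length a"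
    "length b = length a \<longrightarrow> ascending a"
    using shorten_to_ascending[OF a(1)] by auto
  have "length a \<le> length b" using r b a by (auto simp: reduced_word_def word_perm_eq)
  then show "a \<in> lists {1..<n} \<and> word_perm a = w \<and> ascending a" using a b by simp
next
  assume a: "a \<in> lists {1..<n} \<and> word_perm a = w \<and> ascending a"
  have "length a \<le> length b" if b: "b \<in> lists {1..<n}" "word_perm b = w" for b
  proof -
    obtain c where c: "c \<in> lists {1..<n}" "ascending c" "inv_perm c = inv_perm b" "length c \<le> length b"
      using shorten_to_ascending[OF b(1)] by auto
    have "inv_perm a = inv_perm c" using c(3) a b by (simp add: inv_perm_eq)
    then show ?thesis using ascending_length_unique[of a n c] a c by simp
  qed
  then show "reduced_word n w a" using a by (auto simp: reduced_word_def)
qed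

lemma hecke_words_eq:
  assumes "bij w"
  shows "hecke_words n w L = {a \<in> lists {1..<n}. length a = L \<and> demazure a = inv w}"
proof -
  have "(\<exists>r. reduced_word n w r \<and> hecke_eq n a r) \<longleftrightarrow> demazure a = inv w"
    if a: "a \<in> lists {1..<n}" for a
  proof
    assume "\<exists>r. reduced_word n w r \<and> hecke_eq n a r"
    then show "demazure a = inv w"
      using hecke_eq_demazure ascending_demazure by (auto simp: reduced_word_iff inv_perm_eq)
  next
    assume d: "demazure a = inv w"
    obtain b where "b \<in> lists {1..<n}" "ascending b" "inv_perm b = demazure a" "hecke_eq n a b"
      using hecke_eq_ascending[OF a] by auto
    then show "\<exists>r. reduced_word n w r \<and> hecke_eq n a r"
      using d assms by (auto simp: reduced_word_iff word_perm_eq inv_inv_eq)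
  qed
  then show ?thesis unfolding hecke_words_def by blast
qed

definition word_sum :: "nat \<Rightarrow> nat \<Rightarrow> nat \<Rightarrow> (nat \<Rightarrow> nat) \<Rightarrow> int" where
  "word_sum n x L g = (\<Sum>a | a \<in> lists {1..<n} \<and> length a = L \<and> demazure a = g. \<Prod>i\<leftarrow>a. int (x + i))"

lemma finite_words: "finite {a. a \<in> lists {1..<n::nat} \<and> length a = L \<and> P a}"
  by (rule finite_subset[OF _ finite_lists_length_eq[of "{1..<n}" L]]) auto

lemma poly_FK:
  assumes "bij w"
  shows "int (poly (FK n w L) x) = word_sum n x L (inv w)"
proof -
  have "int (poly (prod_list (map (\<lambda>i. [:i, 1:]) a)) x) = (\<Prod>i\<leftarrow>a. int (x + i))" for a
    by (induction a) (auto simp: algebra_simps)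
  then show ?thesis
    unfolding FK_def hecke_words_eq[OF assms] word_sum_def poly_sum of_nat_sum by (intro sum.cong) auto
qed

lemma hop_eq_iff:
  assumes "inj h"
  shows "hop i h = g \<longleftrightarrow> g (Suc i) < g i \<and> (h = g \<or> h = g \<circ> adj i)"
proof -
  have ne: "h i \<noteq> h (Suc i)" using inj_eq[OF assms, of i "Suc i"] by simp
  have *: "f = g \<circ> adj i \<longleftrightarrow> f \<circ> adj i = g" for f
    by (simp only: comp_adj_eq_iff)
  show ?thesis
  proof (cases "h i < h (Suc i)")
    case True
    then have hop: "hop i h = h \<circ> adj i" by (simp add: hop_ascent)
    have "h \<noteq> g" if "g (Suc i) < g i" using that True by auto
    moreover have "g (Suc i) < g i" if "h \<circ> adj i = g" using that True by auto
    ultimately show ?thesis unfolding hop * by blast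
  next
    case False
    then have "hop i h = h" by (simp add: hop_descent)
    moreover have "g i < g (Suc i)" if "h \<circ> adj i = g" using that False ne by auto
    moreover have "g (Suc i) < g i" if "h = g" using that False ne by auto
    ultimately show ?thesis unfolding * using less_asym by metis
  qed
qed

lemma word_sum_Suc:
  assumes "inj g"
  shows "word_sum n x (Suc L) g = (\<Sum>i=1..<n. int (x + i) * dstep (word_sum n x L) g i)"
proof -
  let ?A = "\<lambda>L g. {a. a \<in> lists {1..<n} \<and> length a = L \<and> demazure a = g}"
  have A: "?A (Suc L) g = (\<Union>i\<in>{1..<n}. Cons i ` (if g (Suc i) < g i then ?A L g \<union> ?A L (g \<circ> adj i) else {}))"
  proof (rule set_eqI)
    fix a
    have inj: "inj (demazure b)" for b using demazure_bij bij_is_inj by blast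
    show "a \<in> ?A (Suc L) g \<longleftrightarrow> a \<in> (\<Union>i\<in>{1..<n}. Cons i ` (if g (Suc i) < g i then ?A L g \<union> ?A L (g \<circ> adj i) else {}))"
      by (cases a) (auto simp: hop_eq_iff[OF inj] image_iff)
  qed
  have fin: "finite (?A L h)" for h by (rule finite_words)
  have "word_sum n x (Suc L) g = (\<Sum>i=1..<n. \<Sum>a\<in>Cons i ` (if g (Suc i) < g i then ?A L g \<union> ?A L (g \<circ> adj i) else {}). \<Prod>i\<leftarrow>a. int (x + i))"
    unfolding word_sum_def A using fin by (intro sum.UNION_disjoint) auto
  also have "\<dots> = (\<Sum>i=1..<n. int (x + i) * dstep (word_sum n x L) g i)"
  proof (rule sum.cong[OF refl])
    fix i
    show "(\<Sum>a\<in>Cons i ` (if g (Suc i) < g i then ?A L g \<union> ?A L (g \<circ> adj i) else {}). \<Prod>i\<leftarrow>a. int (x + i)) =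
      int (x + i) * dstep (word_sum n x L) g i"
    proof (cases "g (Suc i) < g i")
      case True
      have "g \<noteq> g \<circ> adj i"
      proof
        assume "g = g \<circ> adj i"
        then have "g i = g (Suc i)" by (metis comp_apply transpose_apply_first)
        then show False using True by simp
      qed
      then have "?A L g \<inter> ?A L (g \<circ> adj i) = {}" by auto
      then have "(\<Sum>a\<in>?A L g \<union> ?A L (g \<circ> adj i). \<Prod>i\<leftarrow>a. int (x + i)) = word_sum n x L g + word_sum n x L (g \<circ> adj i)"
        unfolding word_sum_def by (intro sum.union_disjoint fin)
      then show ?thesis using True
        by (simp add: sum.reindex sum_distrib_left[symmetric] dstep_def del: of_nat_add)
    qed (simp add: dstep_def)
  qed
  finally show ?thesis .
qed

definition shift_perm :: "nat \<Rightarrow> (nat \<Rightarrow> nat) \<Rightarrow> nat \<Rightarrow> nat" where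
  "shift_perm x g p = (if p \<le> x then p else x + g (p - x))"

lemma shift_perm_add: "g 0 = 0 \<Longrightarrow> shift_perm x g (x + i) = x + g i"
  by (auto simp: shift_perm_def)

lemma shift_perm_adj:
  assumes "i > 0"
  shows "shift_perm x (g \<circ> adj i) = shift_perm x g \<circ> adj (x + i)"
  using assms by (auto simp: fun_eq_iff shift_perm_def swap_def)

lemma shift_perm_eq_id_iff: "g 0 = 0 \<Longrightarrow> shift_perm x g = id \<longleftrightarrow> g = id"
  by (auto simp: fun_eq_iff shift_perm_def)
    (metis add_left_imp_eq add_diff_cancel_left' le_add_diff_inverse less_add_same_cancel1 neq0_conv not_le)

lemma word_sum_eq_hecke_sum:
  assumes "g permutes {1..n}"
  shows "word_sum n x L g = hecke_sum (Suc (n + x)) L (shift_perm x g)"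
  using assms
proof (induction L arbitrary: g)
  case 0
  have "{a. a \<in> lists {1..<n} \<and> length a = 0 \<and> demazure a = g} = (if g = id then {[]} else {})" by auto
  then show ?case using permutes_not_in[OF 0, of 0] by (simp add: word_sum_def shift_perm_eq_id_iff)
next
  case (Suc L g)
  have g0: "g 0 = 0" using permutes_not_in[OF Suc.prems, of 0] by simp
  have gn: "g k = k" if "k > n" for k using permutes_not_in[OF Suc.prems, of k] that by simp
  have gle: "g k \<le> n" if "k \<le> n" for k
    using permutes_in_image[OF Suc.prems, of k] that g0 by (cases "k = 0") auto
  have z: "dstep (hecke_sum (Suc (n + x)) L) (shift_perm x g) k = 0" if "k \<le> x \<or> k \<ge> n + x" for k
  proof -
    have "\<not> shift_perm x g (Suc k) < shift_perm x g k"
    proof (cases "k \<le> x")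
      case True
      then show ?thesis by (auto simp: shift_perm_def)
    next
      case False
      then have "k \<ge> n + x" "k > x" using that by auto
      then show ?thesis using gn[of "Suc k - x"] gn[of "k - x"] gle[of "k - x"]
        by (cases "k = n + x") (auto simp: shift_perm_def)
    qed
    then show ?thesis by (simp add: dstep_def)
  qed
  have s: "dstep (hecke_sum (Suc (n + x)) L) (shift_perm x g) (x + i) = dstep (word_sum n x L) g i"
    if i: "i \<in> {1..<n}" for i
  proof -
    have "shift_perm x g (Suc (x + i)) = x + g (Suc i)" "shift_perm x g (x + i) = x + g i"
      using shift_perm_add[of g x, OF g0, of i] shift_perm_add[of g x, OF g0, of "Suc i"] by simp_all
    moreover have "g \<circ> adj i permutes {1..n}"
      using i Suc.prems by (intro permutes_compose[OF permutes_swap_id]) auto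
    then have "word_sum n x L (g \<circ> adj i) = hecke_sum (Suc (n + x)) L (shift_perm x g \<circ> adj (x + i))"
      using Suc.IH shift_perm_adj[of i x g] i by (metis atLeastLessThan_iff less_le_trans zero_less_one)
    ultimately show ?thesis unfolding dstep_def using Suc.IH[OF Suc.prems] by simp
  qed
  have "hecke_sum (Suc (n + x)) (Suc L) (shift_perm x g) =
      (\<Sum>k\<in>(\<lambda>i. x + i) ` {1..<n}. int k * dstep (hecke_sum (Suc (n + x)) L) (shift_perm x g) k)"
    unfolding hecke_sum.simps
  proof (rule sum.mono_neutral_right)
    show "\<forall>k\<in>{1..<Suc (n + x)} - (+) x ` {1..<n}. int k * dstep (hecke_sum (Suc (n + x)) L) (shift_perm x g) k = 0"
    proof
      fix k assume k: "k \<in> {1..<Suc (n + x)} - (+) x ` {1..<n}"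
      have "k \<le> x \<or> k \<ge> n + x"
      proof (rule ccontr)
        assume "\<not> ?thesis"
        then have "k = x + (k - x)" "k - x \<in> {1..<n}" by auto
        then show False using k by blast
      qed
      then show "int k * dstep (hecke_sum (Suc (n + x)) L) (shift_perm x g) k = 0" using z by simp
    qed
  qed auto
  also have "\<dots> = (\<Sum>i=1..<n. int (x + i) * dstep (hecke_sum (Suc (n + x)) L) (shift_perm x g) (x + i))"
    by (subst sum.reindex) auto
  also have "\<dots> = word_sum n x (Suc L) g"
    unfolding word_sum_Suc[OF permutes_inj[OF Suc.prems]] by (intro sum.cong refl) (simp add: s)
  finally show ?case by simp
qed

subsection \<open>Flagged set-valued tableaux with a distinguished corner\<close>

definition flagged_svt :: "(nat \<times> nat) set \<Rightarrow> (nat \<Rightarrow> nat) \<Rightarrow> (nat \<times> nat \<Rightarrow> nat set) \<Rightarrow> bool" where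
  "flagged_svt X F T \<longleftrightarrow> (\<forall>c. c \<notin> X \<longrightarrow> T c = {}) \<and>
     (\<forall>a b. (a, b) \<in> X \<longrightarrow> T (a, b) \<noteq> {}) \<and>
     (\<forall>a b y. (a, b) \<in> X \<longrightarrow> y \<in> T (a, b) \<longrightarrow> 1 \<le> y) \<and>
     (\<forall>a b y. (a, b) \<in> X \<longrightarrow> y \<in> T (a, b) \<longrightarrow> y \<le> F b) \<and>
     (\<forall>a b b' y z. (a, b) \<in> X \<longrightarrow> (a, b') \<in> X \<longrightarrow> b < b' \<longrightarrow> y \<in> T (a, b) \<longrightarrow> z \<in> T (a, b') \<longrightarrow> y \<le> z) \<and>
     (\<forall>a a' b y z. (a, b) \<in> X \<longrightarrow> (a', b) \<in> X \<longrightarrow> a < a' \<longrightarrow> y \<in> T (a, b) \<longrightarrow> z \<in> T (a', b) \<longrightarrow> y < z)"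

definition flagged_svts :: "(nat \<times> nat) set \<Rightarrow> (nat \<Rightarrow> nat) \<Rightarrow> nat \<Rightarrow> (nat \<times> nat \<Rightarrow> nat set) set" where
  "flagged_svts X F j = {T. flagged_svt X F T \<and> (\<Sum>y\<in>X. card (T y)) = j}"

lemma svt_outside: "flagged_svt X F T \<Longrightarrow> c \<notin> X \<Longrightarrow> T c = {}"
  and svt_nonempty: "flagged_svt X F T \<Longrightarrow> (a, b) \<in> X \<Longrightarrow> T (a, b) \<noteq> {}"
  and svt_pos: "flagged_svt X F T \<Longrightarrow> (a, b) \<in> X \<Longrightarrow> y \<in> T (a, b) \<Longrightarrow> 1 \<le> y"
  and svt_le: "flagged_svt X F T \<Longrightarrow> (a, b) \<in> X \<Longrightarrow> y \<in> T (a, b) \<Longrightarrow> y \<le> F b"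
  and svt_row: "flagged_svt X F T \<Longrightarrow> (a, b) \<in> X \<Longrightarrow> (a, b') \<in> X \<Longrightarrow> b < b' \<Longrightarrow> y \<in> T (a, b) \<Longrightarrow> z \<in> T (a, b') \<Longrightarrow> y \<le> z"
  and svt_col: "flagged_svt X F T \<Longrightarrow> (a, b) \<in> X \<Longrightarrow> (a', b) \<in> X \<Longrightarrow> a < a' \<Longrightarrow> y \<in> T (a, b) \<Longrightarrow> z \<in> T (a', b) \<Longrightarrow> y < z"
  unfolding flagged_svt_def by meson+

lemma flagged_svtI:
  assumes "\<And>y. y \<notin> X \<Longrightarrow> T y = {}"
    and "\<And>a b. (a, b) \<in> X \<Longrightarrow> T (a, b) \<noteq> {}"
    and "\<And>a b y. (a, b) \<in> X \<Longrightarrow> y \<in> T (a, b) \<Longrightarrow> 1 \<le> y"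
    and "\<And>a b y. (a, b) \<in> X \<Longrightarrow> y \<in> T (a, b) \<Longrightarrow> y \<le> F b"
    and "\<And>a b b' y z. (a, b) \<in> X \<Longrightarrow> (a, b') \<in> X \<Longrightarrow> b < b' \<Longrightarrow> y \<in> T (a, b) \<Longrightarrow> z \<in> T (a, b') \<Longrightarrow> y \<le> z"
    and "\<And>a a' b y z. (a, b) \<in> X \<Longrightarrow> (a', b) \<in> X \<Longrightarrow> a < a' \<Longrightarrow> y \<in> T (a, b) \<Longrightarrow> z \<in> T (a', b) \<Longrightarrow> y < z"
  shows "flagged_svt X F T"
  unfolding flagged_svt_def by (intro conjI allI impI) (rule assms; assumption)+

lemma finite_flagged_svt:
  assumes "finite X"
  shows "finite {T. flagged_svt X F T}"
proof -
  define B where "B = (\<Union>(a, b)\<in>X. {1..F b})"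
  have "finite B" using assms by (auto simp: B_def)
  then have "finite {T. \<forall>y. (y \<in> X \<longrightarrow> T y \<in> Pow B) \<and> (y \<notin> X \<longrightarrow> T y = {})}"
    using assms by (intro finite_set_of_finite_funs) auto
  moreover have "{T. flagged_svt X F T} \<subseteq> {T. \<forall>y. (y \<in> X \<longrightarrow> T y \<in> Pow B) \<and> (y \<notin> X \<longrightarrow> T y = {})}"
    using svt_outside svt_pos svt_le by (fastforce simp: B_def)
  ultimately show ?thesis by (rule finite_subset[rotated])
qed

lemma finite_flagged_svts: "finite X \<Longrightarrow> finite (flagged_svts X F j)"
  by (rule finite_subset[OF _ finite_flagged_svt[of X F]]) (auto simp: flagged_svts_def)

lemma svt_finite_cell: "flagged_svt X F T \<Longrightarrow> finite (T y)"
proof (cases "y \<in> X")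
  case True
  assume T: "flagged_svt X F T"
  obtain a b where y: "y = (a, b)" by fastforce
  have "T y \<subseteq> {..F b}" using svt_le[OF T] True y by auto
  then show ?thesis by (rule finite_subset) simp
qed (simp add: svt_outside)

lemma svt_shrink:
  assumes "flagged_svt X F T" "S \<subseteq> T c" "S \<noteq> {}"
  shows "flagged_svt X F (T(c := S))"
proof -
  have sub: "z \<in> T y" if "z \<in> (T(c := S)) y" for y z
    using that assms(2) by (auto split: if_splits)
  show ?thesis
  proof (rule flagged_svtI)
    fix y assume "y \<notin> X"
    then have "T y = {}" using assms(1) by (rule svt_outside[rotated])
    then show "(T(c := S)) y = {}" using sub by blast
  next
    fix a b assume "(a, b) \<in> X"
    then show "(T(c := S)) (a, b) \<noteq> {}" using assms(1,3) svt_nonempty by auto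
  next
    fix a b b' y z
    assume "(a, b) \<in> X" "(a, b') \<in> X" "b < b'" "y \<in> (T(c := S)) (a, b)" "z \<in> (T(c := S)) (a, b')"
    then show "y \<le> z" using svt_row[OF assms(1)] sub by blast
  next
    fix a a' b y z
    assume "(a, b) \<in> X" "(a', b) \<in> X" "a < a'" "y \<in> (T(c := S)) (a, b)" "z \<in> (T(c := S)) (a', b)"
    then show "y < z" using svt_col[OF assms(1)] sub by blast
  qed (use assms(1) sub svt_pos svt_le in blast)+
qed

locale tableau_corner =
  fixes X :: "(nat \<times> nat) set" and k C r :: nat and F Fu Fv :: "nat \<Rightarrow> nat"
  assumes finX: "finite X"
    and corner: "(k, C) \<in> X"
    and right: "(k, b) \<in> X \<Longrightarrow> b \<le> C"
    and down: "(a, C) \<in> X \<Longrightarrow> a \<le> k"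
    and young: "(a, b) \<in> X \<Longrightarrow> 1 \<le> a' \<Longrightarrow> a' \<le> a \<Longrightarrow> 1 \<le> b' \<Longrightarrow> b' \<le> b \<Longrightarrow> (a', b') \<in> X"
    and pos: "(a, b) \<in> X \<Longrightarrow> 1 \<le> a \<and> 1 \<le> b"
    and r: "1 \<le> r"
    and left: "1 \<le> b \<Longrightarrow> b \<le> C \<Longrightarrow> F b = r"
    and Fu: "Fu b = F b \<or> (Fu b = r - 1 \<and> 1 \<le> b \<and> b \<le> C \<and> (\<forall>a. (a, b) \<in> X \<longrightarrow> a \<le> k))"
    and FuC: "Fu C = r - 1"
    and Fv: "b \<noteq> C \<Longrightarrow> Fv b = F b"
    and FvC: "1 < k \<Longrightarrow> Fv C \<le> r - 1"
    and FvC': "1 < k \<Longrightarrow> Fv C = r - 1 \<or> ((k - 1, Suc C) \<in> X \<and> F (Suc C) \<le> Fv C)"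
begin

lemma FC: "F C = r"
  using left[of C] pos[OF corner] by simp

lemma Fu_le: "Fu b \<le> F b"
  using Fu[of b] left[of b] by auto

lemma svt_Fu_iff: "flagged_svt X Fu T \<longleftrightarrow> flagged_svt X F T \<and> r \<notin> T (k, C)"
proof
  assume T: "flagged_svt X Fu T"
  have "flagged_svt X F T"
  proof (rule flagged_svtI)
    fix a b y assume "(a, b) \<in> X" "y \<in> T (a, b)"
    then show "y \<le> F b" using svt_le[OF T] Fu_le order.trans by blast
  qed (use T in \<open>meson svt_outside svt_nonempty svt_pos svt_row svt_col\<close>)+
  moreover have "r \<notin> T (k, C)" using svt_le[OF T corner, of r] FuC r by auto
  ultimately show "flagged_svt X F T \<and> r \<notin> T (k, C)" by simp
next
  assume *: "flagged_svt X F T \<and> r \<notin> T (k, C)"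
  then have T: "flagged_svt X F T" by simp
  show "flagged_svt X Fu T"
  proof (rule flagged_svtI)
    fix a b y assume ab: "(a, b) \<in> X" "y \<in> T (a, b)"
    show "y \<le> Fu b"
    proof (cases "Fu b = F b")
      case True
      then show ?thesis using svt_le[OF T ab] by simp
    next
      case False
      then have b: "Fu b = r - 1" "1 \<le> b" "b \<le> C" "a \<le> k" using Fu[of b] ab by auto
      have kb: "(k, b) \<in> X" using young[OF corner, of k b] pos[OF corner] b by simp
      obtain z where z: "z \<in> T (k, C)" using svt_nonempty[OF T corner] by auto
      obtain u where u: "u \<in> T (k, b)" using svt_nonempty[OF T kb] by auto
      have zr: "z \<le> r - 1" using svt_le[OF T corner z] FC z * by (cases "z = r") auto
      have "y \<le> r - 1"
      proof (cases "b = C")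
        case True
        show ?thesis
        proof (cases "a = k")
          case True
          then show ?thesis using svt_le[OF T corner] FC ab * \<open>b = C\<close> by (cases "y = r") fastforce+
        next
          case False
          then show ?thesis using svt_col[OF T ab(1) kb _ ab(2), of z] z b True zr by simp
        qed
      next
        case False
        have uz: "u \<le> z" using svt_row[OF T kb corner _ u z] b False by simp
        show ?thesis
        proof (cases "a = k")
          case True
          then show ?thesis using svt_row[OF T ab(1) _ _ ab(2), of C z] corner z b False zr by auto
        next
          case False
          then show ?thesis using svt_col[OF T ab(1) kb _ ab(2) u] b uz zr by simp
        qed
      qed
      then show ?thesis using b by simp
    qed
  qed (use T in \<open>meson svt_outside svt_nonempty svt_pos svt_row svt_col\<close>)+
qed

lemma svt_insert:
  assumes T: "flagged_svt X Fu T"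
  shows "flagged_svt X F (T((k, C) := insert r (T (k, C))))" (is "flagged_svt X F ?S")
proof -
  have T': "flagged_svt X F T" using T svt_Fu_iff by simp
  show ?thesis
  proof (rule flagged_svtI)
    fix a b b' y z
    assume *: "(a, b) \<in> X" "(a, b') \<in> X" "b < b'" "y \<in> ?S (a, b)"
      "z \<in> ?S (a, b')"
    have "(a, b) \<noteq> (k, C)" using right[of b'] * by auto
    then have y: "y \<in> T (a, b)" using * by (simp split: if_splits)
    show "y \<le> z"
    proof (cases "z \<in> T (a, b')")
      case True
      then show ?thesis using svt_row[OF T' *(1-3) y] by simp
    next
      case False
      then have "z = r" "a = k" "b' = C" using * by (auto split: if_splits)
      then show ?thesis using svt_le[OF T' *(1) y] left[of b] * pos[OF *(1)] by simp
    qed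
  next
    fix a a' b y z
    assume *: "(a, b) \<in> X" "(a', b) \<in> X" "a < a'" "y \<in> ?S (a, b)"
      "z \<in> ?S (a', b)"
    have "(a, b) \<noteq> (k, C)" using down[of a'] * by auto
    then have y: "y \<in> T (a, b)" using * by (simp split: if_splits)
    show "y < z"
    proof (cases "z \<in> T (a', b)")
      case True
      then show ?thesis using svt_col[OF T' *(1-3) y] by simp
    next
      case False
      then have "z = r" "a' = k" "b = C" using * by (auto split: if_splits)
      moreover have "y \<le> Fu C" using svt_le[OF T *(1) y] \<open>b = C\<close> by simp
      ultimately show ?thesis using FuC r by simp
    qed
  next
    fix c assume "c \<notin> X"
    then show "?S c = {}" using corner svt_outside[OF T'] by auto
  next
    fix a b assume "(a, b) \<in> X"
    then show "?S (a, b) \<noteq> {}" using svt_nonempty[OF T'] by auto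
  next
    fix a b y assume *: "(a, b) \<in> X" "y \<in> ?S (a, b)"
    show "1 \<le> y" using * svt_pos[OF T' *(1), of y] r by (auto split: if_splits)
    show "y \<le> F b" using * svt_le[OF T' *(1), of y] FC by (auto split: if_splits)
  qed
qed

abbreviation "X' \<equiv> X - {(k, C)}"

lemma svt_delete_corner:
  assumes T: "flagged_svt X F T" and c: "T (k, C) = {r}"
  shows "flagged_svt X' Fv (T((k, C) := {}))"
proof (rule flagged_svtI)
  fix a b y assume ab: "(a, b) \<in> X'" "y \<in> (T((k, C) := {})) (a, b)"
  then have ab': "(a, b) \<in> X" "y \<in> T (a, b)" "(a, b) \<noteq> (k, C)" by auto
  show "y \<le> Fv b"
  proof (cases "b = C")
    case False
    then show ?thesis using svt_le[OF T ab'(1,2)] Fv by simp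
  next
    case True
    then have a: "a < k" "1 \<le> a" using ab' down[of a] pos[of a b] by auto
    have yr: "y < r" using svt_col[OF T ab'(1) _ a(1) ab'(2), of r] corner c True by simp
    from FvC' show ?thesis
    proof
      assume "Fv C = r - 1" then show ?thesis using yr True by simp
    next
      assume *: "(k - 1, Suc C) \<in> X \<and> F (Suc C) \<le> Fv C"
      then have aC: "(a, Suc C) \<in> X" using young[of "k - 1" "Suc C" a "Suc C"] a by simp
      obtain z where z: "z \<in> T (a, Suc C)" using svt_nonempty[OF T aC] by auto
      have "y \<le> z" using svt_row[OF T ab'(1) aC _ ab'(2) z] True by simp
      also have "z \<le> F (Suc C)" using svt_le[OF T aC z] .
      finally show ?thesis using * True by simp
    qed (use a in simp)
  qed
next
  fix a b b' y z
  assume *: "(a, b) \<in> X'" "(a, b') \<in> X'" "b < b'" "y \<in> (T((k, C) := {})) (a, b)" "z \<in> (T((k, C) := {})) (a, b')"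
  then show "y \<le> z" using svt_row[OF T _ _ *(3), of a y z] by (auto split: if_splits)
next
  fix a a' b y z
  assume *: "(a, b) \<in> X'" "(a', b) \<in> X'" "a < a'" "y \<in> (T((k, C) := {})) (a, b)" "z \<in> (T((k, C) := {})) (a', b)"
  then show "y < z" using svt_col[OF T _ _ *(3), of b y z] by (auto split: if_splits)
next
  fix c assume "c \<notin> X'"
  then show "(T((k, C) := {})) c = {}" using svt_outside[OF T, of c] by (cases "c = (k, C)") auto
next
  fix a b assume "(a, b) \<in> X'"
  then show "(T((k, C) := {})) (a, b) \<noteq> {}" using svt_nonempty[OF T] by auto
next
  fix a b y assume "(a, b) \<in> X'" "y \<in> (T((k, C) := {})) (a, b)"
  then show "1 \<le> y" using svt_pos[OF T, of a b y] by (auto split: if_splits)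
qed

lemma svt_add_corner:
  assumes T: "flagged_svt X' Fv T"
  shows "flagged_svt X F (T((k, C) := {r}))"
proof (rule flagged_svtI)
  fix a b b' y z
  assume *: "(a, b) \<in> X" "(a, b') \<in> X" "b < b'" "y \<in> (T((k, C) := {r})) (a, b)" "z \<in> (T((k, C) := {r})) (a, b')"
  have ne: "(a, b) \<noteq> (k, C)" using right[of b'] * by auto
  then have y: "y \<in> T (a, b)" "(a, b) \<in> X'" using * by (auto split: if_splits)
  show "y \<le> z"
  proof (cases "(a, b') = (k, C)")
    case False
    then have "z \<in> T (a, b')" "(a, b') \<in> X'" using * by auto
    then show ?thesis using svt_row[OF T y(2) _ *(3) y(1), of z] by blast
  next
    case True
    then show ?thesis using svt_le[OF T y(2,1)] left[of b] Fv[of b] * pos[OF *(1)] by simp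
  qed
next
  fix a a' b y z
  assume *: "(a, b) \<in> X" "(a', b) \<in> X" "a < a'" "y \<in> (T((k, C) := {r})) (a, b)" "z \<in> (T((k, C) := {r})) (a', b)"
  have ne: "(a, b) \<noteq> (k, C)" using down[of a'] * by auto
  then have y: "y \<in> T (a, b)" "(a, b) \<in> X'" using * by (auto split: if_splits)
  show "y < z"
  proof (cases "(a', b) = (k, C)")
    case False
    then have "z \<in> T (a', b)" "(a', b) \<in> X'" using * by auto
    then show ?thesis using svt_col[OF T y(2) _ *(3) y(1), of z] by blast
  next
    case True
    then show ?thesis using svt_le[OF T y(2,1)] FvC * pos[OF *(1)] r by simp
  qed
next
  fix a b y assume ab: "(a, b) \<in> X" "y \<in> (T((k, C) := {r})) (a, b)"
  show "y \<le> F b"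
  proof (cases "(a, b) = (k, C)")
    case True
    then show ?thesis using ab FC by simp
  next
    case False
    then have ab': "(a, b) \<in> X'" "y \<in> T (a, b)" using ab by (auto split: if_splits)
    then have "y \<le> Fv b" using svt_le[OF T] by simp
    moreover have "Fv b \<le> F b"
    proof (cases "b = C")
      case True
      then have "1 < k" using False ab down[of a] pos[of a b] by auto
      then show ?thesis using FvC FC True by simp
    qed (simp add: Fv)
    ultimately show ?thesis by simp
  qed
next
  fix c assume "c \<notin> X"
  then have "c \<noteq> (k, C)" "c \<notin> X'" using corner by auto
  then show "(T((k, C) := {r})) c = {}" using svt_outside[OF T, of c] by simp
next
  fix a b assume "(a, b) \<in> X"
  then show "(T((k, C) := {r})) (a, b) \<noteq> {}" using svt_nonempty[OF T] by auto
next
  fix a b y assume *: "(a, b) \<in> X" "y \<in> (T((k, C) := {r})) (a, b)"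
  then show "1 \<le> y" using svt_pos[OF T, of a b y] r by (auto split: if_splits)
qed

lemma size_upd: "(\<Sum>y\<in>X. card ((T((k, C) := S)) y)) + card (T (k, C)) = (\<Sum>y\<in>X. card (T y)) + card S"
proof -
  have "(\<Sum>y\<in>X. card ((T((k, C) := S)) y)) = card S + (\<Sum>y\<in>X'. card (T y))"
  proof -
    have "(\<Sum>y\<in>X'. card ((T((k, C) := S)) y)) = (\<Sum>y\<in>X'. card (T y))"
      by (intro sum.cong) auto
    then show ?thesis using sum.remove[OF finX corner, of "\<lambda>y. card ((T((k, C) := S)) y)"] by simp
  qed
  then show ?thesis using sum.remove[OF finX corner, of "\<lambda>y. card (T y)"] by simp
qed

lemma card_flagged_svts_corner:
  "card (flagged_svts X F (Suc j)) = card (flagged_svts X' Fv j) + card (flagged_svts X Fu (Suc j)) + card (flagged_svts X Fu j)"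
proof -
  let ?A = "flagged_svts X F (Suc j)"
  let ?A1 = "{T \<in> ?A. r \<notin> T (k, C)}" and ?A2 = "{T \<in> ?A. T (k, C) = {r}}"
    and ?A3 = "{T \<in> ?A. r \<in> T (k, C) \<and> T (k, C) \<noteq> {r}}"
  have fin: "finite ?A" using finX by (rule finite_flagged_svts)
  have "?A = ?A2 \<union> ?A1 \<union> ?A3" by auto
  then have "card ?A = card (?A2 \<union> ?A1 \<union> ?A3)" by simp
  also have "\<dots> = card (?A2 \<union> ?A1) + card ?A3" using fin by (intro card_Un_disjoint) auto
  also have "card (?A2 \<union> ?A1) = card ?A2 + card ?A1" using fin by (intro card_Un_disjoint) auto
  also have "?A1 = flagged_svts X Fu (Suc j)" by (auto simp: flagged_svts_def svt_Fu_iff)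
  also have "card ?A2 = card (flagged_svts X' Fv j)"
  proof (rule bij_betw_same_card[OF bij_betwI[where f = "\<lambda>T. T((k, C) := {})" and g = "\<lambda>T. T((k, C) := {r})"]])
    show "(\<lambda>T. T((k, C) := {})) \<in> ?A2 \<rightarrow> flagged_svts X' Fv j"
    proof
      fix T assume T: "T \<in> ?A2"
      then have "(\<Sum>y\<in>X. card ((T((k, C) := {})) y)) = j" using size_upd[of T "{}"] by (simp add: flagged_svts_def)
      moreover have "(\<Sum>y\<in>X. card ((T((k, C) := {})) y)) = (\<Sum>y\<in>X'. card ((T((k, C) := {})) y))"
        using sum.remove[OF finX corner, of "\<lambda>y. card ((T((k, C) := {})) y)"] by simp
      ultimately show "T((k, C) := {}) \<in> flagged_svts X' Fv j"
        using T svt_delete_corner by (simp add: flagged_svts_def)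
    qed
    show "(\<lambda>T. T((k, C) := {r})) \<in> flagged_svts X' Fv j \<rightarrow> ?A2"
    proof
      fix T assume T: "T \<in> flagged_svts X' Fv j"
      then have c: "T (k, C) = {}" using svt_outside[of X' Fv T "(k, C)"] by (simp add: flagged_svts_def)
      have "(\<Sum>y\<in>X. card (T y)) = j"
        using T sum.remove[OF finX corner, of "\<lambda>y. card (T y)"] c by (simp add: flagged_svts_def)
      then have "(\<Sum>y\<in>X. card ((T((k, C) := {r})) y)) = Suc j" using size_upd[of T "{r}"] c by simp
      then show "T((k, C) := {r}) \<in> ?A2" using T svt_add_corner by (simp add: flagged_svts_def)
    qed
    show "\<And>T. T \<in> ?A2 \<Longrightarrow> T((k, C) := {}, (k, C) := {r}) = T" by (auto simp: fun_eq_iff)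
    show "\<And>T. T \<in> flagged_svts X' Fv j \<Longrightarrow> T((k, C) := {r}, (k, C) := {}) = T"
    proof -
      fix T assume T: "T \<in> flagged_svts X' Fv j"
      then have "T (k, C) = {}" using svt_outside[of X' Fv T "(k, C)"] by (simp add: flagged_svts_def)
      then show "T((k, C) := {r}, (k, C) := {}) = T" by (auto simp: fun_eq_iff)
    qed
  qed
  also have "card ?A3 = card (flagged_svts X Fu j)"
  proof (rule bij_betw_same_card[OF bij_betwI[where f = "\<lambda>T. T((k, C) := T (k, C) - {r})" and g = "\<lambda>T. T((k, C) := insert r (T (k, C)))"]])
    show "(\<lambda>T. T((k, C) := T (k, C) - {r})) \<in> ?A3 \<rightarrow> flagged_svts X Fu j"
    proof
      fix T assume T: "T \<in> ?A3"
      then have sv: "flagged_svt X F T" by (simp add: flagged_svts_def)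
      have "flagged_svt X F (T((k, C) := T (k, C) - {r}))" using T sv by (intro svt_shrink) auto
      moreover have "card (T (k, C)) = Suc (card (T (k, C) - {r}))"
        using T by (intro card.remove svt_finite_cell[OF sv]) auto
      then have "(\<Sum>y\<in>X. card ((T((k, C) := T (k, C) - {r})) y)) = j"
        using size_upd[of T "T (k, C) - {r}"] T by (simp add: flagged_svts_def)
      ultimately show "T((k, C) := T (k, C) - {r}) \<in> flagged_svts X Fu j"
        by (simp add: flagged_svts_def svt_Fu_iff)
    qed
    show "(\<lambda>T. T((k, C) := insert r (T (k, C)))) \<in> flagged_svts X Fu j \<rightarrow> ?A3"
    proof
      fix T assume T: "T \<in> flagged_svts X Fu j"
      then have sv: "flagged_svt X Fu T" by (simp add: flagged_svts_def)
      then have c: "r \<notin> T (k, C)" "T (k, C) \<noteq> {}" using svt_Fu_iff svt_nonempty[OF sv corner] by auto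
      have "(\<Sum>y\<in>X. card ((T((k, C) := insert r (T (k, C)))) y)) = Suc j"
        using size_upd[of T "insert r (T (k, C))"] T svt_finite_cell[OF sv] c by (simp add: flagged_svts_def)
      then show "T((k, C) := insert r (T (k, C))) \<in> ?A3" using c svt_insert[OF sv] by (auto simp: flagged_svts_def)
    qed
    show "\<And>T. T \<in> ?A3 \<Longrightarrow> (T((k, C) := T (k, C) - {r}))((k, C) := insert r ((T((k, C) := T (k, C) - {r})) (k, C))) = T"
      by (auto simp: fun_eq_iff)
    show "\<And>T. T \<in> flagged_svts X Fu j \<Longrightarrow> (T((k, C) := insert r (T (k, C))))((k, C) := (T((k, C) := insert r (T (k, C)))) (k, C) - {r}) = T"
      by (auto simp: fun_eq_iff flagged_svts_def svt_Fu_iff)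
  qed
  finally show ?thesis .
qed

end

abbreviation surjections :: "nat \<Rightarrow> nat \<Rightarrow> nat" where
  "surjections L j \<equiv> fact j * Stirling L j"

lemma surjections_Suc: "surjections (Suc L) (Suc j) = Suc j * (surjections L (Suc j) + surjections L j)"
  by (simp add: algebra_simps)

lemma sum_binomial_Suc:
  fixes h :: "nat \<Rightarrow> nat"
  shows "(\<Sum>m\<le>Suc L. (Suc L choose m) * h m) = (\<Sum>m\<le>L. (L choose m) * h m) + (\<Sum>m\<le>L. (L choose m) * h (Suc m))"
proof -
  have "(\<Sum>m\<le>Suc L. (Suc L choose m) * h m) = h 0 + (\<Sum>m\<le>L. (Suc L choose Suc m) * h (Suc m))"
    by (subst sum.atMost_Suc_shift) simp
  also have "\<dots> = h 0 + (\<Sum>m\<le>L. (L choose Suc m) * h (Suc m)) + (\<Sum>m\<le>L. (L choose m) * h (Suc m))"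
    by (simp add: distrib_right sum.distrib)
  also have "h 0 + (\<Sum>m\<le>L. (L choose Suc m) * h (Suc m)) = (\<Sum>m\<le>Suc L. (L choose m) * h m)"
    by (subst sum.atMost_Suc_shift) simp
  finally show ?thesis by simp
qed

lemma sum_binomial_surj: "(\<Sum>m\<le>L. (L choose m) * surjections m j) = surjections L j + surjections L (Suc j)"
proof (induction L arbitrary: j)
  case 0
  show ?case by (cases j) simp_all
next
  case (Suc L)
  show ?case
  proof (cases j)
    case 0
    have "(\<Sum>m\<le>L. (L choose m) * surjections (Suc m) j) = 0" using 0 by simp
    moreover have "surjections (Suc L) 0 + surjections (Suc L) (Suc 0) = 1 * (surjections L (Suc 0) + surjections L 0)"
      using surjections_Suc[of L 0] by simp
    ultimately show ?thesis unfolding sum_binomial_Suc Suc.IH using 0 by simp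
  next
    case (Suc i)
    have "(\<Sum>m\<le>L. (L choose m) * surjections (Suc m) j) = Suc i * ((\<Sum>m\<le>L. (L choose m) * surjections m (Suc i)) + (\<Sum>m\<le>L. (L choose m) * surjections m i))"
      unfolding Suc surjections_Suc by (simp only: sum.distrib[symmetric] sum_distrib_left) (simp add: algebra_simps)
    then show ?thesis unfolding sum_binomial_Suc Suc.IH Suc surjections_Suc by (simp add: algebra_simps del: Stirling.simps fact_Suc)
  qed
qed

subsection \<open>The transition on codes and tableaux\<close>

definition code_cells :: "(nat \<Rightarrow> nat) \<Rightarrow> (nat \<times> nat) set" where
  "code_cells c = {(a, b). 1 \<le> a \<and> 1 \<le> b \<and> a \<le> card {p. b \<le> c p}}"

text \<open>Rows of a tableau are weakly increasing, so flagging each row by the flag of its last cell is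
  the same as bounding the entries of column b by the last row whose code is at least b.\<close>

definition last_row :: "(nat \<Rightarrow> nat) \<Rightarrow> nat \<Rightarrow> nat" where
  "last_row c b = Max {p. b \<le> c p}"

definition tableau_count :: "(nat \<Rightarrow> nat) \<Rightarrow> nat \<Rightarrow> nat" where
  "tableau_count c j = card (flagged_svts (code_cells c) (last_row c) j)"

lemma flagged_svts_0_empty:
  assumes "finite X" "x \<in> X"
  shows "flagged_svts X F 0 = {}"
proof -
  have False if T: "flagged_svt X F T" "(\<Sum>y\<in>X. card (T y)) = 0" for T
  proof -
    have "card (T x) = 0" using T(2) assms by simp
    then have "T x = {}" using svt_finite_cell[OF T(1)] by simp
    then show False using svt_nonempty[OF T(1), of "fst x" "snd x"] assms by simp
  qed
  then show ?thesis by (auto simp: flagged_svts_def)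
qed

locale last_code =
  fixes c :: "nat \<Rightarrow> nat" and r :: nat
  assumes c0: "c 0 = 0" and cr: "0 < c r" and beyond: "r < p \<Longrightarrow> c p = 0"
begin

abbreviation "C \<equiv> c r"
abbreviation "k \<equiv> card {p. C \<le> c p}"
abbreviation "cv \<equiv> c(r := C - 1)"

lemma r_pos: "1 \<le> r"
  using c0 cr by (cases r) auto

lemma rows_le: "1 \<le> b \<Longrightarrow> {p. b \<le> c p} \<subseteq> {..r}"
  using beyond by (auto simp: not_less[symmetric])

lemma finite_rows: "1 \<le> b \<Longrightarrow> finite {p. b \<le> c p}"
  using rows_le finite_subset by blast

lemma k_pos: "1 \<le> k"
  using finite_rows[of C] cr by (simp add: Suc_le_eq card_gt_0_iff) auto

lemma finite_code_cells: "finite (code_cells c)"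
proof -
  have "code_cells c \<subseteq> {..Suc r} \<times> {..Max (c ` {..r})}"
  proof
    fix y assume y: "y \<in> code_cells c"
    obtain a b where ab: "y = (a, b)" "1 \<le> a" "1 \<le> b" "a \<le> card {p. b \<le> c p}"
      using y by (auto simp: code_cells_def)
    have "card {p. b \<le> c p} \<le> card {..r}" using rows_le[OF ab(3)] by (intro card_mono) auto
    moreover have "card {p. b \<le> c p} \<noteq> 0" using ab by simp
    then have "{p. b \<le> c p} \<noteq> {}" by (metis card.empty)
    then obtain p where p: "b \<le> c p" by auto
    then have "p \<le> r" using rows_le[OF ab(3)] by auto
    then have "c p \<le> Max (c ` {..r})" by (intro Max_ge) auto
    ultimately show "y \<in> {..Suc r} \<times> {..Max (c ` {..r})}" using ab p by simp
  qed
  then show ?thesis by (rule finite_subset) simp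
qed

lemma code_cells_young:
  assumes "(a, b) \<in> code_cells c" "1 \<le> a'" "a' \<le> a" "1 \<le> b'" "b' \<le> b"
  shows "(a', b') \<in> code_cells c"
proof -
  have "card {p. b \<le> c p} \<le> card {p. b' \<le> c p}"
    using assms finite_rows[of b'] by (intro card_mono) auto
  then show ?thesis using assms by (auto simp: code_cells_def)
qed

lemma corner_cell: "(k, C) \<in> code_cells c"
  using k_pos cr by (simp add: code_cells_def)

lemma corner_right: "(k, b) \<in> code_cells c \<Longrightarrow> b \<le> C"
proof (rule ccontr)
  assume b: "(k, b) \<in> code_cells c" "\<not> b \<le> C"
  have "card {p. b \<le> c p} < k"
    using b finite_rows[of C] cr by (intro psubset_card_mono) auto
  then show False using b by (simp add: code_cells_def)
qed

lemma last_row_le: "1 \<le> b \<Longrightarrow> b \<le> C \<Longrightarrow> last_row c b = r"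
  unfolding last_row_def using finite_rows[of b] rows_le[of b] by (intro Max_eqI) auto

lemma rows_cv: "b \<noteq> C \<Longrightarrow> {p. b \<le> cv p} = {p. b \<le> c p}"
  by auto

lemma rows_cv_C: "{p. C \<le> cv p} = {p. C \<le> c p} - {r}"
  using cr by auto

lemma last_row_cv: "b \<noteq> C \<Longrightarrow> last_row cv b = last_row c b"
  unfolding last_row_def by (subst rows_cv) auto

lemma code_cells_cv: "code_cells cv = code_cells c - {(k, C)}"
proof -
  have cC: "card {p. C \<le> cv p} = k - 1" unfolding rows_cv_C by simp
  have "(a, b) \<in> code_cells cv \<longleftrightarrow> (a, b) \<in> code_cells c \<and> (a, b) \<noteq> (k, C)" for a b
  proof (cases "b = C")
    case True
    define K where "K = k"
    have "K \<ge> 1" using k_pos by (simp only: K_def)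
    then have "(1 \<le> a \<and> 1 \<le> C \<and> a \<le> K - 1) \<longleftrightarrow> (1 \<le> a \<and> 1 \<le> C \<and> a \<le> K) \<and> (a, C) \<noteq> (K, C)" by auto
    then show ?thesis unfolding code_cells_def mem_Collect_eq case_prod_conv True cC K_def .
  next
    case False
    show ?thesis unfolding code_cells_def mem_Collect_eq case_prod_conv rows_cv[OF False] using False by simp
  qed
  then show ?thesis by (auto simp del: fun_upd_apply)
qed

lemma last_row_cv_C: "1 < k \<Longrightarrow> last_row cv C \<in> {p. C \<le> c p} - {r}"
proof -
  assume "1 < k"
  then have "card ({p. C \<le> c p} - {r}) > 0" by simp
  then have "finite ({p. C \<le> c p} - {r}) \<and> {p. C \<le> c p} - {r} \<noteq> {}" unfolding card_gt_0_iff by blast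
  then show "last_row cv C \<in> {p. C \<le> c p} - {r}"
    unfolding last_row_def rows_cv_C by (intro Max_in) blast+
qed

lemma last_row_cv_C_le: "1 < k \<Longrightarrow> last_row cv C \<le> r - 1"
  using last_row_cv_C rows_le[of C] cr by fastforce

lemma last_row_cv_C_eq:
  assumes "1 < k" "C \<le> c (r - 1)"
  shows "last_row cv C = r - 1"
proof (rule antisym)
  show "last_row cv C \<le> r - 1" using assms(1) by (rule last_row_cv_C_le)
  show "r - 1 \<le> last_row cv C"
    unfolding last_row_def rows_cv_C using assms finite_rows[of C] cr r_pos by (intro Max_ge) auto
qed

lemma tableau_cornerI:
  assumes "\<And>b. Fu b = last_row c b \<or>
      (Fu b = r - 1 \<and> 1 \<le> b \<and> b \<le> C \<and> (\<forall>a. (a, b) \<in> code_cells c \<longrightarrow> a \<le> k))"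
    and "Fu C = r - 1"
    and "1 < k \<Longrightarrow> last_row cv C = r - 1 \<or>
      ((k - 1, Suc C) \<in> code_cells c \<and> last_row c (Suc C) \<le> last_row cv C)"
  shows "tableau_corner (code_cells c) k C r (last_row c) Fu (last_row cv)"
proof
  show "finite (code_cells c)" by (rule finite_code_cells)
  show "(k, C) \<in> code_cells c" by (rule corner_cell)
  show "\<And>b. (k, b) \<in> code_cells c \<Longrightarrow> b \<le> C" by (rule corner_right)
  show "\<And>a. (a, C) \<in> code_cells c \<Longrightarrow> a \<le> k" by (simp add: code_cells_def)
  show "\<And>a b a' b'. (a, b) \<in> code_cells c \<Longrightarrow> 1 \<le> a' \<Longrightarrow> a' \<le> a \<Longrightarrow> 1 \<le> b' \<Longrightarrow> b' \<le> b \<Longrightarrow> (a', b') \<in> code_cells c"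
    by (rule code_cells_young)
  show "\<And>a b. (a, b) \<in> code_cells c \<Longrightarrow> 1 \<le> a \<and> 1 \<le> b" by (simp add: code_cells_def)
  show "1 \<le> r" by (rule r_pos)
  show "\<And>b. 1 \<le> b \<Longrightarrow> b \<le> C \<Longrightarrow> last_row c b = r" by (rule last_row_le)
  show "\<And>b. b \<noteq> C \<Longrightarrow> last_row cv b = last_row c b" by (rule last_row_cv)
  show "1 < k \<Longrightarrow> last_row cv C \<le> r - 1" by (rule last_row_cv_C_le)
qed (rule assms; assumption)+

lemma tableau_count_0: "tableau_count c 0 = 0"
  using flagged_svts_0_empty[OF finite_code_cells corner_cell] by (simp add: tableau_count_def)

lemma tableau_count_move:
  assumes i: "i < r" "c i < C"
    and between: "\<And>j. i < j \<Longrightarrow> j < r \<Longrightarrow> C \<le> c j"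
    and gap: "\<And>j. j < r \<Longrightarrow> c j < C \<Longrightarrow> c j \<le> c i"
    and before: "\<And>j. j < i \<Longrightarrow> c j \<noteq> C"
  defines "cu \<equiv> c(r := c i, i := C)"
  shows "tableau_count c (Suc j) = tableau_count cv j + tableau_count cu (Suc j) + tableau_count cu j"
    and "tableau_count cu 0 = 0"
proof -
  have cu: "cu = c \<circ> swap i r"
    using i by (auto simp: cu_def fun_eq_iff swap_def)
  have card_cu: "card {p. b \<le> cu p} = card {p. b \<le> c p}" for b
  proof -
    have "{p. b \<le> cu p} = swap i r -` {p. b \<le> c p}" by (auto simp: cu)
    then show ?thesis by (simp only: card_vimage_inj[OF inj_transpose] surj_transpose subset_UNIV)
  qed
  have cells: "code_cells cu = code_cells c" by (simp add: code_cells_def card_cu)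
  have rows_same: "{p. b \<le> cu p} = {p. b \<le> c p}" if "C < b \<or> b \<le> c i" for b
    using that i by (auto simp: cu_def)
  have rows_mid: "{p. b \<le> c p} = {p. C \<le> c p}" if "c i < b" "b \<le> C" for b
  proof -
    have "C \<le> c p" if "b \<le> c p" for p
    proof (rule ccontr)
      assume "\<not> C \<le> c p"
      moreover from this have "p \<noteq> r" by auto
      moreover have "p \<le> r" using rows_le[of b] that \<open>c i < b\<close> by auto
      ultimately have "c p \<le> c i" using gap[of p] by simp
      then show False using that \<open>c i < b\<close> by simp
    qed
    then show ?thesis using that by auto
  qed
  have rm1: "r - 1 = i \<or> C \<le> c (r - 1)" using between[of "r - 1"] i by linarith
  have last_mid: "last_row cu b = r - 1" if b: "c i < b" "b \<le> C" for b
  proof -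
    have "{p. b \<le> cu p} \<subseteq> {..r} - {r}"
      using b i rows_le[of b] by (auto simp: cu_def split: if_splits)
    moreover have "r - 1 \<in> {p. b \<le> cu p}"
      using b i rm1 by (auto simp: cu_def)
    ultimately show ?thesis
      unfolding last_row_def using finite_subset[of "{p. b \<le> cu p}" "{..r} - {r}"] by (intro Max_eqI) fastforce+
  qed
  interpret tableau_corner "code_cells c" k C r "last_row c" "last_row cu" "last_row cv"
  proof (rule tableau_cornerI)
    show "last_row cu C = r - 1" using last_mid[of C] i by simp
    show "last_row cu b = last_row c b \<or> (last_row cu b = r - 1 \<and> 1 \<le> b \<and> b \<le> C \<and> (\<forall>a. (a, b) \<in> code_cells c \<longrightarrow> a \<le> k))" for b
    proof (cases "c i < b \<and> b \<le> C")
      case True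
      then show ?thesis using last_mid[of b] rows_mid[of b] by (auto simp: code_cells_def)
    next
      case False
      then show ?thesis using rows_same[of b] by (auto simp: last_row_def)
    qed
    show "last_row cv C = r - 1 \<or> ((k - 1, Suc C) \<in> code_cells c \<and> last_row c (Suc C) \<le> last_row cv C)" if k1: "1 < k"
    proof (cases "\<exists>j<r. c j = C")
      case True
      then obtain j where j: "j < r" "c j = C" by blast
      have "i < j" using before[of j] j i(2) by (metis less_irrefl nat_neq_iff)
      then have "C \<le> c (r - 1)" using rm1 j by auto
      then show ?thesis using last_row_cv_C_eq[OF k1] by simp
    next
      case False
      have ne: "c p \<noteq> C" if "p \<noteq> r" for p
        using False beyond[of p] cr that by (cases "p < r") auto
      have mem: "Suc C \<le> c p \<longleftrightarrow> C \<le> c p \<and> p \<noteq> r" for p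
        using ne[of p] by (cases "p = r") (simp, linarith)
      have "{p. Suc C \<le> c p} = {p. C \<le> c p} - {r}"
        unfolding mem by blast
      moreover have "card ({p. C \<le> c p} - {r}) = k - 1" by simp
      moreover have "1 \<le> k - 1" using k1 by linarith
      ultimately show ?thesis unfolding code_cells_def last_row_def rows_cv_C by simp
    qed
  qed
  show "tableau_count c (Suc j) = tableau_count cv j + tableau_count cu (Suc j) + tableau_count cu j"
    unfolding tableau_count_def cells code_cells_cv by (rule card_flagged_svts_corner)
  show "tableau_count cu 0 = 0"
    using flagged_svts_0_empty[OF finite_code_cells corner_cell] by (simp add: tableau_count_def cells)
qed

lemma tableau_count_drop:
  assumes full: "\<And>j. 1 \<le> j \<Longrightarrow> j < r \<Longrightarrow> C \<le> c j"
  shows "tableau_count c (Suc j) = tableau_count cv j"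
proof -
  define Fu where "Fu b = (if 1 \<le> b \<and> b \<le> C then r - 1 else last_row c b)" for b
  have rows: "{p. b \<le> c p} = {1..r}" if "1 \<le> b" "b \<le> C" for b
  proof -
    have "b \<le> c p" if "p \<in> {1..r}" for p
      using full[of p] that \<open>b \<le> C\<close> by (cases "p = r") auto
    moreover have "p \<noteq> 0" if "b \<le> c p" for p using that c0 \<open>1 \<le> b\<close> by (cases p) auto
    ultimately show ?thesis using rows_le[OF that(1)] by (auto simp: Suc_le_eq)
  qed
  have kr: "k = r" using rows[of C] cr by simp
  interpret tableau_corner "code_cells c" k C r "last_row c" Fu "last_row cv"
  proof (rule tableau_cornerI)
    show "Fu C = r - 1" using cr by (simp add: Fu_def)
    show "Fu b = last_row c b \<or> (Fu b = r - 1 \<and> 1 \<le> b \<and> b \<le> C \<and> (\<forall>a. (a, b) \<in> code_cells c \<longrightarrow> a \<le> k))" for b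
      using rows[of b] kr by (auto simp: Fu_def code_cells_def)
    show "last_row cv C = r - 1 \<or> ((k - 1, Suc C) \<in> code_cells c \<and> last_row c (Suc C) \<le> last_row cv C)" if k1: "1 < k"
      using last_row_cv_C_eq[OF k1] full[of "r - 1"] k1 kr by simp
  qed
  have "flagged_svts (code_cells c) Fu j = {}" for j
  proof -
    have False if T: "flagged_svt (code_cells c) Fu T" for T
    proof -
      have cell: "(a, C) \<in> code_cells c" if "1 \<le> a" "a \<le> r" for a
        using that kr cr by (simp add: code_cells_def)
      have ge: "a \<le> y" if "1 \<le> a" "a \<le> r" "y \<in> T (a, C)" for a y
        using that
      proof (induction a arbitrary: y)
        case (Suc a)
        show ?case
        proof (cases "a = 0")
          case False
          obtain z where z: "z \<in> T (a, C)" using svt_nonempty[OF T cell[of a]] False Suc.prems by auto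
          have "z < y" using svt_col[OF T cell[of a] cell[of "Suc a"] _ z, of y] False Suc.prems by simp
          then show ?thesis using Suc.IH[of z] z False Suc.prems by simp
        qed (use svt_pos[OF T cell[of "Suc a"]] Suc.prems in simp)
      qed simp
      obtain y where y: "y \<in> T (r, C)" using svt_nonempty[OF T cell[of r]] r_pos by auto
      then have "y \<le> Fu C" using svt_le[OF T cell[of r]] r_pos by simp
      then show False using ge[OF r_pos _ y] cr r_pos by (simp add: Fu_def)
    qed
    then show ?thesis by (auto simp: flagged_svts_def)
  qed
  then show ?thesis unfolding tableau_count_def code_cells_cv card_flagged_svts_corner by simp
qed

end

definition lehmer :: "(nat \<Rightarrow> nat) \<Rightarrow> nat \<Rightarrow> nat" where
  "lehmer W p = card {q. p < q \<and> W q < W p}"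

lemma lehmer_eq_0:
  assumes "\<And>q. p < q \<Longrightarrow> W p < W q"
  shows "lehmer W p = 0"
proof -
  have "{q. p < q \<and> W q < W p} = {}" using assms less_asym by blast
  then show ?thesis by (simp only: lehmer_def card.empty)
qed

definition avoids_2143 :: "(nat \<Rightarrow> nat) \<Rightarrow> bool" where
  "avoids_2143 W \<longleftrightarrow> \<not> (\<exists>a b c d. a < b \<and> b < c \<and> c < d \<and> W b < W a \<and> W a < W d \<and> W d < W c)"

lemma avoids_2143D:
  assumes "avoids_2143 W" "a < b" "b < c" "c < d" "W b < W a" "W a < W d" "W d < W c"
  shows False
  using assms unfolding avoids_2143_def by blast

locale vexillary_step =
  fixes M :: nat and W :: "nat \<Rightarrow> nat" and r s :: nat
  assumes perm: "W permutes {1..<M}" and vex: "avoids_2143 W"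
    and rs: "r < s" and desc: "W s < W r"
    and inc: "\<And>p q. r < p \<Longrightarrow> p < q \<Longrightarrow> W p < W q"
    and after: "\<And>q. s < q \<Longrightarrow> W r < W q"
begin

definition "v = W \<circ> swap r s"

lemma W_eq: "W p = W q \<longleftrightarrow> p = q"
  using permutes_inj[OF perm] by (auto dest: injD)

lemma W0: "W 0 = 0"
  using permutes_not_in[OF perm, of 0] by simp

lemma finite_below: "finite {q. P q \<and> W q < m}"
proof (rule finite_subset)
  show "{q. P q \<and> W q < m} \<subseteq> W -` {..<m}" by auto
  show "finite (W -` {..<m})" using permutes_inj[OF perm] by (intro finite_vimageI) auto
qed

lemma v_simps: "v r = W s" "v s = W r" "p \<noteq> r \<Longrightarrow> p \<noteq> s \<Longrightarrow> v p = W p"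
  by (simp_all add: v_def)

lemma below_r: "r < q \<Longrightarrow> W q < W r \<longleftrightarrow> q \<le> s"
  using after[of q] inc[of q s] desc by (cases "q = s"; cases "q < s") auto

lemma v_inc: "r < p \<Longrightarrow> p < q \<Longrightarrow> v p < v q"
  using inc[of p q] inc[of p s] desc after[of q] rs
  by (cases "p = s"; cases "q = s") (auto simp: v_simps)

lemma lehmer_beyond: "r < p \<Longrightarrow> lehmer W p = 0"
  using inc by (intro lehmer_eq_0)

lemma lehmer_r: "lehmer W r = s - r"
proof -
  have "{q. r < q \<and> W q < W r} = {r<..s}" using below_r by auto
  then show ?thesis by (simp add: lehmer_def)
qed

lemma lehmer_0: "lehmer W 0 = 0"
  by (simp add: lehmer_def W0)

lemma last_code: "last_code (lehmer W) r"
  using rs by unfold_locales (simp_all add: lehmer_0 lehmer_beyond lehmer_r)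

lemma card_shuffle:
  assumes "bij t" "\<And>q. p < q \<longleftrightarrow> p < t q" "\<And>q. p < q \<Longrightarrow> (W' q < m) = (W (t q) < m)"
  shows "card {q. p < q \<and> W' q < m} = card {q. p < q \<and> W q < m}"
proof -
  have "{q. p < q \<and> W' q < m} = t -` {q. p < q \<and> W q < m}" using assms by auto
  then show ?thesis using assms(1) by (simp only: card_vimage_inj[OF bij_is_inj] bij_is_surj subset_UNIV)
qed

lemma lehmer_v: "lehmer v = (lehmer W)(r := lehmer W r - 1)"
proof
  fix p
  consider "p < r" | "p = r" | "r < p" by linarith
  then show "lehmer v p = ((lehmer W)(r := lehmer W r - 1)) p"
  proof cases
    case 1
    have "card {q. p < q \<and> v q < W p} = card {q. p < q \<and> W q < W p}"
      using 1 rs by (intro card_shuffle[where t = "swap r s"])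
        (auto simp: v_def swap_def)
    then show ?thesis using 1 rs by (simp add: lehmer_def v_simps)
  next
    case 2
    have "{q. r < q \<and> v q < W s} = {r<..<s}"
    proof (rule set_eqI)
      fix q
      show "q \<in> {q. r < q \<and> v q < W s} \<longleftrightarrow> q \<in> {r<..<s}"
        using inc[of q s] inc[of s q] rs desc by (cases q s rule: linorder_cases) (auto simp: v_simps)
    qed
    then show ?thesis using 2 by (simp add: lehmer_def[of v] v_simps lehmer_r)
  next
    case 3
    then have "lehmer v p = 0" using v_inc by (intro lehmer_eq_0)
    then show ?thesis using 3 by (simp add: lehmer_beyond)
  qed
qed

lemma avoids_v: "avoids_2143 v"
  unfolding avoids_2143_def
proof
  assume "\<exists>a b c d. a < b \<and> b < c \<and> c < d \<and> v b < v a \<and> v a < v d \<and> v d < v c"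
  then obtain a b c d where *: "a < b" "b < c" "c < d" "v b < v a" "v a < v d" "v d < v c" by blast
  have cr: "c \<le> r" using v_inc[of c d] * by (meson leI order.asym)
  then have ab: "v a = W a" "v b = W b" using * rs by (simp_all add: v_simps)
  show False
  proof (cases "c = r")
    case True
    then have "d \<noteq> s" using * desc by (auto simp: v_simps)
    then have "v d = W d" using * True by (simp add: v_simps)
    then show False using avoids_2143D[OF vex *(1-3)] * ab desc True by (auto simp: v_simps)
  next
    case False
    then have c: "v c = W c" "c < r" using cr rs by (simp_all add: v_simps)
    consider "d = r" | "d = s" | "d \<noteq> r" "d \<noteq> s" by blast
    then show False
    proof cases
      case 1
      then show False using avoids_2143D[OF vex *(1,2), of s] * ab c rs by (simp add: v_simps)
    next
      case 2
      then show False using avoids_2143D[OF vex *(1,2), of r] * ab c rs by (simp add: v_simps)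
    next
      case 3
      then show False using avoids_2143D[OF vex *(1-3)] * ab c by (simp add: v_simps)
    qed
  qed
qed

lemma records_v: "i \<in> records r v \<longleftrightarrow> i < r \<and> 0 < W i \<and> W i < W s \<and> (\<forall>j. i < j \<and> j < r \<and> W j < W s \<longrightarrow> W j < W i)"
proof -
  have "v j = W j" if "j < r" for j using that rs by (simp add: v_simps)
  then show ?thesis by (auto simp: records_def v_simps)
qed

lemma ge_of_above:
  assumes "j < r" "W s < W j"
  shows "lehmer W r \<le> lehmer W j"
proof -
  have "{r<..s} \<subseteq> {q. j < q \<and> W q < W j}"
    using assms inc[of _ s] by (auto simp: le_less) (use order.strict_trans in blast)+
  then have "card {r<..s} \<le> lehmer W j"
    unfolding lehmer_def using finite_below[of "\<lambda>q. j < q"] by (intro card_mono) auto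
  then show ?thesis by (simp add: lehmer_r)
qed

end

locale vexillary_move = vexillary_step +
  fixes i :: nat
  assumes rec: "i \<in> records r v"
begin

lemma i: "i < r" "0 < W i" "W i < W s"
  using rec records_v by auto

lemma middle: "i < j \<Longrightarrow> j < r \<Longrightarrow> W s < W j"
proof (rule ccontr)
  assume j: "i < j" "j < r" "\<not> W s < W j"
  then have "W j < W s" using W_eq[of j s] rs by auto
  then have "W j < W i" using rec records_v j by auto
  then show False using avoids_2143D[OF vex j(1,2) rs] i desc by simp
qed

lemma records_single: "records r v = {i}"
proof -
  have False if *: "j \<in> records r v" "j \<noteq> i" for j
  proof -
    have j: "j < r" "W j < W s" "\<And>q. j < q \<Longrightarrow> q < r \<Longrightarrow> W q < W s \<Longrightarrow> W q < W j" using * records_v by auto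
    show False
    proof (cases "i < j")
      case True
      then show False using middle[of j] j by simp
    next
      case False
      then have "j < i" using * by simp
      then show False using avoids_2143D[OF vex _ i(1) rs, of j] j(2) j(3)[of i] i desc by simp
    qed
  qed
  then show ?thesis using rec by blast
qed

definition "u = v \<circ> swap i r"

lemma u_simps: "u i = W s" "u r = W i" "u s = W r" "p \<noteq> i \<Longrightarrow> p \<noteq> r \<Longrightarrow> p \<noteq> s \<Longrightarrow> u p = W p"
  using i rs by (simp_all add: u_def v_def)

lemma u_eq_v: "r < p \<Longrightarrow> u p = v p"
  using i by (simp add: u_def)

lemma lehmer_i: "lehmer W i = card {q. r < q \<and> W q < W i}"
proof -
  have "{q. i < q \<and> W q < W i} = {q. r < q \<and> W q < W i}"
  proof (rule set_eqI)
    fix q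
    show "q \<in> {q. i < q \<and> W q < W i} \<longleftrightarrow> q \<in> {q. r < q \<and> W q < W i}"
      using middle[of q] i desc by (cases q r rule: linorder_cases) auto
  qed
  then show ?thesis by (simp add: lehmer_def)
qed

lemma lehmer_u: "lehmer u = (lehmer W)(r := lehmer W i, i := lehmer W r)"
proof
  fix p
  let ?R = "((lehmer W)(r := lehmer W i, i := lehmer W r)) p"
  consider "p < i" | "p = i" | "i < p" "p < r" | "p = r" | "r < p" by linarith
  then show "lehmer u p = ?R"
  proof cases
    case 1
    have "card {q. p < q \<and> u q < W p} = card {q. p < q \<and> W q < W p}"
      using 1 rs i by (intro card_shuffle[where t = "swap r s \<circ> swap i r"])
        (auto simp: u_def v_def swap_def intro: bij_comp)
    then show ?thesis using 1 rs i by (simp add: lehmer_def u_simps)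
  next
    case 2
    have "{q. i < q \<and> u q < W s} = {r..<s}"
    proof (rule set_eqI)
      fix q
      consider "q \<le> i" | "i < q" "q < r" | "q = r" | "r < q" "q < s" | "q = s" | "s < q" by linarith
      then show "q \<in> {q. i < q \<and> u q < W s} \<longleftrightarrow> q \<in> {r..<s}"
      proof cases
        case 2
        then show ?thesis using middle[of q] rs by (simp add: u_simps)
      next
        case 4
        then show ?thesis using inc[of q s] i by (simp add: u_simps)
      next
        case 6
        then show ?thesis using inc[of s q] rs i by (simp add: u_simps)
      qed (use i rs desc in \<open>auto simp: u_simps\<close>)
    qed
    then show ?thesis using 2 i by (simp add: lehmer_def[of u] u_simps lehmer_r)
  next
    case 3
    have p: "W s < W p" using middle 3 by simp
    have "card {q. p < q \<and> u q < W p} = card {q. p < q \<and> W q < W p}"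
    proof (rule card_shuffle[where t = "swap r s"])
      show "p < q \<longleftrightarrow> p < swap r s q" for q
        using 3 rs by (auto simp: swap_def)
      show "(u q < W p) = (W (swap r s q) < W p)" if "p < q" for q
        using that 3 rs p i by (cases "q = r"; cases "q = s") (auto simp: u_simps)
    qed simp
    then show ?thesis using 3 rs by (simp add: lehmer_def u_simps)
  next
    case 4
    have "{q. r < q \<and> u q < W i} = {q. r < q \<and> W q < W i}"
    proof (rule set_eqI)
      fix q
      show "q \<in> {q. r < q \<and> u q < W i} \<longleftrightarrow> q \<in> {q. r < q \<and> W q < W i}"
        using i desc rs by (cases "q = s"; cases "r < q") (auto simp: u_simps)
    qed
    then show ?thesis using 4 i by (simp add: lehmer_def[of u] u_simps lehmer_i)
  next
    case 5
    then have "lehmer u p = 0" using v_inc by (intro lehmer_eq_0) (simp add: u_eq_v)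
    then show ?thesis using 5 i by (simp add: lehmer_beyond)
  qed
qed

lemma avoids_u: "avoids_2143 u"
  unfolding avoids_2143_def
proof
  assume "\<exists>a b c d. a < b \<and> b < c \<and> c < d \<and> u b < u a \<and> u a < u d \<and> u d < u c"
  then obtain a b c d where *: "a < b" "b < c" "c < d" "u b < u a" "u a < u d" "u d < u c" by blast
  have cr: "c \<le> r" using v_inc[of c d] * u_eq_v[of c] u_eq_v[of d] by (cases "r < c") auto
  have us: "u p = W p" if "p < r" "p \<noteq> i" for p using that rs by (simp add: u_simps)
  note V = avoids_2143D[OF vex]
  have ar: "a < r" "b < r" using * cr by auto
  show False
  proof (cases "c = r")
    case True
    have "d \<noteq> s" "d \<noteq> r" "d \<noteq> i" using * True desc i by (auto simp: u_simps)
    then have d: "u d = W d" by (simp add: u_simps)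
    have "a \<noteq> i" "b \<noteq> i" using * True i by (auto simp: u_simps)
    then show False using V[OF *(1-3)] * d us[of a] us[of b] ar True i desc by (simp add: u_simps)
  next
    case False
    then have c: "c < r" using cr by simp
    consider "d = r" | "d = s" | "d = i" | "d \<noteq> i" "d \<noteq> r" "d \<noteq> s" by blast
    then show False
    proof cases
      case 1
      then have abi: "a \<noteq> i" "b \<noteq> i" using * i by (auto simp: u_simps)
      then have ab: "u a = W a" "u b = W b" using us ar by auto
      consider "c < i" | "c = i" | "i < c" by linarith
      then show False
      proof cases
        case 1
        then show False using V[OF *(1,2) 1] * ab us[OF c] \<open>d = r\<close> by (simp add: u_simps)
      next
        case 2
        then show False using V[OF *(1), of r s] * ab \<open>d = r\<close> i desc rs ar by (simp add: u_simps)
      next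
        case 3
        then show False using V[OF *(1,2), of s] * ab us[OF c] \<open>d = r\<close> middle[OF 3 c] i rs c by (simp add: u_simps)
      qed
    next
      case 2
      then have ci: "c \<noteq> i" using * desc by (auto simp: u_simps)
      then have uc: "u c = W c" using us c by simp
      consider "a = i" | "b = i" | "a \<noteq> i" "b \<noteq> i" by blast
      then show False
      proof cases
        case 1
        then show False using middle[of b] * ar us[of b] by (simp add: u_simps)
      next
        case 2
        then have "u a = W a" using us[of a] * ar by simp
        then show False using V[OF *(1,2) c] * 2 \<open>d = s\<close> uc i by (simp add: u_simps)
      next
        case 3
        then show False using V[OF *(1,2) c] * \<open>d = s\<close> uc us[of a] us[of b] ar by (simp add: u_simps)
      qed
    next
      case 3
      then show False using V[OF *(1,2), of s] * us[of a] us[of b] us[of c] ar c rs by (simp add: u_simps)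
    next
      case 4
      then have d: "u d = W d" by (simp add: u_simps)
      consider "a = i" | "b = i" | "c = i" | "a \<noteq> i" "b \<noteq> i" "c \<noteq> i" by blast
      then show False
      proof cases
        case 1
        then show False using middle[of b] * ar us[of b] by (simp add: u_simps)
      next
        case 2
        then have "u a = W a" "u c = W c" using us[of a] us[of c] * ar c by simp_all
        then show False using V[OF *(1-3)] * 2 d i by (simp add: u_simps)
      next
        case 3
        then have ab: "u a = W a" "u b = W b" using us[of a] us[of b] * ar by simp_all
        have "r < d" using middle[of d] 3 4 * d by (cases "d < r") (auto simp: u_simps)
        moreover have "W d < W r" using * 3 d desc by (simp add: u_simps)
        ultimately show False using V[OF *(1) ar(2), of d] * d ab by simp
      next
        case 4
        then show False using V[OF *(1-3)] * d us[of a] us[of b] us[of c] ar c by simp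
      qed
    qed
  qed
qed

lemma lehmer_i_less: "lehmer W i < lehmer W r"
proof -
  have "{q. r < q \<and> W q < W i} \<subset> {q. r < q \<and> W q < W r}"
  proof
    show "{q. r < q \<and> W q < W i} \<subseteq> {q. r < q \<and> W q < W r}" using i desc by auto
    have "s \<in> {q. r < q \<and> W q < W r}" "s \<notin> {q. r < q \<and> W q < W i}" using i desc rs by auto
    then show "{q. r < q \<and> W q < W i} \<noteq> {q. r < q \<and> W q < W r}" by blast
  qed
  then show ?thesis unfolding lehmer_i using finite_below[of "\<lambda>q. r < q" "W r"]
    by (simp add: lehmer_def psubset_card_mono)
qed

lemma le_of_below:
  assumes "j < r" "W j < W s"
  shows "lehmer W j \<le> lehmer W i"
proof (cases "j = i")
  case False
  then have j: "j < i" using middle[of j] assms by (meson linorder_neqE_nat order.asym)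
  have W: "W j < W i"
  proof (rule ccontr)
    assume "\<not> W j < W i"
    then have "W i < W j" using W_eq[of i j] False by auto
    then show False using avoids_2143D[OF vex j i(1) rs] assms(2) desc by simp
  qed
  have "{q. j < q \<and> W q < W j} \<subseteq> {q. i < q \<and> W q < W i}"
  proof
    fix q assume "q \<in> {q. j < q \<and> W q < W j}"
    then have q: "j < q" "W q < W j" by auto
    have "i < q"
    proof (rule ccontr)
      assume "\<not> i < q"
      then have "q < r" using i by simp
      then show False using avoids_2143D[OF vex q(1) _ rs] q assms(2) desc by simp
    qed
    then show "q \<in> {q. i < q \<and> W q < W i}" using q W by simp
  qed
  then show ?thesis unfolding lehmer_def using finite_below[of "\<lambda>q. i < q"] by (intro card_mono) auto
qed simp

lemma gap:
  assumes "j < r" "lehmer W j < lehmer W r"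
  shows "lehmer W j \<le> lehmer W i"
proof (rule le_of_below[OF assms(1)])
  have "\<not> W s < W j" using ge_of_above[of j] assms by auto
  then show "W j < W s" using W_eq[of j s] assms(1) rs by auto
qed

lemma before_i:
  assumes "j < i"
  shows "lehmer W j \<noteq> lehmer W r"
proof (cases "W j < W s")
  case True
  then show ?thesis using le_of_below[of j] lehmer_i_less assms i by simp
next
  case False
  then have sj: "W s < W j" using W_eq[of j s] assms i rs by auto
  have "insert i {r<..s} \<subseteq> {q. j < q \<and> W q < W j}"
    using assms sj i inc[of _ s] by (auto simp: le_less) (use order.strict_trans in blast)+
  then have "card (insert i {r<..s}) \<le> lehmer W j"
    unfolding lehmer_def using finite_below[of "\<lambda>q. j < q"] by (intro card_mono) auto
  then show ?thesis using i rs by (simp add: lehmer_r)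
qed

end

context vexillary_step
begin

lemma r_range: "r \<in> {1..<M}" and s_range: "s \<in> {1..<M}"
proof -
  have mem: "W p \<in> {1..<M} \<longleftrightarrow> p \<in> {1..<M}" for p using perm by (rule permutes_in_image)
  have out: "W p = p" if "p \<notin> {1..<M}" for p using perm that by (rule permutes_not_in)
  show r: "r \<in> {1..<M}"
  proof (rule ccontr)
    assume "r \<notin> {1..<M}"
    then show False using out[of r] out[of s] desc rs by (cases "r = 0") auto
  qed
  show "s \<in> {1..<M}"
    using mem[of r] out[of s] r rs desc by (cases "s < M") auto
qed

lemma v_perm: "v permutes {1..<M}"
  unfolding v_def using r_range s_range by (intro permutes_compose[OF permutes_swap_id perm])

lemma inv_v: "inv v = swap r s \<circ> inv W"
  unfolding v_def using permutes_bij[OF perm] by (simp add: o_inv_distrib)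

lemma inv_v_eq: "inv v m = p \<longleftrightarrow> m = v p"
  using permutes_bij[OF v_perm] by (metis bij_inv_eq_iff)

lemma inv_v_r: "inv (inv v) r = W s"
  using permutes_bij[OF v_perm] by (simp add: inv_inv_eq v_simps)

lemma v_inv: "v (inv v m) = m"
  using inv_v_eq by metis

lemma monk_ok_v: "monk_ok M r (inv v)"
proof -
  have "increasing_beyond r (inv v)"
    unfolding increasing_beyond_def
  proof (intro allI impI)
    fix m m' assume *: "r < inv v m \<and> r < inv v m' \<and> m < m'"
    show "inv v m < inv v m'"
    proof (rule ccontr)
      assume "\<not> inv v m < inv v m'"
      then have "inv v m' \<le> inv v m" by simp
      moreover have "inv v m' \<noteq> inv v m" using * v_inv by (metis less_irrefl)
      ultimately have "v (inv v m') < v (inv v m)" using * v_inc by simp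
      then show False using * by (simp add: v_inv)
    qed
  qed
  moreover have "W s < W r \<and> r < inv v (W r)"
    using desc rs inv_v_eq[of "W r" s] by (simp add: v_simps)
  moreover have "W r < M" using permutes_in_image[OF perm, of r] r_range by simp
  ultimately show ?thesis
    unfolding monk_ok_def inv_v_r using permutes_inv[OF v_perm] r_range by blast
qed

lemma nxt_v: "nxt r (inv v) = W r"
proof (rule nxt_eqI)
  show "inv (inv v) r < W r" unfolding inv_v_r by (rule desc)
  show "r < inv v (W r)" using rs inv_v_eq[of "W r" s] by (simp add: v_simps)
  fix m assume m: "inv (inv v) r < m" "m < W r"
  show "\<not> r < inv v m"
  proof
    define p where "p = inv v m"
    assume "r < inv v m"
    then have p: "r < p" "v p = m" by (simp_all add: p_def v_inv)
    then have "p \<noteq> s" using m v_simps by auto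
    then have "W p = m" using p by (simp add: v_simps)
    then show False using m p inc[of p s] after[of p] \<open>p \<noteq> s\<close> unfolding inv_v_r
      by (cases "p < s") auto
  qed
qed

lemma lower_v: "lower r f (inv v) = f (inv v) + f (inv W)"
proof -
  have "inv v \<circ> swap (W s) (W r) = inv W"
  proof
    fix m
    define p where "p = inv W m"
    have m: "m = W p" using permutes_surj[OF perm] by (simp add: p_def surj_f_inv_f)
    have inv: "inv W (W q) = q" for q using permutes_inj[OF perm] by simp
    show "(inv v \<circ> swap (W s) (W r)) m = inv W m"
      unfolding m inv_v
      by (cases "p = r"; cases "p = s") (simp_all add: inv W_eq swap_def)
  qed
  then show ?thesis by (simp add: lower_def inv_v_r nxt_v)
qed

lemma inv_inv_v: "inv (inv v) = v"
  using permutes_bij[OF v_perm] by (simp add: inv_inv_eq)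

lemma hecke_sum_v:
  "hecke_sum M L (inv v) + hecke_sum M L (inv W) =
    (\<Sum>m\<le>L. int (L choose m) * upper r (hecke_sum M m) (inv v))"
  using hecke_sum_monk[OF monk_ok_v, of L] by (simp add: lower_v)

lemma upper_empty:
  assumes "records r v = {}"
  shows "upper r f (inv v) = f (inv v)"
proof -
  have "cyc r {} \<circ> inv v = inv v" by (auto simp: cyc_def fun_eq_iff)
  then show ?thesis using assms by (simp add: upper_def inv_inv_v)
qed

lemma full_of_empty:
  assumes "records r v = {}" "1 \<le> j" "j < r"
  shows "lehmer W r \<le> lehmer W j"
proof (rule ge_of_above[OF assms(3)], rule ccontr)
  assume "\<not> W s < W j"
  then have js: "W j < W s" using W_eq[of j s] assms rs by auto
  define A where "A = {j. 1 \<le> j \<and> j < r \<and> W j < W s}"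
  define i where "i = Max A"
  have A: "finite A" "j \<in> A" using js assms by (auto simp: A_def)
  then have "i \<in> A" unfolding i_def by (intro Max_in) auto
  then have i: "1 \<le> i" "i < r" "W i < W s" by (auto simp: A_def)
  have "\<not> W q < W s" if "i < q" "q < r" for q
  proof
    assume "W q < W s"
    then have "q \<in> A" using that i by (auto simp: A_def)
    then have "q \<le> i" using A by (simp add: i_def)
    then show False using that by simp
  qed
  moreover have "0 < W i" using W_eq[of i 0] W0 i by (cases "W i") auto
  ultimately have "i \<in> records r v" using i records_v by auto
  then show False using assms by simp
qed

end

context vexillary_move
begin

lemma u_perm: "u permutes {1..<M}"
proof -
  have "i \<in> {1..<M}" using i r_range W0 by (cases i) auto
  then show ?thesis unfolding u_def using r_range by (intro permutes_compose[OF permutes_swap_id v_perm])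
qed

lemma upper_move: "upper r f (inv v) = f (inv v) + f (inv u)"
proof -
  have 1: "cyc r {} \<circ> inv v = inv v" by (auto simp: cyc_def fun_eq_iff)
  have "{y. (y = r \<or> y = i) \<and> i < y} = {r}" using i by auto
  then have 2: "cyc r {i} = swap i r"
    using i by (auto simp: cyc_def fun_eq_iff swap_def)
  have "inv u = swap i r \<circ> inv v"
    unfolding u_def using permutes_bij[OF v_perm] by (simp add: o_inv_distrib)
  then show ?thesis using 1 2 by (simp add: upper_def inv_inv_v records_single Pow_insert)
qed

end

definition surj_sum :: "(nat \<Rightarrow> nat) \<Rightarrow> nat \<Rightarrow> nat" where
  "surj_sum a L = (\<Sum>j\<le>L. a j * surjections L j)"

lemma surj_sum_extend: "m \<le> L \<Longrightarrow> surj_sum a m = (\<Sum>j\<le>L. a j * surjections m j)"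
  unfolding surj_sum_def by (intro sum.mono_neutral_left) auto

lemma sum_binomial_surj_sum:
  "(\<Sum>m\<le>L. (L choose m) * surj_sum a m) = surj_sum a L + (\<Sum>j\<le>L. a j * surjections L (Suc j))"
proof -
  have "(\<Sum>m\<le>L. (L choose m) * surj_sum a m) = (\<Sum>m\<le>L. \<Sum>j\<le>L. a j * ((L choose m) * surjections m j))"
    by (intro sum.cong refl) (simp add: surj_sum_extend[of _ L] sum_distrib_left ac_simps)
  also have "\<dots> = (\<Sum>j\<le>L. a j * (\<Sum>m\<le>L. (L choose m) * surjections m j))"
    by (subst sum.swap) (simp add: sum_distrib_left)
  also have "\<dots> = surj_sum a L + (\<Sum>j\<le>L. a j * surjections L (Suc j))"
    unfolding sum_binomial_surj surj_sum_def by (simp only: distrib_left sum.distrib)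
  finally show ?thesis .
qed

lemma surj_sum_shift:
  assumes "a 0 = 0"
  shows "surj_sum a L = (\<Sum>j\<le>L. a (Suc j) * surjections L (Suc j))"
proof -
  have "surj_sum a L = (\<Sum>j\<le>Suc L. a j * surjections L j)"
    unfolding surj_sum_def by (simp del: fact_Suc)
  also have "\<dots> = (\<Sum>j\<le>L. a (Suc j) * surjections L (Suc j))"
    using assms by (subst sum.atMost_Suc_shift) simp
  finally show ?thesis .
qed

lemma id_of_lehmer_0:
  assumes "W permutes {1..<M}" and z: "\<And>p. lehmer W p = 0"
  shows "W = id"
proof -
  have bij: "bij W" using assms(1) by (rule permutes_bij)
  have fin: "finite {q. p < q \<and> W q < W p}" for p
    by (rule finite_subset[of _ "W -` {..<W p}"]) (use bij in \<open>auto intro!: finite_vimageI simp: bij_is_inj\<close>)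
  have lt: "W p < W q" if "p < q" for p q
  proof -
    have "\<not> W q < W p" using z[of p] fin[of p] that by (auto simp: lehmer_def)
    moreover have "W q \<noteq> W p" using that bij by (metis bij_is_inj inj_eq less_irrefl)
    ultimately show ?thesis by simp
  qed
  then have sm: "strict_mono W" by (simp add: strict_mono_def)
  have "strict_mono (inv W)"
  proof (rule strict_monoI)
    fix m m' :: nat assume "m < m'"
    then have "W (inv W m) < W (inv W m')" using bij by (simp add: bij_is_surj surj_f_inv_f)
    then show "inv W m < inv W m'" using sm by (simp add: strict_mono_less)
  qed
  then have "inv W (W p) \<ge> W p" for p by (rule strict_mono_imp_increasing)
  then have "W p \<le> p" for p using bij by (simp add: bij_is_inj)
  moreover have "p \<le> W p" for p using sm by (rule strict_mono_imp_increasing)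
  ultimately show ?thesis by (simp add: fun_eq_iff antisym)
qed

lemma exists_vexillary_step:
  assumes perm: "W permutes {1..<M}" and vex: "avoids_2143 W" and "W \<noteq> id"
  shows "\<exists>r s. vexillary_step M W r s"
proof -
  have bij: "bij W" using perm by (rule permutes_bij)
  have Weq: "W p = W q \<longleftrightarrow> p = q" for p q using bij by (simp add: bij_is_inj inj_eq)
  have fin: "finite {q. p < q \<and> W q < m}" for p m
    by (rule finite_subset[of _ "W -` {..<m}"]) (use bij in \<open>auto intro!: finite_vimageI simp: bij_is_inj\<close>)
  define A where "A = {p. 0 < lehmer W p}"
  have "A \<subseteq> {..<M}"
  proof
    fix p assume p: "p \<in> A"
    show "p \<in> {..<M}"
    proof (rule ccontr)
      assume "p \<notin> {..<M}"
      then have "W q = q" if "p \<le> q" for q using permutes_not_in[OF perm, of q] that by simp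
      then have "lehmer W p = 0" by (intro lehmer_eq_0) simp
      then show False using p by (simp add: A_def)
    qed
  qed
  then have finA: "finite A" using finite_subset by blast
  have "A \<noteq> {}" using id_of_lehmer_0[OF perm] assms(3) by (auto simp: A_def)
  define r where "r = Max A"
  have r: "r \<in> A" unfolding r_def using finA \<open>A \<noteq> {}\<close> by (rule Max_in)
  have inc: "W p < W q" if "r < p" "p < q" for p q
  proof -
    have "p \<notin> A" using that Max_ge[OF finA, of p] by (auto simp: r_def)
    then have "{q. p < q \<and> W q < W p} = {}" using fin[of p "W p"] by (simp add: A_def lehmer_def)
    then have "\<not> W q < W p" using that by blast
    then show ?thesis using Weq[of p q] that by simp
  qed
  define B where "B = {q. r < q \<and> W q < W r}"
  have finB: "finite B" unfolding B_def by (rule fin)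
  have "0 < card B" using r by (simp add: A_def lehmer_def B_def)
  then have "B \<noteq> {}" by (metis card.empty less_irrefl)
  define s where "s = Max B"
  have s: "s \<in> B" unfolding s_def using finB \<open>B \<noteq> {}\<close> by (rule Max_in)
  have after: "W r < W q" if "s < q" for q
  proof -
    have "q \<notin> B" using that Max_ge[OF finB, of q] by (auto simp: s_def)
    moreover have "r < q" using that s by (auto simp: B_def)
    ultimately show ?thesis using Weq[of q r] by (auto simp: B_def)
  qed
  have "vexillary_step M W r s"
    using perm vex s inc after by unfold_locales (auto simp: B_def)
  then show ?thesis by blast
qed

lemma hecke_sum_id: "hecke_sum M L id = (if L = 0 then 1 else 0)"
  by (cases L) (simp_all add: dstep_def)

lemma hecke_sum_eq_tableaux:
  assumes "W permutes {1..<M}" "avoids_2143 W"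
  shows "hecke_sum M L (inv W) = int (surj_sum (tableau_count (lehmer W)) L)"
  using assms
proof (induction "\<Sum>p<M. p * lehmer W p" arbitrary: W L rule: less_induct)
  case less
  show ?case
  proof (cases "W = id")
    case True
    have z: "lehmer W = (\<lambda>_. 0)" using True lehmer_eq_0[of _ id] by auto
    have cells: "code_cells (\<lambda>_. 0) = {}" by (auto simp: code_cells_def)
    have "flagged_svts {} F j = (if j = 0 then {\<lambda>_. {}} else {})" for F j
      by (auto simp: flagged_svts_def flagged_svt_def)
    then have "tableau_count (\<lambda>_. 0) j = (if j = 0 then 1 else 0)" for j
      by (simp add: tableau_count_def cells)
    then have "surj_sum (tableau_count (lehmer W)) L = (\<Sum>j\<le>L. if j = 0 then surjections L 0 else 0)"
      unfolding z surj_sum_def by (intro sum.cong) auto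
    also have "\<dots> = surjections L 0" by simp
    also have "\<dots> = (if L = 0 then 1 else 0)" by (cases L) auto
    finally show ?thesis using True hecke_sum_id[of M L] by (simp del: hecke_sum.simps)
  next
    case False
    obtain r s where "vexillary_step M W r s"
      using exists_vexillary_step[OF less.prems False] by blast
    then interpret vexillary_step M W r s .
    interpret last_code "lehmer W" r by (rule last_code)
    have rM: "r < M" using r_range by simp
    have sum_upd: "(\<Sum>p<M. p * (c(q := x)) p) + q * c q = (\<Sum>p<M. p * c p) + q * x" if "q < M" for q x c
      using that sum.remove[of "{..<M}" q "\<lambda>p. p * (c(q := x)) p"] sum.remove[of "{..<M}" q "\<lambda>p. p * c p"]
      by simp
    have sv: "(\<Sum>p<M. p * lehmer v p) < (\<Sum>p<M. p * lehmer W p)"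
    proof -
      have "r * (lehmer W r - 1) < r * lehmer W r" using cr r_pos by simp
      then show ?thesis using sum_upd[OF rM, of "lehmer W" "lehmer W r - 1"] unfolding lehmer_v by linarith
    qed
    have IHv: "hecke_sum M m (inv v) = int (surj_sum (tableau_count (lehmer v)) m)" for m
      using less.hyps[OF sv v_perm avoids_v] .
    let ?av = "tableau_count (lehmer v)" and ?aw = "tableau_count (lehmer W)"
    show ?thesis
    proof (cases "records r v = {}")
      case True
      have "?aw (Suc j) = ?av j" for j
        using tableau_count_drop[OF full_of_empty[OF True]] unfolding lehmer_v by simp
      then have "surj_sum ?aw L = (\<Sum>j\<le>L. ?av j * surjections L (Suc j))"
        using surj_sum_shift[of ?aw, OF tableau_count_0] by simp
      moreover have "int (surj_sum ?av L) + hecke_sum M L (inv W) = int (\<Sum>m\<le>L. (L choose m) * surj_sum ?av m)"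
        using hecke_sum_v[of L] unfolding upper_empty[OF True] IHv by simp
      ultimately show ?thesis unfolding sum_binomial_surj_sum by simp
    next
      case False
      then obtain i where "i \<in> records r v" by blast
      then interpret vexillary_move M W r s i by unfold_locales
      have su: "(\<Sum>p<M. p * lehmer u p) < (\<Sum>p<M. p * lehmer W p)"
      proof -
        have iM: "i < M" using i rM by simp
        have 1: "(\<Sum>p<M. p * ((lehmer W)(r := lehmer W i)) p) + r * lehmer W r = (\<Sum>p<M. p * lehmer W p) + r * lehmer W i"
          by (rule sum_upd[OF rM])
        have 2: "(\<Sum>p<M. p * lehmer u p) + i * lehmer W i = (\<Sum>p<M. p * ((lehmer W)(r := lehmer W i)) p) + i * lehmer W r"
          unfolding lehmer_u using sum_upd[OF iM, of "(lehmer W)(r := lehmer W i)" "lehmer W r"] i by simp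
        have "r * lehmer W i + i * lehmer W r < r * lehmer W r + i * lehmer W i"
        proof -
          obtain e where e: "lehmer W r = lehmer W i + Suc e" using lehmer_i_less less_imp_Suc_add by fastforce
          show ?thesis unfolding e using mult_less_mono1[OF i(1), of "Suc e"] by (simp add: algebra_simps)
        qed
        then show ?thesis using 1 2 by linarith
      qed
      have IHu: "hecke_sum M m (inv u) = int (surj_sum (tableau_count (lehmer u)) m)" for m
        using less.hyps[OF su u_perm avoids_u] .
      let ?au = "tableau_count (lehmer u)"
      have between: "lehmer W r \<le> lehmer W j" if "i < j" "j < r" for j
        using ge_of_above middle that by blast
      have rec: "?aw (Suc j) = ?av j + ?au (Suc j) + ?au j" for j
        using tableau_count_move(1)[OF i(1) lehmer_i_less between gap before_i] unfolding lehmer_v lehmer_u .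
      have au0: "?au 0 = 0"
        using tableau_count_move(2)[OF i(1) lehmer_i_less between gap before_i] unfolding lehmer_u .
      have "surj_sum ?aw L = (\<Sum>j\<le>L. ?av j * surjections L (Suc j)) + surj_sum ?au L + (\<Sum>j\<le>L. ?au j * surjections L (Suc j))"
        unfolding surj_sum_shift[of ?aw, OF tableau_count_0] surj_sum_shift[of ?au, OF au0] rec
        by (simp only: distrib_right sum.distrib)
      moreover have "int (surj_sum ?av L) + hecke_sum M L (inv W) =
          int (\<Sum>m\<le>L. (L choose m) * surj_sum ?av m) + int (\<Sum>m\<le>L. (L choose m) * surj_sum ?au m)"
        using hecke_sum_v[of L] unfolding upper_move IHv IHu
        by (simp add: distrib_left sum.distrib)
      ultimately show ?thesis unfolding sum_binomial_surj_sum by simp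
    qed
  qed
qed

subsection \<open>The flag of a vexillary permutation\<close>

lemma mu_iff:
  "(r, c) \<in> mu n w \<longleftrightarrow> 1 \<le> r \<and> 1 \<le> c \<and> (\<exists>P Q. (P, Q) \<in> rothe n w \<and> r \<le> P \<and> c \<le> Q)"
proof -
  define D where "D = {(r, c). 1 \<le> r \<and> 1 \<le> c \<and> (\<exists>P Q. (P, Q) \<in> rothe n w \<and> r \<le> P \<and> c \<le> Q)}"
  have "ferrers n D" unfolding ferrers_def D_def by (fastforce simp: rothe_def)
  moreover have "rothe n w \<subseteq> D" by (auto simp: D_def rothe_def)
  ultimately have "mu n w \<subseteq> D" by (auto simp: mu_def)
  moreover have "D \<subseteq> F" if F: "ferrers n F" "rothe n w \<subseteq> F" for F
  proof
    fix y assume "y \<in> D"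
    then obtain r c P Q where y: "y = (r, c)" "1 \<le> r" "1 \<le> c" "(P, Q) \<in> rothe n w" "r \<le> P" "c \<le> Q"
      by (auto simp: D_def)
    then have "(P, Q) \<in> F" using F by auto
    then show "y \<in> F" using F(1) y unfolding ferrers_def by fastforce
  qed
  then have "D \<subseteq> mu n w" unfolding mu_def by blast
  ultimately have "mu n w = D" by (rule antisym)
  then show ?thesis by (simp add: D_def)
qed

lemma exists_nth_smallest:
  fixes A :: "nat set"
  assumes "finite A" "1 \<le> m" "m \<le> card A"
  shows "\<exists>q\<in>A. card {c \<in> A. c \<le> q} = m"
  using assms
proof (induction A arbitrary: m rule: finite_linorder_max_induct)
  case (insert b A)
  have bA: "b \<notin> A" using insert by auto
  show ?case
  proof (cases "m \<le> card A")
    case True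
    then obtain q where q: "q \<in> A" "card {c \<in> A. c \<le> q} = m" using insert by blast
    then have "{c \<in> insert b A. c \<le> q} = {c \<in> A. c \<le> q}" using insert by force
    then show ?thesis using q by (intro bexI[of _ q]) auto
  next
    case False
    then have "m = Suc (card A)" using insert bA by simp
    moreover have "{c \<in> insert b A. c \<le> b} = insert b A" using insert by force
    ultimately show ?thesis using insert bA by (intro bexI[of _ b]) auto
  qed
qed simp

lemma svt_mono:
  assumes T: "flagged_svt X F T" and F: "\<And>a b. (a, b) \<in> X \<Longrightarrow> F b \<le> F' b"
  shows "flagged_svt X F' T"
proof (rule flagged_svtI)
  fix a b y assume ab: "(a, b) \<in> X" "y \<in> T (a, b)"
  show "y \<le> F' b" using svt_le[OF T ab] F[OF ab(1)] by simp
qed (use T in \<open>meson svt_outside svt_nonempty svt_pos svt_row svt_col\<close>)+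

locale vexillary_perm =
  fixes n :: nat and w :: "nat \<Rightarrow> nat"
  assumes perm: "w permutes {1..n}" and vex: "vexillary n w"
begin

abbreviation "row j \<equiv> {c. (j, c) \<in> rothe n w}"
abbreviation "height b \<equiv> card {j \<in> {1..n}. b \<le> code n w j}"

definition "bottom b = Max {j \<in> {1..n}. b \<le> code n w j}"

lemma w_in: "w j \<in> {1..n} \<longleftrightarrow> j \<in> {1..n}"
  using perm by (rule permutes_in_image)

lemma w_eq: "w i = w j \<longleftrightarrow> i = j"
  using permutes_inj[OF perm] by (simp add: inj_eq)

lemma inv_w: "inv w (w j) = j" "w (inv w j) = j"
  using permutes_inverses[OF perm] by simp_all

lemma inv_w_in: "inv w j \<in> {1..n} \<longleftrightarrow> j \<in> {1..n}"
  using permutes_in_image[OF permutes_inv[OF perm]] .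

lemma finite_row: "finite (row j)"
  by (rule finite_subset[of _ "{1..n}"]) (auto simp: rothe_def)

lemma card_row: "j \<in> {1..n} \<Longrightarrow> card (row j) = code n w j"
proof -
  assume j: "j \<in> {1..n}"
  have "row j = w ` {j' \<in> {1..n}. j < j' \<and> w j' < w j}"
  proof (intro set_eqI iffI)
    fix c assume "c \<in> row j"
    then have "c = w (inv w c)" "inv w c \<in> {1..n}" "j < inv w c" "w (inv w c) < w j"
      using inv_w inv_w_in[of c] by (auto simp: rothe_def)
    then show "c \<in> w ` {j' \<in> {1..n}. j < j' \<and> w j' < w j}" by blast
  next
    fix c assume "c \<in> w ` {j' \<in> {1..n}. j < j' \<and> w j' < w j}"
    then obtain j' where "c = w j'" "j' \<in> {1..n}" "j < j'" "w j' < w j" by blast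
    then show "c \<in> row j" using j w_in[of j'] inv_w by (simp add: rothe_def)
  qed
  then show ?thesis using w_eq by (simp add: code_def card_image inj_on_def)
qed

lemma in_row: "j \<in> {1..n} \<Longrightarrow> c \<in> row j \<longleftrightarrow> 1 \<le> c \<and> c < w j \<and> j < inv w c"
  using w_in[of j] by (auto simp: rothe_def)

lemma pattern:
  assumes "1 \<le> a" "a < b" "b < c" "c < d" "d \<le> n" "w b < w a" "w a < w d" "w d < w c"
  shows False
proof -
  have "a \<in> {1..n}" "b \<in> {1..n}" "c \<in> {1..n}" "d \<in> {1..n}" using assms by auto
  then show False using vex assms unfolding vexillary_def by blast
qed

lemma bottom_in:
  assumes "j \<in> {1..n}" "b \<le> code n w j"
  shows "bottom b \<in> {1..n}" "b \<le> code n w (bottom b)" "j \<le> bottom b"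
proof -
  have fin: "finite {j \<in> {1..n}. b \<le> code n w j}" and mem: "j \<in> {j \<in> {1..n}. b \<le> code n w j}"
    using assms by auto
  have "bottom b \<in> {j \<in> {1..n}. b \<le> code n w j}"
    unfolding bottom_def using fin mem by (intro Max_in) auto
  then show "bottom b \<in> {1..n}" "b \<le> code n w (bottom b)" by auto
  show "j \<le> bottom b" unfolding bottom_def using fin mem by (rule Max_ge)
qed

text \<open>The column q is that of the C-th box of row p. The equation places \<open>(p, q)\<close> on the diagonal of
  the last row of length C of the shape, and no box of \<^term>\<open>mu n w\<close> lies further southeast on it.\<close>

lemma corner_box:
  assumes p': "p' \<in> {1..n}" "code n w p' = C" and C: "1 \<le> C"
  defines "p \<equiv> bottom C"
  shows "\<exists>q. (p, q) \<in> rothe n w \<and> q + height C = p + C \<and>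
    (\<forall>P Q. (P, Q) \<in> rothe n w \<longrightarrow> p < P \<longrightarrow> Q \<le> q)"
proof -
  have p: "p \<in> {1..n}" "C \<le> code n w p" "p' \<le> p"
    unfolding p_def using bottom_in[OF p'(1), of C] p'(2) by auto
  have last: "j \<le> p" if "j \<in> {1..n}" "C \<le> code n w j" for j
    unfolding p_def using bottom_in(3)[OF that] .
  obtain q where q: "q \<in> row p" "card {c \<in> row p. c \<le> q} = C"
    using exists_nth_smallest[OF finite_row C, of p] card_row[OF p(1)] p(2) by auto
  define R where "R = {c \<in> row p. c \<le> q}"
  have R: "finite R" "card R = C" using finite_row q(2) by (simp_all add: R_def)
  have qp: "1 \<le> q" "q < w p" "p < inv w q" using q(1) in_row[OF p(1), of q] by simp_all
  have inR: "c \<in> R \<longleftrightarrow> 1 \<le> c \<and> c \<le> q \<and> p < inv w c" for c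
  proof -
    have "c \<in> R \<longleftrightarrow> (1 \<le> c \<and> c < w p \<and> p < inv w c) \<and> c \<le> q"
      using in_row[OF p(1), of c] by (simp add: R_def)
    then show ?thesis using qp(2) by linarith
  qed
  have invq: "inv w q \<le> n" using q(1) inv_w_in[of q] by (auto simp: rothe_def)
  have big: "C \<le> code n w j" if "j \<in> {1..n}" "j \<le> p" "q < w j" for j
  proof -
    have "R \<subseteq> row j" using that in_row inR by auto
    then show ?thesis using card_mono[OF finite_row] R card_row[OF that(1)] by metis
  qed
  have small: "code n w j < C" if j: "j \<in> {1..n}" "j \<le> p" "w j < q" for j
  proof -
    have "row j \<subseteq> R - {q}"
    proof
      fix c assume "c \<in> row j"
      then have c: "1 \<le> c" "c < w j" "j < inv w c" using in_row[OF j(1)] by auto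
      have "p < inv w c"
      proof (rule ccontr)
        assume *: "\<not> p < inv w c"
        have "inv w c \<noteq> p" using c j qp inv_w(2)[of c] by auto
        then show False
          using pattern[of j "inv w c" p "inv w q"] * c j qp invq inv_w by simp
      qed
      then show "c \<in> R - {q}" using inR c j by auto
    qed
    then have "card (row j) \<le> card (R - {q})" using R by (intro card_mono) auto
    also have "\<dots> < card R" using R q(1) by (intro psubset_card_mono) (auto simp: R_def)
    finally show ?thesis using R card_row[OF j(1)] by simp
  qed
  have wq: "w j \<noteq> q" if "j \<le> p" for j using that qp inv_w(1)[of j] by auto
  have iff: "C \<le> code n w j \<longleftrightarrow> q < w j" if "j \<in> {1..n}" "j \<le> p" for j
  proof (cases "q < w j")
    case True
    then show ?thesis using big[OF that] by simp
  next
    case False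
    then have "w j < q" using wq[OF that(2)] by simp
    then show ?thesis using small[OF that] False by simp
  qed
  have "height C = card {j \<in> {1..p}. q < w j}"
  proof -
    have "{j \<in> {1..n}. C \<le> code n w j} = {j \<in> {1..p}. q < w j}"
      using iff last p(1) by auto
    then show ?thesis by simp
  qed
  moreover have "card {j \<in> {1..p}. w j < q} + card {j \<in> {1..p}. q < w j} = p"
  proof -
    have "w j < q \<or> q < w j" if "j \<le> p" for j using wq[OF that] by (simp add: neq_iff)
    then have "{j \<in> {1..p}. w j < q} \<union> {j \<in> {1..p}. q < w j} = {1..p}" by fastforce
    moreover have "{j \<in> {1..p}. w j < q} \<inter> {j \<in> {1..p}. q < w j} = {}" by auto
    ultimately show ?thesis using card_Un_disjoint[of "{j \<in> {1..p}. w j < q}" "{j \<in> {1..p}. q < w j}"] by simp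
  qed
  moreover have "q = C + card {j \<in> {1..p}. w j < q}"
  proof -
    have "{1..q} = R \<union> w ` {j \<in> {1..p}. w j < q}"
    proof (intro set_eqI iffI)
      fix c assume c: "c \<in> {1..q}"
      show "c \<in> R \<union> w ` {j \<in> {1..p}. w j < q}"
      proof (cases "p < inv w c")
        case True
        then show ?thesis using c inR by auto
      next
        case False
        have "c \<in> {1..n}" using c q(1) by (auto simp: rothe_def)
        then have "inv w c \<in> {1..p}" using False inv_w_in[of c] by auto
        moreover have "w (inv w c) < q" using wq[of "inv w c"] c False inv_w(2)[of c] by auto
        ultimately show ?thesis using inv_w(2)[of c] by (metis (mono_tags, lifting) UnCI image_eqI mem_Collect_eq)
      qed
    next
      fix c assume "c \<in> R \<union> w ` {j \<in> {1..p}. w j < q}"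
      then consider "c \<in> R" | j where "c = w j" "j \<in> {1..p}" "w j < q" by blast
      then show "c \<in> {1..q}"
      proof cases
        case 1
        then show ?thesis using inR[of c] by simp
      next
        case 2
        then have "w j \<in> {1..n}" using w_in[of j] p(1) by simp
        then show ?thesis using 2 by simp
      qed
    qed
    moreover have "R \<inter> w ` {j \<in> {1..p}. w j < q} = {}"
    proof -
      have "w j \<notin> R" if "j \<in> {1..p}" for j using inR[of "w j"] inv_w(1)[of j] that by simp
      then show ?thesis by blast
    qed
    moreover from this have "card (R \<union> w ` {j \<in> {1..p}. w j < q}) = card R + card (w ` {j \<in> {1..p}. w j < q})"
      using R(1) by (intro card_Un_disjoint) auto
    ultimately have "card {1..q} = card R + card (w ` {j \<in> {1..p}. w j < q})" by (simp only:)
    moreover have "card (w ` {j \<in> {1..p}. w j < q}) = card {j \<in> {1..p}. w j < q}"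
      using w_eq by (intro card_image) (simp add: inj_on_def)
    ultimately show ?thesis using R by simp
  qed
  ultimately have eq: "q + height C = p + C" by linarith
  have "Q \<le> q" if PQ: "(P, Q) \<in> rothe n w" "p < P" for P Q
  proof (rule ccontr)
    assume "\<not> Q \<le> q"
    then have Qq: "q < Q" by simp
    have P: "P \<in> {1..n}" "Q < w P" "P < inv w Q" "inv w Q \<le> n" "1 \<le> Q"
      using PQ inv_w_in[of Q] by (auto simp: rothe_def)
    have add_box: "C < code n w j" if "j \<in> {1..n}" "q < w j" "Q < w j" "j < inv w Q" "\<And>c. c \<in> R \<Longrightarrow> j < inv w c" for j
    proof -
      have "insert Q R \<subseteq> row j" using that in_row[OF that(1)] inR P(5) by auto
      then have "card (insert Q R) \<le> code n w j"
        using card_mono[OF finite_row] card_row[OF that(1)] by metis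
      moreover have "Q \<notin> R" using Qq inR by auto
      ultimately show ?thesis using R by simp
    qed
    have "code n w P < C" using last[OF P(1)] PQ(2) by linarith
    then obtain e where e: "e \<in> R" "\<not> P < inv w e" using add_box[OF P(1)] P Qq by fastforce
    have ePn: "inv w e \<noteq> P" using e(1) inR[of e] P Qq inv_w(2)[of e] by auto
    have p'q: "q < w p'" using iff[OF p'(1) p(3)] p'(2) by simp
    have "\<not> Q < w p'"
    proof
      assume "Q < w p'"
      then have "C < code n w p'"
        using add_box[OF p'(1) p'q] P PQ(2) p(3) inR by fastforce
      then show False using p'(2) by simp
    qed
    moreover have "w p' \<noteq> Q" using P PQ(2) p(3) inv_w(1)[of p'] by auto
    ultimately show False
      using pattern[of p' "inv w e" P "inv w Q"] p' p(3) e ePn inR[of e] P p'q inv_w by simp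
  qed
  then show ?thesis using q(1) eq by blast
qed

end

lemma decreasing_nth_iff:
  assumes "sorted_wrt (\<ge>) (xs :: nat list)" "1 \<le> a"
  shows "a \<le> length (filter (\<lambda>c. b \<le> c) xs) \<longleftrightarrow> a \<le> length xs \<and> b \<le> xs ! (a - 1)"
  using assms
proof (induction xs arbitrary: a)
  case (Cons y xs)
  show ?case
  proof (cases "b \<le> y")
    case True
    show ?thesis
    proof (cases "a = 1")
      case False
      then obtain a' where "a = Suc a'" "1 \<le> a'" using Cons.prems by (cases a) auto
      then show ?thesis using Cons True by (cases a') auto
    qed (use True in simp)
  next
    case False
    then have "\<forall>z\<in>set xs. z < b" using Cons.prems by (auto simp: not_le intro: le_less_trans)
    then have e: "filter (\<lambda>c. b \<le> c) xs = []" by (auto simp: filter_empty_conv)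
    have "\<not> b \<le> (y # xs) ! (a - 1)" if "a \<le> length (y # xs)"
    proof -
      have "(y # xs) ! (a - 1) \<in> set (y # xs)" using that Cons.prems by (intro nth_mem) auto
      then show ?thesis using False \<open>\<forall>z\<in>set xs. z < b\<close> by auto
    qed
    then show ?thesis using e False Cons.prems by auto
  qed
qed simp

context vexillary_perm
begin

abbreviation "lam \<equiv> shape n w"

lemma lam_sorted: "sorted_wrt (\<ge>) lam"
  unfolding shape_def by (simp add: sorted_wrt_rev)

lemma mset_lam: "mset lam = mset (filter (\<lambda>c. 0 < c) (map (code n w) [1..<Suc n]))"
  by (simp add: shape_def)

lemma set_lam: "C \<in> set lam \<longleftrightarrow> 1 \<le> C \<and> (\<exists>j\<in>{1..n}. code n w j = C)"
  unfolding set_mset_mset[symmetric] mset_lam by auto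

lemma length_filter_lam: "1 \<le> b \<Longrightarrow> length (filter (\<lambda>c. b \<le> c) lam) = height b"
proof -
  assume b: "1 \<le> b"
  have "length (filter (\<lambda>c. b \<le> c) lam) = size (filter_mset (\<lambda>c. b \<le> c) (mset lam))"
    by (metis mset_filter size_mset)
  also have "\<dots> = length (filter (\<lambda>c. b \<le> c) (filter (\<lambda>c. 0 < c) (map (code n w) [1..<Suc n])))"
    unfolding mset_lam by (metis mset_filter size_mset)
  also have "filter (\<lambda>c. b \<le> c) (filter (\<lambda>c. 0 < c) (map (code n w) [1..<Suc n])) =
      filter (\<lambda>c. b \<le> c) (map (code n w) [1..<Suc n])"
    unfolding filter_filter using b by (intro filter_cong) auto
  also have "length \<dots> = length (filter (\<lambda>j. b \<le> code n w j) [1..<Suc n])"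
    by (simp add: filter_map comp_def del: upt_Suc)
  also have "\<dots> = card (set (filter (\<lambda>j. b \<le> code n w j) [1..<Suc n]))"
    by (intro distinct_card[symmetric]) (simp del: upt_Suc)
  also have "set (filter (\<lambda>j. b \<le> code n w j) [1..<Suc n]) = {j \<in> {1..n}. b \<le> code n w j}"
    by (auto simp del: upt_Suc)
  finally show ?thesis .
qed

lemma cells_iff: "(a, b) \<in> cells lam \<longleftrightarrow> 1 \<le> a \<and> 1 \<le> b \<and> a \<le> height b"
proof (cases "1 \<le> a \<and> 1 \<le> b")
  case True
  then show ?thesis
    using decreasing_nth_iff[OF lam_sorted, of a b] length_filter_lam[of b] by (auto simp: cells_def)
qed (auto simp: cells_def)

lemma height_mono: "b \<le> b' \<Longrightarrow> height b' \<le> height b"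
  by (intro card_mono) auto

lemma card_cells: "card (cells lam) = sum_list lam"
proof -
  have "cells lam = Sigma {1..length lam} (\<lambda>i. {1..lam ! (i - 1)})" by (auto simp: cells_def)
  then have "card (cells lam) = (\<Sum>i\<in>{1..length lam}. lam ! (i - 1))" by simp
  also have "\<dots> = (\<Sum>i\<in>{0..<length lam}. lam ! i)"
    by (rule sum.reindex_bij_witness[of _ Suc "\<lambda>i. i - 1"]) auto
  finally show ?thesis by (simp add: sum_list_sum_nth)
qed

lemma row_end:
  assumes "a \<in> {1..length lam}"
  shows "(a, lam ! (a - 1)) \<in> cells lam" "a \<le> height (lam ! (a - 1))" "lam ! (a - 1) \<in> set lam"
proof -
  show m: "lam ! (a - 1) \<in> set lam" using assms by (intro nth_mem) auto
  then show c: "(a, lam ! (a - 1)) \<in> cells lam" using assms set_lam by (auto simp: cells_def)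
  then show "a \<le> height (lam ! (a - 1))" using cells_iff by simp
qed

lemma flag_entry_bounds:
  assumes a: "a \<in> {1..length lam}"
  defines "C \<equiv> lam ! (a - 1)"
  shows "bottom C + a \<le> flag_entry n w a + height C"
    and "a = height C \<Longrightarrow> flag_entry n w a = bottom C"
proof -
  obtain p' where p': "p' \<in> {1..n}" "code n w p' = C" and C: "1 \<le> C"
    using row_end(3)[OF a] set_lam unfolding C_def by auto
  define p where "p = bottom C"
  define k where "k = height C"
  obtain q where q: "(p, q) \<in> rothe n w" "q + k = p + C" "\<And>P Q. (P, Q) \<in> rothe n w \<Longrightarrow> p < P \<Longrightarrow> Q \<le> q"
    using corner_box[OF p' C] unfolding p_def k_def by blast
  define D where "D i = {r. \<exists>c. (r, c) \<in> mu n w \<and> c + i = r + C}" for i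
  have flag: "flag_entry n w a = Max (D a)" by (simp add: flag_entry_def D_def C_def)
  have finD: "finite (D i)" for i
    by (rule finite_subset[of _ "{..n}"]) (auto simp: D_def mu_iff rothe_def)
  have ak: "a \<le> k" using row_end(2)[OF a] by (simp add: k_def C_def)
  have kp: "k \<le> p"
  proof -
    have "{j \<in> {1..n}. C \<le> code n w j} \<subseteq> {1..p}" using bottom_in(3) by (auto simp: p_def)
    then have "card {j \<in> {1..n}. C \<le> code n w j} \<le> card {1..p}" by (intro card_mono) auto
    then show ?thesis by (simp add: k_def)
  qed
  have "(p - (k - a), q) \<in> mu n w"
  proof -
    have "1 \<le> p - (k - a)" "1 \<le> q" using q(1) a ak kp by (auto simp: rothe_def)
    then show ?thesis unfolding mu_iff using q(1) diff_le_self by blast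
  qed
  moreover have "q + a = p - (k - a) + C" using q(2) ak kp by simp
  ultimately have "p - (k - a) \<in> D a" unfolding D_def by blast
  then have le: "p - (k - a) \<le> flag_entry n w a" unfolding flag using finD by (intro Max_ge)
  show "bottom C + a \<le> flag_entry n w a + height C"
    using le ak kp unfolding p_def[symmetric] k_def[symmetric] by linarith
  assume "a = height C"
  then have akk: "a = k" by (simp add: k_def)
  have "r \<le> p" if rD: "r \<in> D k" for r
  proof (rule ccontr)
    assume "\<not> r \<le> p"
    obtain c P Q where c: "c + k = r + C" "(P, Q) \<in> rothe n w" "r \<le> P" "c \<le> Q"
      using rD by (auto simp: D_def mu_iff)
    then have "Q \<le> q" using q(3) \<open>\<not> r \<le> p\<close> by simp
    then show False using c q(2) \<open>\<not> r \<le> p\<close> by simp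
  qed
  moreover have "D k \<noteq> {}" using \<open>p - (k - a) \<in> D a\<close> akk by auto
  ultimately have "Max (D k) \<le> p" using finD by simp
  then show "flag_entry n w a = bottom C" using le akk unfolding flag p_def[symmetric] by simp
qed

lemma SSYT_eq_flagged_svts:
  "SSYT lam (map (\<lambda>a. a + x) (flag n w)) m = flagged_svts (cells lam) (\<lambda>b. bottom b + x) m"
proof -
  let ?phi = "map (\<lambda>a. a + x) (flag n w)" and ?F = "\<lambda>b. bottom b + x"
  have phi: "?phi ! (a - 1) = flag_entry n w a + x" if "a \<in> {1..length lam}" for a
  proof -
    have "a - 1 < length lam" "Suc (a - 1) = a" using that by auto
    then show ?thesis by (simp add: flag_def del: upt_Suc)
  qed
  have rows: "a \<in> {1..length lam}" "1 \<le> b" "b \<le> lam ! (a - 1)" if "(a, b) \<in> cells lam" for a b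
    using that by (auto simp: cells_def)
  have "set_valued_tableau lam T \<and> flagged lam ?phi T \<longleftrightarrow> flagged_svt (cells lam) ?F T" for T
  proof
    assume *: "set_valued_tableau lam T \<and> flagged lam ?phi T"
    then have T: "\<And>y. y \<in> cells lam \<Longrightarrow> finite (T y) \<and> T y \<noteq> {} \<and> T y \<subseteq> {1..}"
      "\<And>y. y \<notin> cells lam \<Longrightarrow> T y = {}"
      "\<And>i j j'. (i, j) \<in> cells lam \<Longrightarrow> (i, j') \<in> cells lam \<Longrightarrow> j < j' \<Longrightarrow> Max (T (i, j)) \<le> Min (T (i, j'))"
      "\<And>i i' j. (i, j) \<in> cells lam \<Longrightarrow> (i', j) \<in> cells lam \<Longrightarrow> i < i' \<Longrightarrow> Max (T (i, j)) < Min (T (i', j))"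
      "\<And>i j. (i, j) \<in> cells lam \<Longrightarrow> Max (T (i, j)) \<le> ?phi ! (i - 1)"
      unfolding set_valued_tableau_def flagged_def by blast+
    have row: "y \<le> z" if "(a, b) \<in> cells lam" "(a, b') \<in> cells lam" "b < b'" "y \<in> T (a, b)" "z \<in> T (a, b')" for a b b' y z
    proof -
      have "y \<le> Max (T (a, b))" using T(1)[OF that(1)] that by simp
      also have "\<dots> \<le> Min (T (a, b'))" using T(3) that by blast
      also have "\<dots> \<le> z" using T(1)[OF that(2)] that by simp
      finally show ?thesis .
    qed
    have col: "y < z" if "(a, b) \<in> cells lam" "(a', b) \<in> cells lam" "a < a'" "y \<in> T (a, b)" "z \<in> T (a', b)" for a a' b y z
    proof -
      have "y \<le> Max (T (a, b))" using T(1)[OF that(1)] that by simp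
      also have "\<dots> < Min (T (a', b))" using T(4) that by blast
      also have "\<dots> \<le> z" using T(1)[OF that(2)] that by simp
      finally show ?thesis .
    qed
    show "flagged_svt (cells lam) ?F T"
    proof (rule flagged_svtI)
      fix a b y assume ab: "(a, b) \<in> cells lam" "y \<in> T (a, b)"
      define k where "k = height b"
      have ak: "1 \<le> a" "1 \<le> b" "a \<le> k" using ab cells_iff by (auto simp: k_def)
      then have kb: "(k, b) \<in> cells lam" using cells_iff k_def by auto
      define C where "C = lam ! (k - 1)"
      have kl: "k \<in> {1..length lam}" and bC: "b \<le> C" using rows[OF kb] by (auto simp: C_def)
      have kC: "(k, C) \<in> cells lam" "k \<le> height C" using row_end[OF kl] by (auto simp: C_def)
      then have "k = height C" using height_mono[OF bC] by (simp add: k_def)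
      then have fl: "flag_entry n w k = bottom C" using flag_entry_bounds(2)[OF kl] by (simp add: C_def)
      obtain z where z: "z \<in> T (k, C)" using T(1)[OF kC(1)] by auto
      obtain u where u: "u \<in> T (k, b)" using T(1)[OF kb] by auto
      have zle: "z \<le> bottom C + x" if "z \<in> T (k, C)" for z
      proof -
        have "z \<le> Max (T (k, C))" using T(1)[OF kC(1)] that by simp
        also have "\<dots> \<le> ?phi ! (k - 1)" by (rule T(5)[OF kC(1)])
        finally show ?thesis using phi[OF kl] fl by simp
      qed
      have ule: "u \<le> bottom C + x" if "u \<in> T (k, b)" for u
        using row[OF kb kC(1) _ that z] zle[OF z] zle[of u] that bC by (cases "b = C") auto
      have "y \<le> bottom C + x"
        using col[OF ab(1) kb _ ab(2) u] ule[OF u] ule[of y] ab(2) ak(3) by (cases "a = k") auto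
      moreover have "bottom C \<le> bottom b"
      proof -
        have "C \<in> set lam" using row_end(3)[OF kl] by (simp add: C_def)
        then obtain j where j: "j \<in> {1..n}" "C \<le> code n w j" using set_lam by auto
        have "b \<le> code n w (bottom C)" using bottom_in(2)[OF j] bC by simp
        then show ?thesis using bottom_in(3)[OF bottom_in(1)[OF j], of b] by simp
      qed
      ultimately show "y \<le> ?F b" by simp
    next
      fix a b y assume "(a, b) \<in> cells lam" "y \<in> T (a, b)"
      then show "1 \<le> y" using T(1)[of "(a, b)"] by auto
    next
      fix y assume "y \<notin> cells lam" then show "T y = {}" by (rule T(2))
    next
      fix a b assume "(a, b) \<in> cells lam" then show "T (a, b) \<noteq> {}" using T(1)[of "(a, b)"] by simp
    next
      fix a b b' y z
      assume "(a, b) \<in> cells lam" "(a, b') \<in> cells lam" "b < b'" "y \<in> T (a, b)" "z \<in> T (a, b')"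
      then show "y \<le> z" by (rule row)
    next
      fix a a' b y z
      assume "(a, b) \<in> cells lam" "(a', b) \<in> cells lam" "a < a'" "y \<in> T (a, b)" "z \<in> T (a', b)"
      then show "y < z" by (rule col)
    qed
  next
    assume T: "flagged_svt (cells lam) ?F T"
    have fin: "finite (T y)" for y using svt_finite_cell[OF T] .
    have ne: "T y \<noteq> {}" if "y \<in> cells lam" for y using svt_nonempty[OF T] that by (cases y) auto
    have "set_valued_tableau lam T"
      unfolding set_valued_tableau_def
    proof (intro conjI allI impI ballI)
      fix y assume y: "y \<in> cells lam"
      show "T y \<subseteq> {1..}" using svt_pos[OF T] y by (cases y) auto
    next
      fix i j j' assume *: "(i, j) \<in> cells lam \<and> (i, j') \<in> cells lam \<and> j < j'"
      then have "Max (T (i, j)) \<in> T (i, j)" "Min (T (i, j')) \<in> T (i, j')" using fin ne by auto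
      then show "Max (T (i, j)) \<le> Min (T (i, j'))" using svt_row[OF T] * by blast
    next
      fix i i' j assume *: "(i, j) \<in> cells lam \<and> (i', j) \<in> cells lam \<and> i < i'"
      then have "Max (T (i, j)) \<in> T (i, j)" "Min (T (i', j)) \<in> T (i', j)" using fin ne by auto
      then show "Max (T (i, j)) < Min (T (i', j))" using svt_col[OF T] * by blast
    qed (use fin ne svt_outside[OF T] in blast)+
    moreover have "flagged lam ?phi T"
      unfolding flagged_def
    proof clarify
      fix a b assume ab: "(a, b) \<in> cells lam"
      define C where "C = lam ! (a - 1)"
      have al: "a \<in> {1..length lam}" and bC: "b \<le> C" using rows[OF ab] by (auto simp: C_def)
      have aC: "(a, C) \<in> cells lam" "a \<le> height C" using row_end[OF al] by (auto simp: C_def)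
      have down: "z + d \<le> bottom C + x" if "(a' + d, C) \<in> cells lam" "1 \<le> a'" "z \<in> T (a', C)" for a' d z
        using that
      proof (induction d arbitrary: a' z)
        case 0
        then show ?case using svt_le[OF T] by simp
      next
        case (Suc d)
        have c: "(a', C) \<in> cells lam" "(Suc a', C) \<in> cells lam"
          using Suc.prems cells_iff by auto
        obtain z' where z': "z' \<in> T (Suc a', C)" using ne[OF c(2)] by auto
        have "z < z'" using svt_col[OF T c _ Suc.prems(3) z'] by simp
        then show ?case using Suc.IH[of "Suc a'" z'] Suc.prems z' by simp
      qed
      have "(height C, C) \<in> cells lam" using aC cells_iff by auto
      then have zle: "z + (height C - a) \<le> bottom C + x" if "z \<in> T (a, C)" for z
        using down[of a "height C - a" z] that aC(2) al by simp
      have zfl: "z \<le> flag_entry n w a + x" if "z \<in> T (a, C)" for z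
        using zle[OF that] flag_entry_bounds(1)[OF al] aC(2) unfolding C_def[symmetric] by linarith
      obtain z where z: "z \<in> T (a, C)" using ne[OF aC(1)] by auto
      have "y \<le> flag_entry n w a + x" if "y \<in> T (a, b)" for y
        using svt_row[OF T ab aC(1) _ that z] zfl[OF z] zfl[of y] that bC by (cases "b = C") auto
      then have "Max (T (a, b)) \<le> flag_entry n w a + x" using fin ne[OF ab] by simp
      then show "Max (T (a, b)) \<le> ?phi ! (a - 1)" using phi[OF al] by simp
    qed
    ultimately show "set_valued_tableau lam T \<and> flagged lam ?phi T" by simp
  qed
  then show ?thesis unfolding SSYT_def flagged_svts_def by blast
qed

lemma SSYT_empty:
  assumes "m < sum_list lam"
  shows "SSYT lam (map (\<lambda>a. a + x) (flag n w)) m = {}"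
proof -
  have "sum_list lam \<le> (\<Sum>y\<in>cells lam. card (T y))" if T: "flagged_svt (cells lam) F T" for F T
  proof -
    have "(\<Sum>y\<in>cells lam. 1) \<le> (\<Sum>y\<in>cells lam. card (T y))"
    proof (rule sum_mono)
      fix y assume "y \<in> cells lam"
      then have "T y \<noteq> {}" using svt_nonempty[OF T] by (cases y) auto
      then show "1 \<le> card (T y)" using svt_finite_cell[OF T] by (simp add: Suc_le_eq card_gt_0_iff)
    qed
    then show ?thesis using card_cells by simp
  qed
  then show ?thesis using assms unfolding SSYT_eq_flagged_svts flagged_svts_def by (auto simp: not_le[symmetric])
qed

abbreviation "W x \<equiv> shift_perm x w"

lemma w0: "w 0 = 0"
  using permutes_not_in[OF perm, of 0] by simp

lemma W_beyond: "W x p = p" if "p \<le> x \<or> n + x < p"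
proof (cases "p \<le> x")
  case False
  then have "w (p - x) = p - x" using that by (intro permutes_not_in[OF perm]) auto
  then show ?thesis using False by (simp add: shift_perm_def)
qed (simp add: shift_perm_def)

lemma W_add: "W x (x + i) = x + w i"
  using w0 by (rule shift_perm_add)

lemma shift_inv: "W x \<circ> shift_perm x (inv w) = id" "shift_perm x (inv w) \<circ> W x = id"
proof -
  have inv0: "inv w 0 = 0" using inv_w(1)[of 0] w0 by simp
  have gt: "x < shift_perm x g p" if "g permutes {1..n}" "x < p" for g p
  proof -
    have "g 0 = 0" using permutes_not_in[OF that(1), of 0] by simp
    then have "g (p - x) \<noteq> 0" using inj_eq[OF permutes_inj[OF that(1)], of "p - x" 0] that(2) by simp
    then show ?thesis using that by (simp add: shift_perm_def)
  qed
  show "W x \<circ> shift_perm x (inv w) = id"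
  proof
    fix p
    show "(W x \<circ> shift_perm x (inv w)) p = id p"
      using gt[OF permutes_inv[OF perm], of p] inv_w(2)[of "p - x"]
      by (cases "x < p") (auto simp: shift_perm_def)
  qed
  show "shift_perm x (inv w) \<circ> W x = id"
  proof
    fix p
    show "(shift_perm x (inv w) \<circ> W x) p = id p"
      using gt[OF perm, of p] inv_w(1)[of "p - x"]
      by (cases "x < p") (auto simp: shift_perm_def)
  qed
qed

lemma inv_W: "inv (W x) = shift_perm x (inv w)"
  using shift_inv by (intro inv_unique_comp)

lemma W_permutes: "W x permutes {1..<Suc (n + x)}"
  unfolding permutes_def
proof (intro conjI allI impI)
  have "bij (W x)" using shift_inv by (metis o_bij)
  then show "\<exists>!p. W x p = q" for q by (simp add: bij_iff)
  fix p assume "p \<notin> {1..<Suc (n + x)}"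
  then show "W x p = p" using W_beyond[of p x] by auto
qed

lemma W_le: "p \<le> x \<Longrightarrow> p < q \<Longrightarrow> W x p < W x q"
proof -
  assume p: "p \<le> x" "p < q"
  have "w (q - x) \<noteq> 0" if "x < q"
    using that w_eq[of "q - x" 0] w0 by simp
  then show "W x p < W x q" using p by (cases "q \<le> x") (auto simp: shift_perm_def)
qed

lemma avoids_W: "avoids_2143 (W x)"
  unfolding avoids_2143_def
proof
  assume "\<exists>a b c d. a < b \<and> b < c \<and> c < d \<and> W x b < W x a \<and> W x a < W x d \<and> W x d < W x c"
  then obtain a b c d where *: "a < b" "b < c" "c < d" "W x b < W x a" "W x a < W x d" "W x d < W x c" by blast
  have "x < a" using W_le[of a x b] * by (meson leI order.asym)
  then obtain a' where a: "a = x + a'" "1 \<le> a'" by (metis Suc_leI add_diff_inverse_nat less_imp_le not_less zero_less_diff One_nat_def)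
  obtain b' where b: "b = x + b'" using * a by (metis le_add1 le_Suc_ex less_imp_le order_trans)
  obtain c' where c: "c = x + c'" using * b by (metis le_add1 le_Suc_ex less_imp_le order_trans)
  obtain d' where d: "d = x + d'" using * c by (metis le_add1 le_Suc_ex less_imp_le order_trans)
  have dn: "d' \<le> n"
  proof (rule ccontr)
    assume "\<not> d' \<le> n"
    then have "W x d = d" using W_beyond[of d x] d by simp
    moreover have "W x c < d"
    proof (cases "n + x < c")
      case True
      then show ?thesis using W_beyond[of c x] * by simp
    next
      case False
      then have "c \<in> {1..<Suc (n + x)}" using * by auto
      then have "W x c \<in> {1..<Suc (n + x)}" using permutes_in_image[OF W_permutes] by blast
      then show ?thesis using d \<open>\<not> d' \<le> n\<close> by simp
    qed
    ultimately show False using * by simp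
  qed
  show False using pattern[of a' b' c' d'] * dn a unfolding a b c d W_add by simp
qed

lemma lehmer_W: "lehmer (W x) (x + j) = code n w j" if "j \<in> {1..n}"
proof -
  have "{q. x + j < q \<and> W x q < W x (x + j)} = (\<lambda>j. x + j) ` {j' \<in> {1..n}. j < j' \<and> w j' < w j}"
  proof (intro set_eqI iffI)
    fix q assume q: "q \<in> {q. x + j < q \<and> W x q < W x (x + j)}"
    then obtain j' where j': "q = x + j'" using le_Suc_ex[of x q] by auto
    have "j' \<le> n"
    proof (rule ccontr)
      assume "\<not> j' \<le> n"
      then have "w j' = j'" using permutes_not_in[OF perm, of j'] by simp
      then show False using q j' w_in[of j] that \<open>\<not> j' \<le> n\<close> by (auto simp: W_add)
    qed
    then show "q \<in> (\<lambda>j. x + j) ` {j' \<in> {1..n}. j < j' \<and> w j' < w j}" using q j' by (auto simp: W_add)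
  next
    fix q assume "q \<in> (\<lambda>j. x + j) ` {j' \<in> {1..n}. j < j' \<and> w j' < w j}"
    then show "q \<in> {q. x + j < q \<and> W x q < W x (x + j)}" by (auto simp: W_add)
  qed
  then show ?thesis by (simp add: lehmer_def code_def card_image)
qed

lemma lehmer_W_0: "lehmer (W x) p = 0" if "p \<notin> (\<lambda>j. x + j) ` {1..n}"
proof (rule lehmer_eq_0)
  fix q assume q: "p < q"
  show "W x p < W x q"
  proof (cases "p \<le> x")
    case True
    then show ?thesis using W_le q by blast
  next
    case False
    have "n + x < p"
    proof (rule ccontr)
      assume "\<not> n + x < p"
      then have "p = x + (p - x)" "p - x \<in> {1..n}" using False by auto
      then show False using that by blast
    qed
    then show ?thesis using W_beyond[of p x] W_beyond[of q x] q by simp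
  qed
qed

lemma rows_W: "1 \<le> b \<Longrightarrow> {p. b \<le> lehmer (W x) p} = (\<lambda>j. x + j) ` {j \<in> {1..n}. b \<le> code n w j}"
proof (intro set_eqI iffI)
  fix p assume "1 \<le> b" "p \<in> {p. b \<le> lehmer (W x) p}"
  moreover from this have "p \<in> (\<lambda>j. x + j) ` {1..n}" using lehmer_W_0[of p x] by fastforce
  then obtain j where "p = x + j" "j \<in> {1..n}" by blast
  ultimately show "p \<in> (\<lambda>j. x + j) ` {j \<in> {1..n}. b \<le> code n w j}" using lehmer_W[of j x] by simp
next
  fix p assume "p \<in> (\<lambda>j. x + j) ` {j \<in> {1..n}. b \<le> code n w j}"
  then show "p \<in> {p. b \<le> lehmer (W x) p}" using lehmer_W by auto
qed

lemma code_cells_W: "code_cells (lehmer (W x)) = cells lam"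
proof -
  have "card {p. b \<le> lehmer (W x) p} = height b" if "1 \<le> b" for b
    unfolding rows_W[OF that] by (intro card_image) simp
  then have "(a, b) \<in> code_cells (lehmer (W x)) \<longleftrightarrow> (a, b) \<in> cells lam" for a b
    by (auto simp: code_cells_def cells_iff)
  then show ?thesis by auto
qed

lemma last_row_W:
  assumes "(a, b) \<in> cells lam"
  shows "last_row (lehmer (W x)) b = bottom b + x"
proof -
  have b: "1 \<le> b" and "1 \<le> height b" using assms cells_iff by auto
  then have "{j \<in> {1..n}. b \<le> code n w j} \<noteq> {}" by (metis card.empty not_one_le_zero)
  then have "Max ((\<lambda>j. x + j) ` {j \<in> {1..n}. b \<le> code n w j}) = x + Max {j \<in> {1..n}. b \<le> code n w j}"
    by (intro mono_Max_commute[symmetric]) (auto simp: mono_def)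
  then show ?thesis unfolding last_row_def rows_W[OF b] bottom_def by simp
qed

lemma tableau_count_W: "tableau_count (lehmer (W x)) m = card (SSYT lam (map (\<lambda>a. a + x) (flag n w)) m)"
proof -
  have "flagged_svt (cells lam) (last_row (lehmer (W x))) T = flagged_svt (cells lam) (\<lambda>b. bottom b + x) T" for T
    using svt_mono[of "cells lam" "last_row (lehmer (W x))" T "\<lambda>b. bottom b + x"]
      svt_mono[of "cells lam" "\<lambda>b. bottom b + x" T "last_row (lehmer (W x))"] last_row_W by fastforce
  then show ?thesis unfolding tableau_count_def SSYT_eq_flagged_svts flagged_svts_def code_cells_W by simp
qed

end

theorem theorem6p7:
  fixes n x L :: nat and w :: "nat \<Rightarrow> nat" and lam phi :: "nat list"
  assumes "w permutes {1..n}"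
    and "vexillary n w"
    and "lam = shape n w"
    and "x > 0"
    and "phi = map (\<lambda>a. a + x) (flag n w)"
  shows "poly (FK n w L) x =
    (\<Sum>j = sum_list lam..L. card (SSYT lam phi j) * fact j * Stirling L j)"
proof -
  interpret vexillary_perm n w using assms by unfold_locales
  have "int (poly (FK n w L) x) = word_sum n x L (inv w)"
    using assms(1) by (intro poly_FK permutes_bij)
  also have "\<dots> = hecke_sum (Suc (n + x)) L (inv (shift_perm x w))"
    unfolding inv_W by (intro word_sum_eq_hecke_sum permutes_inv assms(1))
  also have "\<dots> = int (surj_sum (tableau_count (lehmer (shift_perm x w))) L)"
    by (rule hecke_sum_eq_tableaux[OF W_permutes avoids_W])
  also have "\<dots> = int (\<Sum>j\<le>L. card (SSYT lam phi j) * surjections L j)"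
    unfolding surj_sum_def tableau_count_W assms(3,5) ..
  finally have "poly (FK n w L) x = (\<Sum>j\<le>L. card (SSYT lam phi j) * surjections L j)"
    by (simp only: of_nat_eq_iff)
  also have "\<dots> = (\<Sum>j = sum_list lam..L. card (SSYT lam phi j) * surjections L j)"
    using SSYT_empty unfolding assms(3,5) by (intro sum.mono_neutral_right) auto
  finally show ?thesis by (simp add: mult.assoc)
qed

end
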